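(* Let $\alpha\in[1,2)$, $f_0\in L^2(0,1)$, $T>0$, $\tau\in(0,T)$ and $s\in(1,2)$. Then there exists a function (flat output) $y\in\mathscr{G}^s([\tau,T])$ such that the control $$u(t)=\begin{cases}0, & t\in[0,\tau],\\[4pt] \displaystyle\sum_{k=0}^{\infty}\frac{y^{(k)}(t)}{(2-\alpha)^{2k}\,k!\,\prod_{j=1}^{k}\left(j+\frac{\alpha-1}{2-\alpha}\right)}, & t\in(\tau,T],\end{cases}$$ steers to zero at time $T$ the weak solution $f$ of $$\begin{cases}\partial_t f(t,x)-\partial_x\left(x^\alpha\partial_x f\right)(t,x)=0, & (t,x)\in(0,T)\times(0,1),\\ (x^\alpha\partial_x f)(t,x)|_{x=0}=0, & t\in(0,T),\\ f(t,1)=u(t), & t\in(0,T),\\ f(0,x)=f_0(x), & x\in(0,1),\end{cases}$$ that is, $f(T,\cdot)=0$ in $L^2(0,1)$. Furthermore, the control $u$ belongs to $\mathscr{G}^s([0,T])$.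
   Context: All functions are real-valued; the empty product ($k=0$) equals $1$. Gevrey class: for $s\in\mathbb{R}^+$ and real $t_1<t_2$, a function $h\in C^\infty([t_1,t_2])$ is Gevrey of order $s$, written $h\in\mathscr{G}^s([t_1,t_2])$, if there exist $M,R>0$ such that $\sup_{t_1\le r\le t_2}|h^{(n)}(r)|\le \frac{M(n!)^s}{R^n}$ for all $n\in\mathbb{N}$. Weak solution: for $f_0\in L^2(0,1)$, $T>0$ and $u\in H^1(0,T)$, a weak solution of the system in the claim is a function $f\in C^0([0,T];L^2(0,1))$ such that for every $t'\in[0,T]$ and every $\psi\in C^1([0,t'];L^2(0,1))\cap C^0([0,t'];H^2(0,1))$ with $(x^\alpha\partial_x\psi)(t,x)|_{x=0}=\psi(t,1)=0$ for all $t\in[0,t']$, one has $$\int_0^{t'}\!\!\int_0^1 f(t,x)\left(\partial_t\psi+\partial_x(x^\alpha\partial_x\psi)\right)(t,x)\,dx\,dt=\int_0^1 f(t',x)\psi(t',x)\,dx-\int_0^1 f_0(x)\psi(0,x)\,dx+\int_0^{t'}u(t)\,\partial_x\psi(t,1)\,dt.$$ *)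

theory Defs
  imports "HOL-Analysis.Analysis"
begin

section \<open>Smooth functions and Gevrey classes\<close>

text \<open>Derivatives are taken within \<open>S\<close>, so they are one-sided at the endpoints of an
  interval \<open>S = {t1..t2}\<close>; for \<open>S = UNIV\<close> they are the ordinary ones.\<close>

definition nth_deriv :: "real set \<Rightarrow> nat \<Rightarrow> (real \<Rightarrow> real) \<Rightarrow> real \<Rightarrow> real" where
  "nth_deriv S n h = ((\<lambda>g t. vector_derivative g (at t within S)) ^^ n) h"

definition C_infty :: "real set \<Rightarrow> (real \<Rightarrow> real) set" where
  "C_infty S = {h. \<forall>n. \<forall>t\<in>S. nth_deriv S n h differentiable (at t within S)}"

definition gevrey :: "real \<Rightarrow> real \<Rightarrow> real \<Rightarrow> (real \<Rightarrow> real) set" where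
  "gevrey s t1 t2 = {h \<in> C_infty {t1..t2}.
     \<exists>M>0. \<exists>R>0. \<forall>n. \<forall>r\<in>{t1..t2}. \<bar>nth_deriv {t1..t2} n h r\<bar> \<le> M * fact n powr s / R ^ n}"

section \<open>Lebesgue and Sobolev spaces on an interval\<close>

text \<open>Elements of \<open>L\<^sup>2(a,b)\<close> and \<open>H\<^sup>k(a,b)\<close> are represented by functions; equality in these
  spaces is equality almost everywhere on \<open>{a<..<b}\<close>. Values outside the interval are irrelevant.\<close>

definition L2 :: "real \<Rightarrow> real \<Rightarrow> (real \<Rightarrow> real) set" where
  "L2 a b = {g \<in> borel_measurable (lebesgue_on {a<..<b}).
     integrable (lebesgue_on {a<..<b}) (\<lambda>x. (g x)\<^sup>2)}"

definition L2_norm :: "real \<Rightarrow> real \<Rightarrow> (real \<Rightarrow> real) \<Rightarrow> real" where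
  "L2_norm a b g = sqrt (LINT x|lebesgue_on {a<..<b}. (g x)\<^sup>2)"

definition test_functions :: "real \<Rightarrow> real \<Rightarrow> (real \<Rightarrow> real) set" where
  "test_functions a b = {\<phi> \<in> C_infty UNIV.
     \<exists>c d. a < c \<and> d < b \<and> (\<forall>x. x \<notin> {c..d} \<longrightarrow> \<phi> x = 0)}"

definition has_weak_deriv ::
  "real \<Rightarrow> real \<Rightarrow> nat \<Rightarrow> (real \<Rightarrow> real) \<Rightarrow> (real \<Rightarrow> real) \<Rightarrow> bool" where
  "has_weak_deriv a b n g h \<longleftrightarrow> (\<forall>\<phi>\<in>test_functions a b.
     (LINT x|lebesgue_on {a<..<b}. g x * nth_deriv UNIV n \<phi> x) =
     (-1) ^ n * (LINT x|lebesgue_on {a<..<b}. h x * \<phi> x))"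

text \<open>The \<open>n\<close>-th weak derivative, when it exists in \<open>L\<^sup>2(a,b)\<close>; it is then determined almost
  everywhere, and an arbitrary representative is chosen.\<close>

definition weak_deriv :: "real \<Rightarrow> real \<Rightarrow> nat \<Rightarrow> (real \<Rightarrow> real) \<Rightarrow> real \<Rightarrow> real" where
  "weak_deriv a b n g = (SOME h. h \<in> L2 a b \<and> has_weak_deriv a b n g h)"

definition Sobolev :: "nat \<Rightarrow> real \<Rightarrow> real \<Rightarrow> (real \<Rightarrow> real) set" where
  "Sobolev k a b = {g \<in> L2 a b. \<forall>n\<le>k. \<exists>h\<in>L2 a b. has_weak_deriv a b n g h}"

definition Sobolev_norm :: "nat \<Rightarrow> real \<Rightarrow> real \<Rightarrow> (real \<Rightarrow> real) \<Rightarrow> real" where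
  "Sobolev_norm k a b g = sqrt (\<Sum>n\<le>k. (L2_norm a b (weak_deriv a b n g))\<^sup>2)"

text \<open>Pointwise value at \<open>c \<in> {a..b}\<close> of the representative of \<open>g\<close> that is continuous on
  \<open>{a..b}\<close>; meaningful only if there is one.\<close>

definition trace :: "real \<Rightarrow> real \<Rightarrow> (real \<Rightarrow> real) \<Rightarrow> real \<Rightarrow> real" where
  "trace a b g c = (THE v. \<exists>G. continuous_on {a..b} G \<and>
     (AE x in lebesgue_on {a<..<b}. G x = g x) \<and> v = G c)"

section \<open>Functions of time with values in function spaces\<close>

definition C0_into :: "real set \<Rightarrow> (real \<Rightarrow> real) set \<Rightarrow> ((real \<Rightarrow> real) \<Rightarrow> real) \<Rightarrow>
    (real \<Rightarrow> real \<Rightarrow> real) set" where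
  "C0_into I X N = {f. (\<forall>t\<in>I. f t \<in> X) \<and>
     (\<forall>t0\<in>I. ((\<lambda>t. N (\<lambda>x. f t x - f t0 x)) \<longlongrightarrow> 0) (at t0 within I))}"

text \<open>\<open>\<psi> \<in> C\<^sup>1(I; L\<^sup>2(a,b))\<close> with time derivative \<open>\<psi>t\<close>.\<close>

definition C1_L2_deriv :: "real set \<Rightarrow> real \<Rightarrow> real \<Rightarrow> (real \<Rightarrow> real \<Rightarrow> real) \<Rightarrow>
    (real \<Rightarrow> real \<Rightarrow> real) \<Rightarrow> bool" where
  "C1_L2_deriv I a b \<psi> \<psi>t \<longleftrightarrow>
     \<psi> \<in> C0_into I (L2 a b) (L2_norm a b) \<and> \<psi>t \<in> C0_into I (L2 a b) (L2_norm a b) \<and>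
     (\<forall>t0\<in>I. ((\<lambda>t. L2_norm a b (\<lambda>x. (\<psi> t x - \<psi> t0 x) / (t - t0) - \<psi>t t0 x)) \<longlongrightarrow> 0)
        (at t0 within I))"

section \<open>Weak solutions of the degenerate heat equation\<close>

definition flux :: "real \<Rightarrow> (real \<Rightarrow> real) \<Rightarrow> real \<Rightarrow> real" where
  "flux \<alpha> g x = x powr \<alpha> * weak_deriv 0 1 1 g x"

definition weak_solution :: "real \<Rightarrow> real \<Rightarrow> (real \<Rightarrow> real) \<Rightarrow> (real \<Rightarrow> real) \<Rightarrow>
    (real \<Rightarrow> real \<Rightarrow> real) \<Rightarrow> bool" where
  "weak_solution \<alpha> T f0 u f \<longleftrightarrow>
     f0 \<in> L2 0 1 \<and> u \<in> Sobolev 1 0 T \<and>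
     f \<in> C0_into {0..T} (L2 0 1) (L2_norm 0 1) \<and>
     (\<forall>t'\<in>{0..T}. \<forall>\<psi> \<psi>t.
        C1_L2_deriv {0..t'} 0 1 \<psi> \<psi>t \<and>
        \<psi> \<in> C0_into {0..t'} (Sobolev 2 0 1) (Sobolev_norm 2 0 1) \<and>
        (\<forall>t\<in>{0..t'}. trace 0 1 (flux \<alpha> (\<psi> t)) 0 = 0 \<and> trace 0 1 (\<psi> t) 1 = 0) \<longrightarrow>
        (LINT t|lebesgue_on {0..t'}. LINT x|lebesgue_on {0<..<1}.
            f t x * (\<psi>t t x + weak_deriv 0 1 1 (flux \<alpha> (\<psi> t)) x)) =
        (LINT x|lebesgue_on {0<..<1}. f t' x * \<psi> t' x) -
        (LINT x|lebesgue_on {0<..<1}. f0 x * \<psi> 0 x) +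
        (LINT t|lebesgue_on {0..t'}. u t * trace 0 1 (weak_deriv 0 1 1 (\<psi> t)) 1))"

end

theory Submission
  imports Defs "HOL-Complex_Analysis.Complex_Analysis"
begin

text \<open>Let \<open>A u = (x\<^sup>\<alpha> u')'\<close> with zero flux at \<open>0\<close> and \<open>u(1) = 0\<close>. Its inverse \<open>- G\<close> is an explicit
  integral operator, bounded, symmetric, positive and injective on \<open>L\<^sup>2(0,1)\<close>. A functional calculus
  for \<open>G\<close>, built from Bernstein polynomials, yields the uncontrolled solution \<open>v(t) = exp(t A) f\<^sub>0\<close>
  together with the bounds \<open>|A\<^sup>n v(t)| \<le> n! / t\<^sup>n |f\<^sub>0|\<close>. Since powers of \<open>G\<close> map \<open>L\<^sup>2\<close> into bounded
  functions, \<open>v(t)\<close> is for \<open>t > 0\<close> the sum of \<open>y\<^sup>(\<^sup>k\<^sup>)(t) P\<^sub>k\<close>, where \<open>y(t) = v(t)(0)\<close> and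
  \<open>P\<^sub>k\<close> is a multiple of \<open>x\<^bsup>(2 - \<alpha>) k\<^esup>\<close>. Multiplying \<open>y\<close> by a Gevrey cutoff that equals \<open>1\<close> near \<open>\<tau>\<close> and
  \<open>0\<close> near \<open>T\<close> gives the flat output, and the same series gives the controlled trajectory, whose
  trace at \<open>x = 1\<close> is the control. A trajectory \<open>F\<close> with boundary value \<open>u\<close> is characterised by
  \<open>F = u - G F'\<close>, from which the weak formulation follows; uniqueness of weak solutions is an
  energy argument with time-independent test functions.\<close>

section \<open>Functional calculus of a positive contraction\<close>

text \<open>No eigenfunctions enter. The only spectral fact needed is that a symbol bounded by M
  gives an operator of norm at most M, and this holds because the Bernstein basis evaluated at a
  positive contraction consists of positive operators with sum the identity. Using G in place of the
  unbounded A avoids domains: A^n v(t) is a sequence linked by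
  \<open>v n t = - G (v (Suc n) t)\<close>. The obstacle is evaluation at the degenerate end:
  \<open>y\<close> is a value at x = 0, meaningless for a class in L2, and G g may be unbounded
  there. Writing v_n through a fixed power G^N repairs this and only replaces n! by (n + N)!. The
  two bounds on s have separate origins: s > 1 admits cutoffs that are constant on intervals, and s
  < 2 makes series with coefficients of size 1 / (k!)^2 converge. The cutoff has to be 1 on a whole
  interval after \<tau>: there the trajectory is the free one, with boundary value 0, so the control
  series vanishes identically near \<tau> and joins the zero control with all derivatives.\<close>

lemma linear_funpow:
  fixes B :: "'a::real_vector \<Rightarrow> 'a"
  assumes "linear B"
  shows "linear (B ^^ k)"
proof (induction k)
  case 0 then show ?case by (simp add: linear_id[unfolded id_def] id_def)
next
  case (Suc k)
  then show ?case using linear_compose[OF Suc assms] by (simp add: o_def)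
qed

text \<open>Quadratic forms only give bounds against \<open>x \<bullet> x + v \<bullet> v\<close>.
  Testing with v = y / M balances the two terms, and half of \<open>y \<bullet> y / M\<close> is
  absorbed on the left.\<close>

lemma norm_le_of_inner_le:
  fixes x y :: "'a::real_inner"
  assumes key: "\<And>v. y \<bullet> v \<le> M * (x \<bullet> x + v \<bullet> v) / 2" and M0: "0 \<le> M"
  shows "norm y \<le> M * norm x"
proof (cases "M = 0")
  case True
  then have "y \<bullet> y \<le> 0" using key[of y] by simp
  then show ?thesis using True by (metis inner_eq_zero_iff inner_ge_zero mult_zero_left norm_zero order_antisym order_refl)
next
  case False
  with M0 have M: "0 < M" by simp
  have "y \<bullet> y / M \<le> M * (x \<bullet> x + y \<bullet> y / M^2) / 2"
    using key[of "y /\<^sub>R M"] M by (simp add: power2_eq_square field_simps)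
  also have "\<dots> = M * (x \<bullet> x) / 2 + y \<bullet> y / M / 2"
    using M by (simp add: field_simps power2_eq_square)
  finally have le: "y \<bullet> y / M \<le> M * (x \<bullet> x) / 2 + y \<bullet> y / M / 2" .
  have "a \<le> b" if "a \<le> b / 2 + a / 2" for a b :: real using that by simp
  from this[OF le] have "y \<bullet> y / M \<le> M * (x \<bullet> x)" .
  then have "y \<bullet> y \<le> M^2 * (x \<bullet> x)" using M by (simp add: field_simps power2_eq_square)
  then have "(norm y)^2 \<le> (M * norm x)^2" by (simp add: power_mult_distrib power2_norm_eq_inner)
  then show ?thesis by (rule power2_le_imp_le) (use M in simp)
qed

text \<open>The bounds 0 \<le> B \<le> 1 are those of forms, so that [0, 1] is the range of the
  spectral variable; the norm bound \<open>norm_B_le\<close> is a consequence.\<close>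

locale positive_contraction =
  fixes B :: "'a::{real_inner,banach} \<Rightarrow> 'a"
  assumes lin: "linear B"
    and sym: "B x \<bullet> y = x \<bullet> B y"
    and nonneg: "0 \<le> B x \<bullet> x"
    and le_one: "B x \<bullet> x \<le> x \<bullet> x"
begin

section \<open>Products of powers of B and 1 - B\<close>

definition D :: "'a \<Rightarrow> 'a" where "D x = x - B x"

lemma lin_D: "linear D"
  unfolding D_def using lin linear_compose_sub[OF linear_id lin] by (simp add: id_def)

lemma D_sym: "D x \<bullet> y = x \<bullet> D y"
  by (simp add: D_def inner_diff_left inner_diff_right sym)

lemma B_D: "B (D x) = D (B x)"
  by (simp add: D_def linear_diff[OF lin])

lemma Bk_D: "(B ^^ k) (D x) = D ((B ^^ k) x)"
  by (induction k arbitrary: x) (simp_all add: B_D)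

lemma B_Dk: "B ((D ^^ k) x) = (D ^^ k) (B x)"
  by (induction k arbitrary: x) (simp_all add: B_D)

definition P :: "nat \<Rightarrow> nat \<Rightarrow> 'a \<Rightarrow> 'a" where "P k j x = (B ^^ k) ((D ^^ j) x)"

lemma lin_P: "linear (P k j)"
  unfolding P_def
  using linear_compose[OF linear_funpow[OF lin_D, of j] linear_funpow[OF lin, of k]] by (simp add: o_def)

lemma P_Suc_B: "P (Suc k) j x = P k j (B x)"
  by (simp add: P_def funpow_swap1 B_Dk)

lemma P_Suc_B': "P (Suc k) j x = B (P k j x)"
  by (simp add: P_def)

lemma P_Suc_D: "P k (Suc j) x = P k j (D x)"
  by (simp add: P_def funpow_swap1)

lemma P_Suc_D': "P k (Suc j) x = D (P k j x)"
  by (simp add: P_def Bk_D)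

lemma P_sym: "P k j x \<bullet> y = x \<bullet> P k j y"
proof (induction k arbitrary: x y)
  case 0
  show ?case
  proof (induction j arbitrary: x y)
    case (Suc j)
    have "P 0 (Suc j) x \<bullet> y = P 0 j x \<bullet> D y" by (simp add: P_Suc_D' D_sym)
    also have "\<dots> = x \<bullet> P 0 (Suc j) y" by (simp add: Suc P_Suc_D)
    finally show ?case .
  qed (simp add: P_def)
next
  case (Suc k)
  have "P (Suc k) j x \<bullet> y = P k j x \<bullet> B y" by (simp add: P_Suc_B' sym)
  also have "\<dots> = x \<bullet> P (Suc k) j y" by (simp add: Suc P_Suc_B)
  finally show ?case .
qed

text \<open>By symmetry two equal factors can be split between the two sides of the inner product,
  which lowers an exponent by 2 until both are at most 1. The mixed case rests on z (1 - z) = z (1 -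
  z)^2 + z^2 (1 - z), where each term is a square around a nonnegative factor.\<close>

lemma P_nonneg: "0 \<le> P k j x \<bullet> x"
proof (induction "k + j" arbitrary: k j x rule: less_induct)
  case less
  consider k' where "k = Suc (Suc k')" | j' where "j = Suc (Suc j')" | "k \<le> 1" "j \<le> 1"
    by (metis One_nat_def add_2_eq_Suc' add.commute le_Suc_ex not_less_eq_eq plus_1_eq_Suc Suc_1)
  then show ?case
  proof cases
    case 1
    then have "P k j x \<bullet> x = P k' j (B x) \<bullet> B x" by (simp add: P_Suc_B' sym P_Suc_B[symmetric])
    then show ?thesis using less[of k' j "B x"] 1 by simp
  next
    case 2
    then have "P k j x \<bullet> x = P k j' (D x) \<bullet> D x" by (simp add: P_Suc_D' D_sym P_Suc_D[symmetric])
    then show ?thesis using less[of k j' "D x"] 2 by simp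
  next
    case 3
    have D0: "0 \<le> D z \<bullet> z" for z using le_one[of z] by (simp add: D_def inner_diff_left)
    have "D z + B z = z" for z by (simp add: D_def)
    then have "B (D x) = B (D (D x)) + B (B (D x))"
      by (simp add: linear_add[OF lin, symmetric])
    then have "B (D x) \<bullet> x = B (D (D x)) \<bullet> x + B (B (D x)) \<bullet> x"
      by (simp add: inner_add_left[symmetric])
    also have "B (D (D x)) \<bullet> x = B (D x) \<bullet> D x" by (simp add: B_D D_sym)
    also have "B (B (D x)) \<bullet> x = D (B x) \<bullet> B x" by (subst sym) (simp only: B_D)
    finally have "B (D x) \<bullet> x = D (B x) \<bullet> B x + B (D x) \<bullet> D x" by simp
    then have "0 \<le> B (D x) \<bullet> x" using D0[of "B x"] nonneg[of "D x"] by simp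
    moreover have "k = 0 \<or> k = 1" "j = 0 \<or> j = 1" using 3 by auto
    ultimately show ?thesis using D0[of x] nonneg[of x] by (auto simp: P_def)
  qed
qed

definition bern :: "nat \<Rightarrow> nat \<Rightarrow> 'a \<Rightarrow> 'a" where
  "bern n k x = real (n choose k) *\<^sub>R P k (n - k) x"

text \<open>Degree elevation: insert 1 = B + (1 - B) and rewrite the binomial coefficients. It
  allows sums of consecutive degrees to be compared in one basis.\<close>

lemma bern_elevate:
  assumes "k \<le> n"
  shows "bern n k x = (real (n + 1 - k) / real (n + 1)) *\<^sub>R bern (Suc n) k x
      + (real (k + 1) / real (n + 1)) *\<^sub>R bern (Suc n) (Suc k) x"
proof -
  have "x = D x + B x" by (simp add: D_def)
  then have "P k (n - k) x = P k (n - k) (D x) + P k (n - k) (B x)"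
    by (metis linear_add lin_P)
  also have "\<dots> = P k (Suc n - k) x + P (Suc k) (Suc n - Suc k) x"
    using assms by (simp add: P_Suc_D P_Suc_B Suc_diff_le)
  finally have P: "P k (n - k) x = P k (Suc n - k) x + P (Suc k) (Suc n - Suc k) x" .
  have "Suc k * (Suc n choose Suc k) = Suc n * (n choose k)"
    by (simp only: Suc_times_binomial_eq mult.commute)
  then have "real (Suc k) * real (Suc n choose Suc k) = real (Suc n) * real (n choose k)"
    by (metis of_nat_mult)
  then have 1: "real (k + 1) / real (n + 1) * real (Suc n choose Suc k) = real (n choose k)"
    by (simp add: field_simps)
  have "(Suc n - k) * (Suc n choose k) = Suc n * (n choose k)"
    using binomial_absorb_comp[of "Suc n" k] by simp
  then have "real (Suc n - k) * real (Suc n choose k) = real (Suc n) * real (n choose k)"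
    by (metis of_nat_mult)
  then have 2: "real (n + 1 - k) / real (n + 1) * real (Suc n choose k) = real (n choose k)"
    by (simp add: field_simps)
  have "bern n k x = real (n choose k) *\<^sub>R P k (Suc n - k) x
      + real (n choose k) *\<^sub>R P (Suc k) (Suc n - Suc k) x"
    unfolding bern_def P by (simp add: scaleR_add_right)
  also have "\<dots> = (real (n + 1 - k) / real (n + 1) * real (Suc n choose k)) *\<^sub>R P k (Suc n - k) x
      + (real (k + 1) / real (n + 1) * real (Suc n choose Suc k)) *\<^sub>R P (Suc k) (Suc n - Suc k) x"
    unfolding 1 2 ..
  finally have E: "bern n k x = (real (n + 1 - k) / real (n + 1) * real (Suc n choose k)) *\<^sub>R P k (Suc n - k) x
      + (real (k + 1) / real (n + 1) * real (Suc n choose Suc k)) *\<^sub>R P (Suc k) (Suc n - Suc k) x" .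
  show ?thesis unfolding E bern_def[of "Suc n"] scaleR_scaleR ..
qed

lemma sum_bern_elevate:
  "(\<Sum>k\<le>n. c k *\<^sub>R bern n k x) =
   (\<Sum>k\<le>Suc n. (real (n + 1 - k) / real (n + 1) * c k + real k / real (n + 1) * c (k - 1)) *\<^sub>R bern (Suc n) k x)"
proof -
  let ?b = "\<lambda>k. bern (Suc n) k x"
  have "(\<Sum>k\<le>n. c k *\<^sub>R bern n k x) = (\<Sum>k\<le>n. (real (n + 1 - k) / real (n + 1) * c k) *\<^sub>R ?b k)
      + (\<Sum>k\<le>n. (real (Suc k) / real (n + 1) * c k) *\<^sub>R ?b (Suc k))"
    unfolding sum.distrib[symmetric]
  proof (rule sum.cong[OF refl])
    fix k assume "k \<in> {..n}"
    then have k: "k \<le> n" by simp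
    show "c k *\<^sub>R bern n k x = (real (n + 1 - k) / real (n + 1) * c k) *\<^sub>R ?b k
        + (real (Suc k) / real (n + 1) * c k) *\<^sub>R ?b (Suc k)"
      unfolding bern_elevate[OF k] scaleR_add_right scaleR_scaleR by (simp only: Suc_eq_plus1 mult.commute)
  qed
  also have "(\<Sum>k\<le>n. (real (n + 1 - k) / real (n + 1) * c k) *\<^sub>R ?b k)
      = (\<Sum>k\<le>Suc n. (real (n + 1 - k) / real (n + 1) * c k) *\<^sub>R ?b k)"
    by simp
  also have "(\<Sum>k\<le>n. (real (Suc k) / real (n + 1) * c k) *\<^sub>R ?b (Suc k))
      = (\<Sum>k\<le>Suc n. (real k / real (n + 1) * c (k - 1)) *\<^sub>R ?b k)"
    by (simp only: sum.atMost_Suc_shift) simp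
  finally show ?thesis by (simp only: sum.distrib[symmetric] scaleR_add_left)
qed

lemma sum_bern: "(\<Sum>k\<le>n. bern n k x) = x"
proof (induction n)
  case 0 show ?case by (simp add: bern_def P_def)
next
  case (Suc n)
  have "real (n + 1 - k) / real (n + 1) * 1 + real k / real (n + 1) * 1 = 1" if "k \<le> Suc n" for k
    using that by (simp add: add_divide_distrib[symmetric] of_nat_diff)
  then have "(\<Sum>k\<le>n. 1 *\<^sub>R bern n k x) = (\<Sum>k\<le>Suc n. bern (Suc n) k x)"
    by (subst sum_bern_elevate[where c = "\<lambda>_. 1"], intro sum.cong[OF refl]) (simp only: atMost_iff scaleR_one)
  then show ?case using Suc by simp
qed

lemma bern_nonneg: "0 \<le> bern n k x \<bullet> x"
  unfolding bern_def by (simp add: P_nonneg)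

text \<open>Polarisation of the semidefinite form at x + y and x - y. The arithmetic-mean version of
  Cauchy-Schwarz is kept because it can be summed over k with \<open>sum_bern\<close>.\<close>

lemma bern_inner_le: "\<bar>bern n k x \<bullet> y\<bar> \<le> (bern n k x \<bullet> x + bern n k y \<bullet> y) / 2"
proof -
  have lin: "linear (bern n k)" unfolding bern_def
    using linear_compose_scale_right[OF lin_P] by blast
  have s: "bern n k y \<bullet> x = bern n k x \<bullet> y"
    using P_sym[of k "n-k" y x] by (simp add: bern_def inner_commute)
  have "0 \<le> bern n k (x + y) \<bullet> (x + y)" "0 \<le> bern n k (x - y) \<bullet> (x - y)"
    by (rule bern_nonneg)+
  then show ?thesis
    by (simp add: linear_add[OF lin] linear_diff[OF lin] inner_simps s)
qed

text \<open>After \<open>bern_inner_le\<close> the sums over k collapse by \<open>sum_bern\<close>,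
  since positive operators with sum the identity are combined. This is how the supremum of a symbol
  controls an operator norm.\<close>

lemma norm_sum_bern_le:
  assumes "\<And>k. k \<le> n \<Longrightarrow> \<bar>c k\<bar> \<le> M"
  shows "norm (\<Sum>k\<le>n. c k *\<^sub>R bern n k x) \<le> M * norm x"
proof -
  let ?y = "\<Sum>k\<le>n. c k *\<^sub>R bern n k x"
  have M0: "0 \<le> M" using assms[of 0] by linarith
  have key: "?y \<bullet> v \<le> M * (x \<bullet> x + v \<bullet> v) / 2" for v
  proof -
    have "?y \<bullet> v = (\<Sum>k\<le>n. c k * (bern n k x \<bullet> v))" by (simp add: inner_sum_left)
    also have "\<dots> \<le> (\<Sum>k\<le>n. M * ((bern n k x \<bullet> x + bern n k v \<bullet> v) / 2))"
    proof (rule sum_mono)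
      fix k assume "k \<in> {..n}"
      then have "\<bar>c k * (bern n k x \<bullet> v)\<bar> \<le> M * ((bern n k x \<bullet> x + bern n k v \<bullet> v) / 2)"
        unfolding abs_mult using assms[of k] bern_inner_le M0 by (intro mult_mono) auto
      then show "c k * (bern n k x \<bullet> v) \<le> M * ((bern n k x \<bullet> x + bern n k v \<bullet> v) / 2)" by linarith
    qed
    also have "\<dots> = M / 2 * ((\<Sum>k\<le>n. bern n k x) \<bullet> x + (\<Sum>k\<le>n. bern n k v) \<bullet> v)"
      by (simp add: inner_sum_left sum_distrib_left sum.distrib[symmetric] field_simps)
    finally show ?thesis by (simp add: sum_bern)
  qed
  show ?thesis by (rule norm_le_of_inner_le[OF key M0])
qed

lemma norm_B_le: "norm (B x) \<le> norm x"
proof -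
  have "(\<Sum>k\<le>1. (real k) *\<^sub>R bern 1 k x) = B x" by (simp add: bern_def P_def)
  then show ?thesis using norm_sum_bern_le[of 1 real 1 x] by simp
qed

lemma bounded_linear_B: "bounded_linear B"
  using lin norm_B_le by (intro bounded_linear_intro[where K=1]) (auto simp: linear_add linear_scale)

definition bernstein :: "(real \<Rightarrow> real) \<Rightarrow> nat \<Rightarrow> 'a \<Rightarrow> 'a" where
  "bernstein f n x = (\<Sum>k\<le>n. f (real k / real n) *\<^sub>R bern n k x)"

end

text \<open>A second-order smoothness condition stated without derivatives, in the form in which
  degree elevation produces it.\<close>

definition chord_bounded :: "(real \<Rightarrow> real) \<Rightarrow> bool" where
  "chord_bounded f \<longleftrightarrow> (\<exists>C. \<forall>x\<in>{0..1}. \<forall>y\<in>{0..1}. \<forall>p\<in>{0..1}.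
     \<bar>(1 - p) * f x + p * f y - f ((1 - p) * x + p * y)\<bar> \<le> C * (x - y)\<^sup>2)"

text \<open>Both f + C x^2 / 2 and - f + C x^2 / 2 are convex on [0, 1], and the chord of x^2
  exceeds its graph by p (1 - p) (x - y)^2.\<close>

lemma chord_boundedI:
  assumes 1: "\<And>x. x \<in> {0..1} \<Longrightarrow> (f has_real_derivative f' x) (at x)"
    and 2: "\<And>x. x \<in> {0..1} \<Longrightarrow> (f' has_real_derivative f'' x) (at x)"
    and 3: "\<And>x. x \<in> {0..1} \<Longrightarrow> \<bar>f'' x\<bar> \<le> C"
  shows "chord_bounded f"
  unfolding chord_bounded_def
proof (intro exI[of _ C] ballI)
  fix x y p :: real assume xy: "x \<in> {0..1}" "y \<in> {0..1}" and p: "p \<in> {0..1}"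
  have C0: "0 \<le> C" using 3[of 0] by auto
  have a: "convex_on {0..1} (\<lambda>x. f x + C / 2 * x^2)"
    by (rule f''_ge0_imp_convex[where f' = "\<lambda>x. f' x + C * x" and f'' = "\<lambda>x. f'' x + C"])
      (use 3 in \<open>auto intro!: derivative_eq_intros 1 2 simp: abs_le_iff algebra_simps\<close>, fastforce)
  have b: "convex_on {0..1} (\<lambda>x. - f x + C / 2 * x^2)"
    by (rule f''_ge0_imp_convex[where f' = "\<lambda>x. - f' x + C * x" and f'' = "\<lambda>x. - f'' x + C"])
      (use 3 in \<open>auto intro!: derivative_eq_intros 1 2 simp: abs_le_iff algebra_simps\<close>)
  let ?z = "(1 - p) * x + p * y"
  have q: "(1 - p) * x^2 + p * y^2 - ?z^2 = p * (1 - p) * (x - y)^2"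
    by (simp add: power2_eq_square algebra_simps)
  have pp: "p * (1 - p) \<le> 1" using p by (metis atLeastAtMost_iff diff_ge_0_iff_ge diff_le_eq le_add_same_cancel1 mult_le_one)
  have pp0: "0 \<le> p * (1 - p)" using p by simp
  have r: "C / 2 * ((1 - p) * x^2 + p * y^2 - ?z^2) \<le> C * (x - y)^2"
    unfolding q using C0 pp pp0
    by (smt (verit) divide_nonneg_nonneg field_sum_of_halves mult.assoc mult_left_le_one_le mult_mono mult_nonneg_nonneg zero_le_power2)
  show "\<bar>(1 - p) * f x + p * f y - f ?z\<bar> \<le> C * (x - y)\<^sup>2"
  proof -
    have "f ?z + C / 2 * ?z^2 \<le> (1 - p) * (f x + C / 2 * x^2) + p * (f y + C / 2 * y^2)"
      using convex_onD[OF a, of p x y] xy p by simp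
    then have 1: "f ?z - ((1 - p) * f x + p * f y) \<le> C / 2 * ((1 - p) * x^2 + p * y^2 - ?z^2)"
      by (simp add: algebra_simps diff_divide_distrib add_divide_distrib)
    have "- f ?z + C / 2 * ?z^2 \<le> (1 - p) * (- f x + C / 2 * x^2) + p * (- f y + C / 2 * y^2)"
      using convex_onD[OF b, of p x y] xy p by simp
    then have 2: "((1 - p) * f x + p * f y) - f ?z \<le> C / 2 * ((1 - p) * x^2 + p * y^2 - ?z^2)"
      by (simp add: algebra_simps diff_divide_distrib add_divide_distrib)
    from 1 2 r show ?thesis by (simp only: abs_le_iff) linarith
  qed
qed

section \<open>Convergence of Bernstein operators and the resulting calculus\<close>

context positive_contraction begin

text \<open>Degree elevation turns \<open>f (k / n)\<close> into the value at \<open>k / (n + 1)\<close> of a chord of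
  \<open>f\<close> over an interval of length \<open>1 / n\<close>, so consecutive Bernstein operators differ by \<open>O(1 / n\<^sup>2)\<close>.\<close>

lemma bernstein_diff_le:
  assumes C: "\<forall>x\<in>{0..1}. \<forall>y\<in>{0..1}. \<forall>p\<in>{0..1}.
     \<bar>(1 - p) * f x + p * f y - f ((1 - p) * x + p * y)\<bar> \<le> C * (x - y)\<^sup>2" and n: "0 < n"
  shows "norm (bernstein f (Suc n) x - bernstein f n x) \<le> C * (1 / real n)^2 * norm x"
proof -
  have "\<bar>(1 - 0) * f 0 + 0 * f 1 - f ((1 - 0) * 0 + 0 * 1)\<bar> \<le> C * (0 - 1)\<^sup>2"
    by (rule C[rule_format]) auto
  then have C0: "0 \<le> C" by simp
  have "bernstein f n x - bernstein f (Suc n) x =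
    (\<Sum>k\<le>Suc n. (real (n + 1 - k) / real (n + 1) * f (real k / real n)
        + real k / real (n + 1) * f (real (k - 1) / real n) - f (real k / real (Suc n))) *\<^sub>R bern (Suc n) k x)"
    unfolding bernstein_def sum_bern_elevate[where n = n] by (simp only: sum_subtractf[symmetric] scaleR_diff_left)
  also have "norm \<dots> \<le> C * (1 / real n)^2 * norm x"
  proof (rule norm_sum_bern_le)
    fix k assume k: "k \<le> Suc n"
    let ?p = "real k / real (n + 1)"
    have 1: "real (n + 1 - k) / real (n + 1) = 1 - ?p" using k by (simp add: field_simps of_nat_diff)
    consider "k = 0" | "k = Suc n" | "1 \<le> k" "k \<le> n" using k by linarith
    then show "\<bar>real (n + 1 - k) / real (n + 1) * f (real k / real n)
        + real k / real (n + 1) * f (real (k - 1) / real n) - f (real k / real (Suc n))\<bar> \<le> C * (1 / real n)^2"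
    proof cases
      case 3
      have e: "(1 - p) * (a / m) + p * ((a - 1) / m) = (a - p) / m" for p a m :: real
        by (simp add: add_divide_distrib[symmetric]) (simp add: algebra_simps)
      have "real (k - 1) = real k - 1" using 3 by (simp add: of_nat_diff)
      moreover have "real k - ?p = real k * real n / real (Suc n)" by (simp add: field_simps)
      ultimately have "(1 - ?p) * (real k / real n) + ?p * (real (k - 1) / real n) = real k / real (Suc n)"
        using n by (simp only: e) simp
      moreover have "real k / real n - real (k - 1) / real n = 1 / real n"
        using 3 by (simp add: diff_divide_distrib[symmetric] of_nat_diff)
      moreover have "real k / real n \<in> {0..1}" "real (k - 1) / real n \<in> {0..1}" "?p \<in> {0..1}"
        using 3 n by (auto simp: field_simps of_nat_diff)
      ultimately show ?thesis unfolding 1 using C by metis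
    qed (use n C0 in auto)
  qed
  finally show ?thesis by (simp add: norm_minus_commute)
qed

text \<open>Successive differences are O(1 / n^2), hence summable, and the sequence is their
  telescoping sum.\<close>

lemma bernstein_convergent:
  assumes "chord_bounded f"
  shows "convergent (\<lambda>n. bernstein f n x)"
proof -
  obtain C where C: "\<forall>x\<in>{0..1}. \<forall>y\<in>{0..1}. \<forall>p\<in>{0..1}.
     \<bar>(1 - p) * f x + p * f y - f ((1 - p) * x + p * y)\<bar> \<le> C * (x - y)\<^sup>2"
    using assms unfolding chord_bounded_def by auto
  let ?X = "\<lambda>n. bernstein f n x"
  have "summable (\<lambda>n. inverse (real n ^ 2))"
    by (rule inverse_power_summable) simp
  then have "summable (\<lambda>n. C * norm x * inverse (real n ^ 2))"
    by (rule summable_mult)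
  then have "summable (\<lambda>n. ?X (Suc n) - ?X n)"
  proof (rule summable_comparison_test')
    fix n :: nat assume "1 \<le> n"
    then show "norm (?X (Suc n) - ?X n) \<le> C * norm x * inverse (real n ^ 2)"
      using bernstein_diff_le[OF C, of n x] by (simp add: power_one_over field_simps)
  qed
  then have "convergent (\<lambda>n. \<Sum>i<n. ?X (Suc i) - ?X i)"
    by (simp add: summable_iff_convergent)
  then have c: "convergent (\<lambda>n. (?X n - ?X 0))" by (simp only: sum_lessThan_telescope[where f = ?X])
  show ?thesis using convergent_add[OF c convergent_const[of "?X 0"]] by simp
qed

definition calc :: "(real \<Rightarrow> real) \<Rightarrow> 'a \<Rightarrow> 'a" where
  "calc f x = lim (\<lambda>n. bernstein f n x)"

lemma calc_lim: "chord_bounded f \<Longrightarrow> (\<lambda>n. bernstein f n x) \<longlonglongrightarrow> calc f x"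
  unfolding calc_def using bernstein_convergent convergent_LIMSEQ_iff by blast

lemma bernstein_le:
  assumes "\<And>x. x \<in> {0..1} \<Longrightarrow> \<bar>f x\<bar> \<le> M"
  shows "norm (bernstein f n x) \<le> M * norm x"
  unfolding bernstein_def
  \<comment> \<open>For n = 0 the node is 0 / 0 = 0, which still lies in [0, 1].\<close>
  by (rule norm_sum_bern_le, rule assms) (auto simp: divide_le_eq)

text \<open>Three symbols at once are what a first-order Taylor remainder in time requires: two
  times and one derivative. Bounding the combined symbol keeps the cancellation that separate bounds
  would lose.\<close>

lemma norm_calc_combine_le:
  assumes "chord_bounded f" "chord_bounded g" "chord_bounded h"
    and "\<And>z. z \<in> {0..1} \<Longrightarrow> \<bar>f z + b * g z + c * h z\<bar> \<le> M"
  shows "norm (calc f x + b *\<^sub>R calc g x + c *\<^sub>R calc h x) \<le> M * norm x"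
proof -
  have "(\<lambda>n. bernstein f n x + b *\<^sub>R bernstein g n x + c *\<^sub>R bernstein h n x)
      \<longlonglongrightarrow> calc f x + b *\<^sub>R calc g x + c *\<^sub>R calc h x"
    by (intro tendsto_intros calc_lim assms)
  moreover have "bernstein f n x + b *\<^sub>R bernstein g n x + c *\<^sub>R bernstein h n x
      = bernstein (\<lambda>z. f z + b * g z + c * h z) n x" for n
    by (simp add: bernstein_def scaleR_add_left sum.distrib scaleR_sum_right)
  ultimately have "(\<lambda>n. bernstein (\<lambda>z. f z + b * g z + c * h z) n x)
      \<longlonglongrightarrow> calc f x + b *\<^sub>R calc g x + c *\<^sub>R calc h x" by simp
  then show ?thesis
    by (intro LIMSEQ_le_const2[OF tendsto_norm]) (auto intro!: bernstein_le assms)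
qed

lemma norm_calc_le:
  assumes "chord_bounded f" "\<And>z. z \<in> {0..1} \<Longrightarrow> \<bar>f z\<bar> \<le> M"
  shows "norm (calc f x) \<le> M * norm x"
  using norm_calc_combine_le[OF assms(1) assms(1) assms(1), of 0 0 M x] assms(2) by simp

text \<open>Applying B to a Bernstein operator of degree n gives one of degree n + 1 with node (k -
  1) / n in place of k / (n + 1). The nodes differ by at most 1 / n, so the Lipschitz bound makes
  the error vanish. Multiplication by the variable is the only product of symbols that is
  used.\<close>

lemma calc_mult_id:
  assumes f: "chord_bounded f" and xf: "chord_bounded (\<lambda>x. x * f x)"
    and L: "\<And>x y. x \<in> {0..1} \<Longrightarrow> y \<in> {0..1} \<Longrightarrow> \<bar>f x - f y\<bar> \<le> L * \<bar>x - y\<bar>"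
  shows "calc (\<lambda>x. x * f x) u = B (calc f u)"
proof -
  have L0: "0 \<le> L" using L[of 0 1] by simp
  have B1: "B (bernstein f n u) = (\<Sum>k\<le>Suc n. (real k / real (Suc n) * f (real (k - 1) / real n)) *\<^sub>R bern (Suc n) k u)" for n
  proof -
    have "B (bern n k u) = (real (Suc k) / real (Suc n)) *\<^sub>R bern (Suc n) (Suc k) u" for k
    proof -
      have "Suc k * (Suc n choose Suc k) = Suc n * (n choose k)"
        by (simp only: Suc_times_binomial_eq mult.commute)
      then have "real (Suc k) * real (Suc n choose Suc k) = real (Suc n) * real (n choose k)"
        by (metis of_nat_mult)
      then have "real (Suc k) / real (Suc n) * real (Suc n choose Suc k) = real (n choose k)"
        by (simp add: field_simps)
      then show ?thesis
        unfolding bern_def by (simp only: scaleR_scaleR linear_scale[OF lin] P_Suc_B' diff_Suc_Suc)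
    qed
    then have "B (bernstein f n u)
        = (\<Sum>k\<le>n. (real (Suc k) / real (Suc n) * f (real k / real n)) *\<^sub>R bern (Suc n) (Suc k) u)"
      unfolding bernstein_def linear_sum[OF lin] by (simp add: linear_scale[OF lin] mult.commute)
    then show ?thesis by (simp only: sum.atMost_Suc_shift) simp
  qed
  have le: "norm (bernstein (\<lambda>x. x * f x) (Suc n) u - B (bernstein f n u)) \<le> L / real n * norm u" if n: "0 < n" for n
  proof -
    have "bernstein (\<lambda>x. x * f x) (Suc n) u - B (bernstein f n u)
      = (\<Sum>k\<le>Suc n. (real k / real (Suc n) * f (real k / real (Suc n))
          - real k / real (Suc n) * f (real (k - 1) / real n)) *\<^sub>R bern (Suc n) k u)"
      unfolding B1 unfolding bernstein_def by (simp only: sum_subtractf[symmetric] scaleR_diff_left)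
    also have "norm \<dots> \<le> L / real n * norm u"
    proof (rule norm_sum_bern_le)
      fix k assume k: "k \<le> Suc n"
      show "\<bar>real k / real (Suc n) * f (real k / real (Suc n)) - real k / real (Suc n) * f (real (k - 1) / real n)\<bar> \<le> L / real n"
      proof (cases "k = 0")
        case True then show ?thesis using L0 by simp
      next
        case False
        have "\<bar>f (real k / real (Suc n)) - f (real (k - 1) / real n)\<bar>
            \<le> L * \<bar>real k / real (Suc n) - real (k - 1) / real n\<bar>"
          using k n False by (intro L) (auto simp: divide_le_eq)
        also have "\<bar>real k / real (Suc n) - real (k - 1) / real n\<bar> \<le> 1 / real n"
        proof -
          have "real k / real (Suc n) - real (k - 1) / real n = (real (Suc n) - real k) / (real n * real (Suc n))"
            using False n by (simp add: field_simps of_nat_diff)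
          moreover have "0 \<le> (real (Suc n) - real k) / (real n * real (Suc n))"
            using k by simp
          moreover have "(real (Suc n) - real k) / (real n * real (Suc n)) \<le> real (Suc n) / (real n * real (Suc n))"
            by (intro divide_right_mono) auto
          moreover have "real (Suc n) / (real n * real (Suc n)) = 1 / real n" by simp
          ultimately show ?thesis by linarith
        qed
        finally have 1: "\<bar>f (real k / real (Suc n)) - f (real (k - 1) / real n)\<bar> \<le> L / real n"
          using L0 by (simp add: mult_left_mono)
        have "\<bar>real k / real (Suc n) * (f (real k / real (Suc n)) - f (real (k - 1) / real n))\<bar> \<le> 1 * (L / real n)"
          unfolding abs_mult using k by (intro mult_mono 1) (auto simp: divide_le_eq)
        then show ?thesis by (simp add: right_diff_distrib)
      qed
    qed
    finally show ?thesis .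
  qed
  have "(\<lambda>n. bernstein (\<lambda>x. x * f x) (Suc n) u - B (bernstein f n u)) \<longlonglongrightarrow> 0"
  proof (rule Lim_null_comparison)
    show "\<forall>\<^sub>F n in sequentially. norm (bernstein (\<lambda>x. x * f x) (Suc n) u - B (bernstein f n u)) \<le> L / real n * norm u"
      using eventually_gt_at_top[of 0] by eventually_elim (rule le)
    have "(\<lambda>n. inverse (real n)) \<longlonglongrightarrow> 0" by (rule lim_inverse_n)
    from tendsto_mult[OF tendsto_mult[OF tendsto_const[of L] this] tendsto_const[of "norm u"]]
    show "(\<lambda>n. L / real n * norm u) \<longlonglongrightarrow> 0" by (simp add: divide_inverse)
  qed
  moreover have "(\<lambda>n. bernstein (\<lambda>x. x * f x) (Suc n) u - B (bernstein f n u)) \<longlonglongrightarrow> calc (\<lambda>x. x * f x) u - B (calc f u)"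
    by (intro tendsto_diff bounded_linear.tendsto[OF bounded_linear_B] calc_lim f
        LIMSEQ_Suc[OF calc_lim] xf)
  ultimately show ?thesis using LIMSEQ_unique by fastforce
qed

lemma calc_B:
  assumes f: "chord_bounded f"
  shows "calc f (B u) = B (calc f u)"
proof -
  have "bernstein f n (B u) = B (bernstein f n u)" for n
    unfolding bernstein_def bern_def linear_sum[OF lin]
    by (simp add: linear_scale[OF lin] P_Suc_B[symmetric] P_Suc_B')
  then have "(\<lambda>n. B (bernstein f n u)) \<longlonglongrightarrow> calc f (B u)" using calc_lim[OF f, of "B u"] by simp
  moreover have "(\<lambda>n. B (bernstein f n u)) \<longlonglongrightarrow> B (calc f u)"
    by (intro bounded_linear.tendsto[OF bounded_linear_B] calc_lim f)
  ultimately show ?thesis by (rule LIMSEQ_unique)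
qed

lemma calc_diff_arg:
  assumes f: "chord_bounded f"
  shows "calc f (u - w) = calc f u - calc f w"
proof -
  have "bernstein f n (u - w) = bernstein f n u - bernstein f n w" for n
    unfolding bernstein_def bern_def
    by (simp add: linear_diff[OF lin_P] scaleR_diff_right sum_subtractf)
  then have "(\<lambda>n. bernstein f n (u - w)) \<longlonglongrightarrow> calc f u - calc f w"
    using tendsto_diff[OF calc_lim[OF f, of u] calc_lim[OF f, of w]] by simp
  then show ?thesis using LIMSEQ_unique calc_lim[OF f] by blast
qed

text \<open>The sequence \<open>D\<^sup>n u\<close> is Cauchy because \<open>D\<^sup>n u \<bullet> u\<close> decreases; its limit is annihilated by \<open>B\<close>.\<close>

lemma D_pow_tendsto_0:
  assumes inj: "\<And>x. B x = 0 \<Longrightarrow> x = 0"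
  shows "(\<lambda>n. (D ^^ n) u) \<longlonglongrightarrow> 0"
proof -
  define a where "a n = (D ^^ n) u \<bullet> u" for n
  have aP: "a n = P 0 n u \<bullet> u" for n by (simp add: a_def P_def)
  have a0: "0 \<le> a n" for n unfolding aP by (rule P_nonneg)
  have dec: "a (Suc n) \<le> a n" for n
  proof -
    have "a n - a (Suc n) = P 1 n u \<bullet> u"
      by (simp add: aP P_def D_def inner_diff_left)
    then show ?thesis using P_nonneg[of 1 n u] by simp
  qed
  have "\<exists>l. a \<longlonglongrightarrow> l"
  proof -
    have "decseq a" using dec by (simp add: decseq_Suc_iff)
    moreover have "bdd_below (range a)" using a0 by (auto intro!: bdd_belowI)
    ultimately show ?thesis using LIMSEQ_decseq_INF by blast
  qed
  then obtain l where l: "a \<longlonglongrightarrow> l" ..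
  \<comment> \<open>Moving powers across the inner product leaves a value depending on n + m only,
    so distances between iterates are combinations of values of \<open>a\<close>.\<close>
  have in2: "(D ^^ n) u \<bullet> (D ^^ m) u = a (n + m)" for n m
    using P_sym[of 0 n u "(D ^^ m) u"] by (simp add: P_def a_def funpow_add inner_commute)
  have d2: "(norm ((D ^^ n) u - (D ^^ m) u))^2 = a (n + n) + a (m + m) - 2 * a (n + m)" for n m
    unfolding power2_norm_eq_inner by (simp add: inner_simps in2 add.commute)
  have "Cauchy (\<lambda>n. (D ^^ n) u)"
  proof (rule CauchyI)
    fix e :: real assume e: "0 < e"
    then have "0 < e^2 / 4" by simp
    then obtain N where N: "\<And>n. n \<ge> N \<Longrightarrow> \<bar>a n - l\<bar> < e^2 / 4"
      using l unfolding LIMSEQ_def dist_real_def by blast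
    have "norm ((D ^^ m) u - (D ^^ n) u) < e" if "N \<le> m" "N \<le> n" for m n
    proof -
      have "\<bar>a (m + m) - l\<bar> < e^2/4" "\<bar>a (n + n) - l\<bar> < e^2/4" "\<bar>a (m + n) - l\<bar> < e^2/4"
        by (rule N, use that in linarith)+
      then have "(norm ((D ^^ m) u - (D ^^ n) u))^2 < e^2" unfolding d2 by linarith
      then show ?thesis using e by (simp add: power2_less_imp_less)
    qed
    then show "\<exists>M. \<forall>m\<ge>M. \<forall>n\<ge>M. norm ((D ^^ m) u - (D ^^ n) u) < e" by blast
  qed
  then obtain r where r: "(\<lambda>n. (D ^^ n) u) \<longlonglongrightarrow> r" using Cauchy_convergent convergent_def by blast
  have "(\<lambda>n. (D ^^ n) u - (D ^^ Suc n) u) \<longlonglongrightarrow> r - r"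
    by (intro tendsto_diff r LIMSEQ_Suc)
  moreover have "(D ^^ n) u - (D ^^ Suc n) u = B ((D ^^ n) u)" for n by (simp add: D_def)
  ultimately have "(\<lambda>n. B ((D ^^ n) u)) \<longlonglongrightarrow> 0" by simp
  moreover have "(\<lambda>n. B ((D ^^ n) u)) \<longlonglongrightarrow> B r"
    by (rule bounded_linear.tendsto[OF bounded_linear_B r])
  ultimately have "B r = 0" using LIMSEQ_unique by blast
  then show ?thesis using r inj by blast
qed

text \<open>By telescoping, \<open>u - (D ^^ n) u\<close> lies in the range of B, and
  \<open>(D ^^ n) u\<close> tends to 0.\<close>

lemma range_dense:
  assumes inj: "\<And>x. B x = 0 \<Longrightarrow> x = 0" and e: "0 < e"
  shows "\<exists>w. norm (u - B w) < e"
proof -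
  obtain n where n: "norm ((D ^^ n) u) < e"
    using LIMSEQ_D[OF D_pow_tendsto_0[OF inj, of u] e] by auto
  have "\<exists>w. u - (D ^^ n) u = B w"
  proof (induction n)
    case 0 show ?case by (intro exI[of _ 0]) (simp add: linear_0[OF lin])
  next
    case (Suc n)
    then obtain w where "u - (D ^^ n) u = B w" by blast
    then have "u - (D ^^ Suc n) u = B (w + (D ^^ n) u)"
      by (simp add: D_def linear_add[OF lin] algebra_simps)
    then show ?case by blast
  qed
  then show ?thesis using n by (metis diff_diff_eq2 add_diff_cancel_left')
qed

end

section \<open>The heat semigroup of a positive operator\<close>

text \<open>If \<open>x\<close> is the spectral variable of \<open>(- A)\<^sup>-\<^sup>1\<close>, this is the symbol of \<open>(- A)\<^sup>m exp (t A)\<close>.\<close>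

definition heat_symbol :: "nat \<Rightarrow> real \<Rightarrow> real \<Rightarrow> real" where
  "heat_symbol m t x = (if x \<le> 0 then 0 else exp (- t / x) / x ^ m)"

lemma power_fact_le_exp:
  fixes z :: real
  assumes "0 \<le> z"
  shows "z ^ n / fact n \<le> exp z"
proof -
  have "(\<Sum>i\<in>{n}. z ^ i /\<^sub>R fact i) \<le> exp z"
    unfolding exp_def by (rule sum_le_suminf[OF summable_exp_generic]) (use assms in auto)
  then show ?thesis by (simp add: divide_inverse mult.commute)
qed

text \<open>The exponential series of t / x contains (t / x)^m / m!, which bounds exp (- t / x) /
  x^m by m! / t^m. These factorials are the origin of the analytic-type bounds on the free
  evolution.\<close>

lemma heat_symbol_bounds:
  assumes "0 < t"
  shows "0 \<le> heat_symbol m t x" "heat_symbol m t x \<le> fact m / t ^ m"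
proof -
  show "0 \<le> heat_symbol m t x" by (simp add: heat_symbol_def)
  show "heat_symbol m t x \<le> fact m / t ^ m"
  proof (cases "x \<le> 0")
    case False
    then have x: "0 < x" by simp
    have "(t / x) ^ m / fact m \<le> exp (t / x)" using x assms by (intro power_fact_le_exp) simp
    then have "exp (- (t / x)) / x ^ m \<le> fact m / t ^ m"
      using x assms by (simp add: exp_minus field_simps power_divide)
    then show ?thesis using False by (simp add: heat_symbol_def)
  qed (use assms in \<open>simp add: heat_symbol_def\<close>)
qed

lemma abs_heat_symbol_le: "0 < t \<Longrightarrow> \<bar>heat_symbol m t x\<bar> \<le> fact m / t ^ m"
  using heat_symbol_bounds[of t m x] by simp

lemma heat_symbol_Suc: "x * heat_symbol (Suc m) t x = heat_symbol m t x"
  by (simp add: heat_symbol_def)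

text \<open>Used at the flat point 0, where the two branches of \<open>heat_symbol\<close>, and
  later of \<open>flat\<close>, meet.\<close>

lemma DERIV_zero_of_quadratic_bound:
  fixes f :: "real \<Rightarrow> real"
  assumes "f 0 = 0" and "\<And>x. \<bar>f x\<bar> \<le> K * x\<^sup>2"
  shows "(f has_real_derivative 0) (at 0)"
  unfolding DERIV_def
proof (rule Lim_null_comparison)
  show "\<forall>\<^sub>F h in at 0. norm ((f (0 + h) - f 0) / h) \<le> \<bar>K\<bar> * \<bar>h\<bar>"
    unfolding eventually_at_filter
  proof (intro always_eventually allI impI)
    fix h :: real assume h: "h \<noteq> 0"
    have "\<bar>f h\<bar> \<le> \<bar>K\<bar> * h\<^sup>2" using assms(2)[of h] by (smt (verit) mult_right_mono zero_le_power2)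
    then have "\<bar>f h\<bar> \<le> \<bar>K\<bar> * \<bar>h\<bar> * \<bar>h\<bar>" by (simp add: power2_eq_square)
    then show "norm ((f (0 + h) - f 0) / h) \<le> \<bar>K\<bar> * \<bar>h\<bar>"
      using h assms(1) by (simp add: pos_divide_le_eq)
  qed
  show "((\<lambda>h. \<bar>K\<bar> * \<bar>h\<bar>) \<longlongrightarrow> 0) (at 0)"
    by (auto intro!: tendsto_eq_intros)
qed

text \<open>The derivative in x stays within the family, with larger m, so
  \<open>abs_heat_symbol_le\<close> bounds derivatives of every order.\<close>

lemma heat_symbol_deriv:
  assumes t: "0 < t"
  shows "(heat_symbol m t has_real_derivative - real m * heat_symbol (Suc m) t x + t * heat_symbol (m + 2) t x) (at x)"
proof -
  consider "x < 0" | "x = 0" | "0 < x" by linarith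
  then show ?thesis
  proof cases
    case 1
    have "((\<lambda>_. 0) has_real_derivative 0) (at x)" by simp
    then have "(heat_symbol m t has_real_derivative 0) (at x)"
      by (rule has_field_derivative_transform_within_open[of _ _ _ "{..<0}"])
        (use 1 in \<open>auto simp: heat_symbol_def\<close>)
    then show ?thesis using 1 by (simp add: heat_symbol_def)
  next
    case 2
    have "(heat_symbol m t has_real_derivative 0) (at 0)"
    proof (rule DERIV_zero_of_quadratic_bound)
      fix x :: real
      \<comment> \<open>Two powers of x are traded for a larger index, whose symbol is still
        bounded.\<close>
      have "heat_symbol m t x = x\<^sup>2 * heat_symbol (m + 2) t x"
        by (simp add: heat_symbol_def power2_eq_square)
      then show "\<bar>heat_symbol m t x\<bar> \<le> fact (m + 2) / t ^ (m + 2) * x\<^sup>2"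
        using mult_left_mono[OF abs_heat_symbol_le[OF t, of "m + 2" x] zero_le_power2[of x]]
        by (simp only: abs_mult abs_power2 mult.commute)
    qed (simp add: heat_symbol_def)
    then show ?thesis using 2 by (simp add: heat_symbol_def)
  next
    case 3
    have "((\<lambda>x. exp (- t / x) / x ^ m) has_real_derivative - real m * heat_symbol (Suc m) t x + t * heat_symbol (m + 2) t x) (at x)"
    proof -
      have "((\<lambda>x. x ^ m) has_real_derivative real m * x ^ m / x) (at x)"
        using DERIV_pow[of m x UNIV] 3 by (cases m) auto
      moreover have "((\<lambda>x. exp (- t / x)) has_real_derivative exp (- t / x) * (t / x\<^sup>2)) (at x)"
        using 3 by (auto intro!: derivative_eq_intros simp: power2_eq_square)
      ultimately show ?thesis
        using 3 by (intro DERIV_cong[OF DERIV_divide]) (auto simp: heat_symbol_def field_simps power2_eq_square)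
    qed
    then show ?thesis
      by (rule has_field_derivative_transform_within_open[of _ _ _ "{0<..}"])
        (use 3 in \<open>auto simp: heat_symbol_def\<close>)
  qed
qed

lemma heat_symbol_lipschitz:
  assumes t: "0 < t"
  shows "\<exists>L. \<forall>x y. \<bar>heat_symbol m t x - heat_symbol m t y\<bar> \<le> L * \<bar>x - y\<bar>"
proof (intro exI allI)
  fix x y :: real
  have "norm (heat_symbol m t x - heat_symbol m t y)
      \<le> (real m * (fact (Suc m) / t ^ Suc m) + t * (fact (m + 2) / t ^ (m + 2))) * norm (x - y)"
  proof (rule field_differentiable_bound[OF convex_UNIV])
    fix z
    show "(heat_symbol m t has_field_derivative - real m * heat_symbol (Suc m) t z + t * heat_symbol (m + 2) t z) (at z within UNIV)"
      using heat_symbol_deriv[OF t] by simp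
    have "\<bar>real m * heat_symbol (Suc m) t z\<bar> \<le> real m * (fact (Suc m) / t ^ Suc m)"
      unfolding abs_mult using abs_heat_symbol_le[OF t, of "Suc m" z] by (intro mult_mono) auto
    moreover have "\<bar>t * heat_symbol (m + 2) t z\<bar> \<le> t * (fact (m + 2) / t ^ (m + 2))"
      unfolding abs_mult using abs_heat_symbol_le[OF t, of "m + 2" z] t by (intro mult_mono) auto
    ultimately show "norm (- real m * heat_symbol (Suc m) t z + t * heat_symbol (m + 2) t z)
      \<le> real m * (fact (Suc m) / t ^ Suc m) + t * (fact (m + 2) / t ^ (m + 2))"
      unfolding real_norm_def by linarith
  qed auto
  then show "\<bar>heat_symbol m t x - heat_symbol m t y\<bar>
    \<le> (real m * (fact (Suc m) / t ^ Suc m) + t * (fact (m + 2) / t ^ (m + 2))) * \<bar>x - y\<bar>"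
    unfolding real_norm_def .
qed

lemma chord_bounded_heat_symbol:
  assumes t: "0 < t"
  shows "chord_bounded (heat_symbol m t)"
proof (rule chord_boundedI)
  show "(heat_symbol m t has_real_derivative - real m * heat_symbol (Suc m) t x + t * heat_symbol (m + 2) t x) (at x)" for x
    by (rule heat_symbol_deriv[OF t])
  show "((\<lambda>x. - real m * heat_symbol (Suc m) t x + t * heat_symbol (m + 2) t x) has_real_derivative
     - real m * (- real (Suc m) * heat_symbol (Suc (Suc m)) t x + t * heat_symbol (Suc m + 2) t x)
     + t * (- real (m + 2) * heat_symbol (Suc (m + 2)) t x + t * heat_symbol (m + 2 + 2) t x)) (at x)" for x
    by (intro DERIV_add DERIV_cmult heat_symbol_deriv t)
  fix x
  let ?c = "\<lambda>j. fact j / t ^ j :: real"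
  have 1: "\<bar>a * heat_symbol j t x\<bar> \<le> \<bar>a\<bar> * ?c j" for a j
    unfolding abs_mult using abs_heat_symbol_le[OF t, of j x] by (intro mult_mono) auto
  have "- real m * (- real (Suc m) * heat_symbol (Suc (Suc m)) t x + t * heat_symbol (Suc m + 2) t x)
     + t * (- real (m + 2) * heat_symbol (Suc (m + 2)) t x + t * heat_symbol (m + 2 + 2) t x)
   = (real m * real (Suc m)) * heat_symbol (m + 2) t x + (- real m * t) * heat_symbol (m + 3) t x
     + (- t * real (m + 2)) * heat_symbol (m + 3) t x + (t * t) * heat_symbol (m + 4) t x"
  proof -
    have idx: "Suc (Suc m) = m + 2" "Suc m + 2 = m + 3" "Suc (m + 2) = m + 3" "m + 2 + 2 = m + 4" by simp_all
    have "- a * (- b * X + t * Y) + t * (- d * Y + t * Z) = (a * b) * X + (- a * t) * Y + (- t * d) * Y + (t * t) * Z"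
      for a b d X Y Z :: real by (simp add: algebra_simps)
    then show ?thesis unfolding idx .
  qed
  moreover have tri: "\<bar>p + q + r + w\<bar> \<le> P' + Q + R + W"
    if "\<bar>p\<bar> \<le> P'" "\<bar>q\<bar> \<le> Q" "\<bar>r\<bar> \<le> R" "\<bar>w\<bar> \<le> W" for p q r w P' Q R W :: real using that by linarith
  ultimately show "\<bar>- real m * (- real (Suc m) * heat_symbol (Suc (Suc m)) t x + t * heat_symbol (Suc m + 2) t x)
     + t * (- real (m + 2) * heat_symbol (Suc (m + 2)) t x + t * heat_symbol (m + 2 + 2) t x)\<bar>
     \<le> \<bar>real m * real (Suc m)\<bar> * ?c (m + 2) + \<bar>- real m * t\<bar> * ?c (m + 3)
      + \<bar>- t * real (m + 2)\<bar> * ?c (m + 3) + \<bar>t * t\<bar> * ?c (m + 4)"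
    by (simp only:) (intro tri 1)
qed

lemma chord_bounded_id: "chord_bounded (\<lambda>x. x)"
  by (rule chord_boundedI[where f' = "\<lambda>_. 1" and f'' = "\<lambda>_. 0" and C = 0]) auto

lemma chord_bounded_const: "chord_bounded (\<lambda>x. c)"
  by (rule chord_boundedI[where f' = "\<lambda>_. 0" and f'' = "\<lambda>_. 0" and C = 0]) auto

text \<open>This product would be the symbol of index - 1, outside the family, so its two
  derivatives are computed separately.\<close>

lemma chord_bounded_id_heat_symbol:
  assumes t: "0 < t"
  shows "chord_bounded (\<lambda>x. x * heat_symbol 0 t x)"
proof (rule chord_boundedI)
  show "((\<lambda>x. x * heat_symbol 0 t x) has_real_derivative heat_symbol 0 t x + t * heat_symbol 1 t x) (at x)" for x
    by (rule derivative_eq_intros heat_symbol_deriv[OF t] refl)+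
      (simp add: heat_symbol_def power2_eq_square)
  show "((\<lambda>x. heat_symbol 0 t x + t * heat_symbol 1 t x) has_real_derivative
     (- real 0 * heat_symbol (Suc 0) t x + t * heat_symbol (0 + 2) t x)
     + t * (- real 1 * heat_symbol (Suc 1) t x + t * heat_symbol (1 + 2) t x)) (at x)" for x
    by (intro DERIV_add DERIV_cmult heat_symbol_deriv t)
  fix x
  have "(- real 0 * heat_symbol (Suc 0) t x + t * heat_symbol (0 + 2) t x)
     + t * (- real 1 * heat_symbol (Suc 1) t x + t * heat_symbol (1 + 2) t x) = t^2 * heat_symbol 3 t x"
    by (simp add: algebra_simps numeral_eq_Suc)
  then show "\<bar>(- real 0 * heat_symbol (Suc 0) t x + t * heat_symbol (0 + 2) t x)
     + t * (- real 1 * heat_symbol (Suc 1) t x + t * heat_symbol (1 + 2) t x)\<bar> \<le> t^2 * (fact 3 / t ^ 3)"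
    using abs_heat_symbol_le[OF t, of 3 x] by (simp only: abs_mult abs_power2 mult_left_mono[OF _ zero_le_power2])
qed

lemma taylor_quadratic_bound:
  fixes h :: "real \<Rightarrow> real"
  assumes S: "convex S" and 1: "\<And>x. x \<in> S \<Longrightarrow> (h has_real_derivative h' x) (at x within S)"
    and 2: "\<And>x. x \<in> S \<Longrightarrow> (h' has_real_derivative h'' x) (at x within S)"
    and 3: "\<And>x. x \<in> S \<Longrightarrow> \<bar>h'' x\<bar> \<le> K" and xy: "x \<in> S" "y \<in> S"
  shows "\<bar>h y - h x - (y - x) * h' x\<bar> \<le> K * (y - x)\<^sup>2"
proof -
  have K: "0 \<le> K" using 3[OF xy(1)] by linarith
  define R where "R = closed_segment x y"
  have R: "R \<subseteq> S" using xy S by (simp add: R_def closed_segment_subset)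
  have cR: "convex R" "x \<in> R" "y \<in> R" by (auto simp: R_def)
  have d: "norm (h' z - h' x) \<le> K * norm (z - x)" if "z \<in> R" for z
    by (rule field_differentiable_bound[OF cR(1)])
      (use R 2 3 that cR in \<open>auto intro: DERIV_subset\<close>)
  have "norm ((h y - y * h' x) - (h x - x * h' x)) \<le> (K * norm (y - x)) * norm (y - x)"
  proof (rule field_differentiable_bound[OF cR(1), where f = "\<lambda>z. h z - z * h' x" and f' = "\<lambda>z. h' z - h' x"])
    fix z assume z: "z \<in> R"
    have "(h has_real_derivative h' z) (at z within R)" using 1 R z by (auto intro: DERIV_subset)
    then show "((\<lambda>z. h z - z * h' x) has_field_derivative h' z - h' x) (at z within R)"
      by (auto intro!: derivative_eq_intros)
    have "norm (z - x) \<le> norm (y - x)"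
      using z segment_bound1[of z x y] by (simp add: R_def norm_minus_commute)
    then show "norm (h' z - h' x) \<le> K * norm (y - x)"
      using d[OF z] K by (meson mult_left_mono order_trans)
  qed (use cR in auto)
  then show ?thesis by (simp add: algebra_simps power2_eq_square)
qed

text \<open>In time, the derivative of the symbol of index m is minus the one of index m + 1. The
  remainder is uniform in x because all times involved stay above r.\<close>

lemma heat_symbol_taylor_time:
  assumes "0 < r" "r \<le> t" "r \<le> s"
  shows "\<bar>heat_symbol m s x - heat_symbol m t x + (s - t) * heat_symbol (Suc m) t x\<bar>
    \<le> fact (m + 2) / r ^ (m + 2) * (s - t)\<^sup>2"
proof (cases "x \<le> 0")
  case True then show ?thesis using assms by (simp add: heat_symbol_def)
next
  case False
  then have x: "0 < x" by simp
  have d: "((\<lambda>t. heat_symbol m t x) has_real_derivative - heat_symbol (Suc m) t x) (at t within S)" for m t S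
    unfolding heat_symbol_def using x by (auto intro!: derivative_eq_intros)
  have "\<bar>heat_symbol m s x - heat_symbol m t x - (s - t) * (- heat_symbol (Suc m) t x)\<bar>
    \<le> fact (m + 2) / r ^ (m + 2) * (s - t)\<^sup>2"
  proof (rule taylor_quadratic_bound[where S = "{r..}" and h = "\<lambda>t. heat_symbol m t x"
        and h' = "\<lambda>t. - heat_symbol (Suc m) t x" and h'' = "\<lambda>t. heat_symbol (m + 2) t x"])
    fix z assume z: "z \<in> {r..}"
    show "((\<lambda>t. - heat_symbol (Suc m) t x) has_real_derivative heat_symbol (m + 2) z x) (at z within {r..})"
      using DERIV_minus[OF d[of "Suc m"]] by (simp add: numeral_2_eq_2)
    have "\<bar>heat_symbol (m + 2) z x\<bar> \<le> fact (m + 2) / z ^ (m + 2)"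
      by (rule abs_heat_symbol_le) (use z assms in auto)
    also have "\<dots> \<le> fact (m + 2) / r ^ (m + 2)"
      using z assms by (intro divide_left_mono power_mono mult_pos_pos zero_less_power) auto
    finally show "\<bar>heat_symbol (m + 2) z x\<bar> \<le> fact (m + 2) / r ^ (m + 2)" .
  qed (use assms d in auto)
  then show ?thesis by simp
qed

lemma has_vector_derivative_of_quadratic_bound:
  fixes F :: "real \<Rightarrow> 'a::real_normed_vector"
  assumes e: "0 < e" and K: "\<And>s. \<bar>s - t\<bar> < e \<Longrightarrow> norm (F s - F t - (s - t) *\<^sub>R F') \<le> K * (s - t)\<^sup>2"
  shows "(F has_vector_derivative F') (at t)"
  unfolding has_vector_derivative_def has_derivative_iff_norm
proof (rule conjI[OF bounded_linear_scaleR_left], rule Lim_null_comparison)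
  show "\<forall>\<^sub>F s in at t. norm (norm (F s - F t - (s - t) *\<^sub>R F') / norm (s - t)) \<le> \<bar>K\<bar> * \<bar>s - t\<bar>"
    unfolding eventually_at
  proof (intro exI[of _ e] conjI ballI impI)
    fix s assume "s \<noteq> t \<and> dist s t < e"
    then have s: "s \<noteq> t" "\<bar>s - t\<bar> < e" by (auto simp: dist_real_def)
    have "norm (F s - F t - (s - t) *\<^sub>R F') \<le> K * (s - t)\<^sup>2"
      using K[OF s(2)] .
    also have "\<dots> \<le> \<bar>K\<bar> * (s - t)\<^sup>2" by (intro mult_right_mono) auto
    also have "\<dots> = \<bar>K\<bar> * \<bar>s - t\<bar> * \<bar>s - t\<bar>" by (simp add: power2_eq_square)
    finally have "norm (F s - F t - (s - t) *\<^sub>R F') / \<bar>s - t\<bar> \<le> \<bar>K\<bar> * \<bar>s - t\<bar>"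
      using s by (simp only: pos_divide_le_eq zero_less_abs_iff right_minus_eq not_False_eq_True)
    then show "norm (norm (F s - F t - (s - t) *\<^sub>R F') / norm (s - t)) \<le> \<bar>K\<bar> * \<bar>s - t\<bar>"
      by (simp add: mult.commute)
  qed (rule e)
  show "((\<lambda>s. \<bar>K\<bar> * \<bar>s - t\<bar>) \<longlongrightarrow> 0) (at t)"
    by (auto intro!: tendsto_eq_intros)
qed

context positive_contraction begin

definition heat :: "nat \<Rightarrow> real \<Rightarrow> 'a \<Rightarrow> 'a" where
  "heat m t u = calc (heat_symbol m t) u"

lemma norm_heat_le: "0 < t \<Longrightarrow> norm (heat m t u) \<le> fact m / t ^ m * norm u"
  unfolding heat_def by (intro norm_calc_le chord_bounded_heat_symbol abs_heat_symbol_le)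

lemma B_heat: "0 < t \<Longrightarrow> B (heat (Suc m) t u) = heat m t u"
proof -
  assume t: "0 < t"
  obtain L where "\<forall>x y. \<bar>heat_symbol (Suc m) t x - heat_symbol (Suc m) t y\<bar> \<le> L * \<bar>x - y\<bar>"
    using heat_symbol_lipschitz[OF t] by blast
  then have "calc (\<lambda>x. x * heat_symbol (Suc m) t x) u = B (calc (heat_symbol (Suc m) t) u)"
    by (intro calc_mult_id[where L = L]) (auto simp: heat_symbol_Suc intro!: chord_bounded_heat_symbol t)
  then show ?thesis by (simp add: heat_def heat_symbol_Suc)
qed

lemma heat_deriv:
  assumes t: "0 < t"
  shows "((\<lambda>t. heat m t u) has_vector_derivative - heat (Suc m) t u) (at t)"
\<comment> \<open>Times within t / 2 of t stay above t / 2, where the second time derivative of the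
  symbol is uniformly bounded.\<close>
proof (rule has_vector_derivative_of_quadratic_bound[where e = "t / 2"
      and K = "fact (m + 2) / (t / 2) ^ (m + 2) * norm u"])
  fix s assume "\<bar>s - t\<bar> < t / 2"
  then have s: "t / 2 \<le> s" "0 < s" using t by linarith+
  have "norm (calc (heat_symbol m s) u + (- 1) *\<^sub>R calc (heat_symbol m t) u
     + (s - t) *\<^sub>R calc (heat_symbol (Suc m) t) u) \<le> (fact (m + 2) / (t / 2) ^ (m + 2) * (s - t)\<^sup>2) * norm u"
  proof (intro norm_calc_combine_le chord_bounded_heat_symbol)
    show "\<bar>heat_symbol m s z + - 1 * heat_symbol m t z + (s - t) * heat_symbol (Suc m) t z\<bar>
      \<le> fact (m + 2) / (t / 2) ^ (m + 2) * (s - t)\<^sup>2" for z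
      using heat_symbol_taylor_time[of "t / 2" t s m z] s t by simp
  qed (use s t in auto)
  then show "norm (heat m s u - heat m t u - (s - t) *\<^sub>R - heat (Suc m) t u)
    \<le> fact (m + 2) / (t / 2) ^ (m + 2) * norm u * (s - t)\<^sup>2"
    by (simp add: heat_def mult_ac)
qed (use t in auto)

text \<open>The operators are contractions, so it suffices to treat the dense range of B; there the
  symbol x exp (- t / x) differs from x by at most t.\<close>

lemma heat_at_0:
  assumes inj: "\<And>x. B x = 0 \<Longrightarrow> x = 0"
  shows "((\<lambda>t. heat 0 t u) \<longlongrightarrow> u) (at_right 0)"
proof (rule tendstoI)
  fix e :: real assume e: "0 < e"
  obtain w where w: "norm (u - B w) < e / 3" using range_dense[OF inj, of "e / 3" u] e by auto
  have nw: "0 < norm w + 1" by (simp add: add_nonneg_pos)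
  have d: "0 < e / 3 / (norm w + 1)" using e nw by simp
  have "dist (heat 0 t u) u < e" if t: "0 < t" "t < e / 3 / (norm w + 1)" for t
  proof -
    have 1: "norm (heat 0 t u - heat 0 t (B w)) \<le> norm (u - B w)"
      using norm_heat_le[of t 0 "u - B w"] t
      by (simp add: heat_def calc_diff_arg chord_bounded_heat_symbol)
    obtain L where L: "\<forall>x y. \<bar>heat_symbol 0 t x - heat_symbol 0 t y\<bar> \<le> L * \<bar>x - y\<bar>"
      using heat_symbol_lipschitz[OF t(1)] by blast
    have a: "calc (\<lambda>x. x * heat_symbol 0 t x) w = heat 0 t (B w)"
      using L by (subst calc_mult_id[where L = L])
        (auto simp: heat_def calc_B[OF chord_bounded_heat_symbol[OF t(1)]] intro!: chord_bounded_heat_symbol chord_bounded_id_heat_symbol t)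
    have b0: "calc (\<lambda>_. 1) w = w"
      using calc_lim[OF chord_bounded_const, of 1 w]
      by (simp add: bernstein_def sum_bern LIMSEQ_const_iff)
    have b: "calc (\<lambda>x. x) w = B w"
      using calc_mult_id[OF chord_bounded_const[of 1], of 0 w] chord_bounded_id b0 by simp
    have "norm (calc (\<lambda>x. x * heat_symbol 0 t x) w + (- 1) *\<^sub>R calc (\<lambda>x. x) w + 0 *\<^sub>R calc (\<lambda>x. x) w) \<le> t * norm w"
    proof (intro norm_calc_combine_le chord_bounded_id_heat_symbol chord_bounded_id t)
      fix z :: real assume "z \<in> {0..1}"
      show "\<bar>z * heat_symbol 0 t z + - 1 * z + 0 * z\<bar> \<le> t"
      proof (cases "z \<le> 0")
        case True then show ?thesis using \<open>z \<in> {0..1}\<close> t by (simp add: heat_symbol_def)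
      next
        case False
        then have z: "0 < z" by simp
        have "1 - t / z \<le> exp (- t / z)" using exp_ge_add_one_self[of "- t / z"] by simp
        then have "z * (1 - t / z) \<le> z * exp (- t / z)" using z by (intro mult_left_mono) auto
        moreover have "z * (1 - t / z) = z - t" using z by (simp add: field_simps)
        moreover have "z * exp (- t / z) \<le> z" using z t by (simp add: mult_left_le)
        ultimately show ?thesis using z by (simp add: heat_symbol_def abs_le_iff)
      qed
    qed
    then have 2: "norm (heat 0 t (B w) - B w) \<le> t * norm w" by (simp add: a b)
    have "t * norm w \<le> t * (norm w + 1)" using t by simp
    also have "\<dots> < e / 3" using t(2) unfolding pos_less_divide_eq[OF nw] .
    finally have 3: "t * norm w < e / 3" .
    have tri: "norm (p + q - r) \<le> norm p + norm q + norm r" for p q r :: 'a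
      using norm_triangle_ineq4[of "p + q" r] norm_triangle_ineq[of p q] by linarith
    have "norm (heat 0 t u - u) \<le> norm (heat 0 t u - heat 0 t (B w)) + norm (heat 0 t (B w) - B w) + norm (u - B w)"
      using tri[of "heat 0 t u - heat 0 t (B w)" "heat 0 t (B w) - B w" "u - B w"] by simp
    then show ?thesis using 1 2 3 w by (simp add: dist_norm)
  qed
  then show "\<forall>\<^sub>F t in at_right 0. dist (heat 0 t u) u < e"
    unfolding eventually_at_right_field using d by blast
qed

end

text \<open>\<open>v n t\<close> stands for A^n exp (t A) u, with A the negative inverse of G. The
  factor c makes G a contraction; time is scaled by the same c, and the powers of - c undo the
  scaling of G in A^n.\<close>

theorem heat_chain_exists:
  fixes G :: "'a::{real_inner,banach} \<Rightarrow> 'a"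
  assumes linG: "linear G" and sym: "\<And>x y. G x \<bullet> y = x \<bullet> G y"
    and nonneg: "\<And>x. 0 \<le> G x \<bullet> x" and c: "0 < c" and le: "\<And>x. c * (G x \<bullet> x) \<le> x \<bullet> x"
    and inj: "\<And>x. G x = 0 \<Longrightarrow> x = 0"
  obtains v :: "nat \<Rightarrow> real \<Rightarrow> 'a"
  where "\<And>n t. 0 < t \<Longrightarrow> (v n has_vector_derivative v (Suc n) t) (at t)"
    and "\<And>n t. 0 < t \<Longrightarrow> v n t = - G (v (Suc n) t)"
    and "\<And>n t. 0 < t \<Longrightarrow> norm (v n t) \<le> fact n / t ^ n * norm u"
    and "(v 0 \<longlongrightarrow> u) (at_right 0)"
proof -
  interpret positive_contraction "\<lambda>x. c *\<^sub>R G x"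
    using linear_compose_scale_right[OF linG, of c] c le nonneg sym
    by (intro positive_contraction.intro) auto
  define v where "v n t = (- c) ^ n *\<^sub>R heat n (c * t) u" for n t
  show thesis
  proof (rule that[of v])
    fix n and t :: real assume t: "0 < t"
    then have ct: "0 < c * t" using c by simp
    have "((*) c has_vector_derivative c) (at t)"
      by (auto intro!: derivative_eq_intros simp: has_real_derivative_iff_has_vector_derivative[symmetric])
    from vector_diff_chain_at[OF this heat_deriv[OF ct, of n u]]
    have "((\<lambda>t. heat n (c * t) u) has_vector_derivative c *\<^sub>R - heat (Suc n) (c * t) u) (at t)"
      by (simp add: o_def)
    from has_vector_derivative_scaleR[OF DERIV_const this, of "(- c) ^ n"]
    show "(v n has_vector_derivative v (Suc n) t) (at t)"
      unfolding v_def[abs_def] by (simp add: mult.commute)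
    show "v n t = - G (v (Suc n) t)"
    proof -
      have "G (v (Suc n) t) = ((- c) ^ n * (- c)) *\<^sub>R G (heat (Suc n) (c * t) u)"
        by (simp add: v_def linear_scale[OF linG] linear_neg[OF linG] mult.commute)
      also have "\<dots> = - ((- c) ^ n *\<^sub>R (c *\<^sub>R G (heat (Suc n) (c * t) u)))" by simp
      finally show ?thesis unfolding B_heat[OF ct] by (simp add: v_def)
    qed
    have "norm (v n t) = c ^ n * norm (heat n (c * t) u)" using c by (simp add: v_def power_abs)
    also have "\<dots> \<le> c ^ n * (fact n / (c * t) ^ n * norm u)"
      using c by (intro mult_left_mono norm_heat_le ct) auto
    also have "\<dots> = fact n / t ^ n * norm u" using c t by (simp add: power_mult_distrib)
    finally show "norm (v n t) \<le> fact n / t ^ n * norm u" .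
  next
    have "\<forall>\<^sub>F t in at_right 0. c * t \<in> {0<..} \<and> c * t \<noteq> 0"
      using c unfolding eventually_at_filter by (intro always_eventually) auto
    moreover have "((\<lambda>t. c * t) \<longlongrightarrow> c * 0) (at_right 0)"
      by (intro tendsto_intros)
    ultimately have "filterlim ((*) c) (at_right 0) (at_right 0)"
      unfolding filterlim_at by simp
    from filterlim_compose[OF heat_at_0 this]
    have "((\<lambda>t. heat 0 (c * t) u) \<longlongrightarrow> u) (at_right 0)"
      using inj c by force
    then show "(v 0 \<longlongrightarrow> u) (at_right 0)" by (simp add: v_def[abs_def])
  qed
qed

section \<open>The Hilbert space of square integrable functions\<close>

abbreviation I01 :: "real measure" where "I01 \<equiv> lebesgue_on {0<..<1}"

lemma finite_measure_interval: "finite_measure (lebesgue_on {a<..<b::real})"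
  by (rule finite_measure_lebesgue_on) simp

lemma L2_measurable [measurable_dest]: "f \<in> L2 a b \<Longrightarrow> f \<in> borel_measurable (lebesgue_on {a<..<b})"
  by (simp add: L2_def)

lemma L2_integrable_square: "f \<in> L2 a b \<Longrightarrow> integrable (lebesgue_on {a<..<b}) (\<lambda>x. (f x)\<^sup>2)"
  by (simp add: L2_def)

lemma L2_integrable_mult:
  assumes f: "f \<in> L2 a b" and g: "g \<in> L2 a b"
  shows "integrable (lebesgue_on {a<..<b}) (\<lambda>x. f x * g x)"
proof (rule Bochner_Integration.integrable_bound)
  show "integrable (lebesgue_on {a<..<b}) (\<lambda>x. (f x)\<^sup>2 + (g x)\<^sup>2)"
    by (intro Bochner_Integration.integrable_add L2_integrable_square f g)
  show "(\<lambda>x. f x * g x) \<in> borel_measurable (lebesgue_on {a<..<b})"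
    using f g by measurable
  show "AE x in lebesgue_on {a<..<b}. norm (f x * g x) \<le> norm ((f x)\<^sup>2 + (g x)\<^sup>2)"
  proof (intro AE_I2)
    fix x
    have "2 * \<bar>f x\<bar> * \<bar>g x\<bar> \<le> (f x)\<^sup>2 + (g x)\<^sup>2" using sum_squares_bound[of "\<bar>f x\<bar>" "\<bar>g x\<bar>"] by simp
    moreover have "0 \<le> \<bar>f x\<bar> * \<bar>g x\<bar>" by simp
    ultimately have "\<bar>f x\<bar> * \<bar>g x\<bar> \<le> (f x)\<^sup>2 + (g x)\<^sup>2" by linarith
    then show "norm (f x * g x) \<le> norm ((f x)\<^sup>2 + (g x)\<^sup>2)" by (simp add: abs_mult)
  qed
qed

lemma L2_add: 
  assumes f: "f \<in> L2 a b" and g: "g \<in> L2 a b"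
  shows "(\<lambda>x. f x + g x) \<in> L2 a b"
proof -
  have "integrable (lebesgue_on {a<..<b}) (\<lambda>x. (f x)\<^sup>2 + (g x)\<^sup>2 + 2 * (f x * g x))"
    by (intro Bochner_Integration.integrable_add L2_integrable_square integrable_mult_right L2_integrable_mult f g)
  then have "integrable (lebesgue_on {a<..<b}) (\<lambda>x. (f x + g x)\<^sup>2)"
    by (simp add: power2_sum mult.assoc)
  moreover have "(\<lambda>x. f x + g x) \<in> borel_measurable (lebesgue_on {a<..<b})" using f g by measurable
  ultimately show ?thesis by (simp add: L2_def)
qed

lemma L2_cmult: 
  assumes f: "f \<in> L2 a b"
  shows "(\<lambda>x. c * f x) \<in> L2 a b"
proof -
  have "(\<lambda>x. c * f x) \<in> borel_measurable (lebesgue_on {a<..<b})" using f by measurable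
  then show ?thesis using L2_integrable_square[OF f] by (simp add: L2_def power_mult_distrib)
qed

lemma L2_uminus: "f \<in> L2 a b \<Longrightarrow> (\<lambda>x. - f x) \<in> L2 a b"
  using L2_cmult[of f a b "-1"] by simp

lemma L2_diff: "f \<in> L2 a b \<Longrightarrow> g \<in> L2 a b \<Longrightarrow> (\<lambda>x. f x - g x) \<in> L2 a b"
  using L2_add[OF _ L2_uminus, of f a b g] by simp

lemma L2_dominated:
  assumes f: "f \<in> L2 a b" and g: "g \<in> borel_measurable (lebesgue_on {a<..<b})"
    and le: "AE x in lebesgue_on {a<..<b}. \<bar>g x\<bar> \<le> C * \<bar>f x\<bar>"
  shows "g \<in> L2 a b"
proof -
  have "integrable (lebesgue_on {a<..<b}) (\<lambda>x. (g x)\<^sup>2)"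
  proof (rule Bochner_Integration.integrable_bound)
    show "integrable (lebesgue_on {a<..<b}) (\<lambda>x. C\<^sup>2 * (f x)\<^sup>2)"
      by (intro integrable_mult_right L2_integrable_square f)
    show "(\<lambda>x. (g x)\<^sup>2) \<in> borel_measurable (lebesgue_on {a<..<b})" using g by measurable
    show "AE x in lebesgue_on {a<..<b}. norm ((g x)\<^sup>2) \<le> norm (C\<^sup>2 * (f x)\<^sup>2)"
      using le
    proof eventually_elim
      case (elim x)
      then have "\<bar>g x\<bar> ^ 2 \<le> (C * \<bar>f x\<bar>) ^ 2" by (intro power_mono) auto
      then show ?case by (simp add: power_mult_distrib abs_mult)
    qed
  qed
  then show ?thesis using g by (simp add: L2_def)
qed

lemma L2_const: "(\<lambda>x. c) \<in> L2 a b"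
  using finite_measure.integrable_const[OF finite_measure_interval[of a b], of "c^2"] by (simp add: L2_def)

lemma L2_bounded:
  assumes "g \<in> borel_measurable (lebesgue_on {a<..<b})" and "AE x in lebesgue_on {a<..<b}. \<bar>g x\<bar> \<le> C"
  shows "g \<in> L2 a b"
  by (rule L2_dominated[OF L2_const[of 1] assms(1), of C]) (use assms(2) in simp)

lemma L2_integrable: "f \<in> L2 a b \<Longrightarrow> integrable (lebesgue_on {a<..<b}) f"
  using L2_integrable_mult[OF _ L2_const[of 1], of f a b] by simp

\<comment> \<open>Passing to classes gives an instance of \<open>real_inner\<close> and
  \<open>banach\<close>, to which the functional calculus and the vector-valued differential
  calculus apply. The quotient is partial because raw functions need not be square
  integrable.\<close>
quotient_type l2 = "real \<Rightarrow> real" / partial: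
  "\<lambda>f g. f \<in> L2 0 1 \<and> g \<in> L2 0 1 \<and> (AE x in I01. f x = g x)"
proof (rule part_equivpI)
  show "\<exists>x. x \<in> L2 0 1 \<and> x \<in> L2 0 1 \<and> (AE t in I01. x t = x t)" using L2_const by blast
  show "symp (\<lambda>f g. f \<in> L2 0 1 \<and> g \<in> L2 0 1 \<and> (AE x in I01. f x = g x))"
    unfolding symp_def by (auto elim: AE_mp)
  show "transp (\<lambda>f g. f \<in> L2 0 1 \<and> g \<in> L2 0 1 \<and> (AE x in I01. f x = g x))"
    unfolding transp_def
  proof (intro allI impI)
    fix f g h assume a: "f \<in> L2 0 1 \<and> g \<in> L2 0 1 \<and> (AE x in I01. f x = g x)"
      "g \<in> L2 0 1 \<and> h \<in> L2 0 1 \<and> (AE x in I01. g x = h x)"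
    then have "AE x in I01. f x = g x" "AE x in I01. g x = h x" by auto
    then have "AE x in I01. f x = h x" by eventually_elim simp
    then show "f \<in> L2 0 1 \<and> h \<in> L2 0 1 \<and> (AE x in I01. f x = h x)" using a by auto
  qed
qed

abbreviation cls :: "(real \<Rightarrow> real) \<Rightarrow> l2" where "cls \<equiv> abs_l2"
abbreviation rep :: "l2 \<Rightarrow> real \<Rightarrow> real" where "rep \<equiv> rep_l2"

lemma rep_L2: "rep x \<in> L2 0 1"
  using Quotient3_rep_reflp[OF Quotient3_l2, of x] by auto

lemma cls_rep: "cls (rep x) = x"
  by (rule Quotient3_abs_rep[OF Quotient3_l2])

lemma cls_eq_iff: "f \<in> L2 0 1 \<Longrightarrow> g \<in> L2 0 1 \<Longrightarrow> cls f = cls g \<longleftrightarrow> (AE x in I01. f x = g x)"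
  using Quotient3_rel[OF Quotient3_l2, of f g] by auto

lemma cls_eqI: "f \<in> L2 0 1 \<Longrightarrow> g \<in> L2 0 1 \<Longrightarrow> AE x in I01. f x = g x \<Longrightarrow> cls f = cls g"
  by (simp add: cls_eq_iff)

lemma rep_cls: "f \<in> L2 0 1 \<Longrightarrow> AE x in I01. rep (cls f) x = f x"
  using cls_eq_iff[OF rep_L2, of f "cls f"] by (simp add: cls_rep)

lemma l2_eq_iff: "x = y \<longleftrightarrow> (AE t in I01. rep x t = rep y t)"
  using cls_eq_iff[OF rep_L2 rep_L2, of x y] by (simp add: cls_rep)

lemma rep_measurable [measurable]: "rep x \<in> borel_measurable I01"
  by (rule L2_measurable[OF rep_L2])

instantiation l2 :: real_inner
begin

definition "0 = cls (\<lambda>_. 0)"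
definition "x + y = cls (\<lambda>t. rep x t + rep y t)"
definition "- x = cls (\<lambda>t. - rep x t)"
definition "x - y = cls (\<lambda>t. rep x t - rep y t)"
definition "c *\<^sub>R x = cls (\<lambda>t. c * rep x t)"
definition "inner x y = (LINT t|I01. rep x t * rep y t)"
definition "norm (x::l2) = sqrt (inner x x)"
definition "dist (x::l2) y = norm (x - y)"
definition "sgn (x::l2) = inverse (norm x) *\<^sub>R x"
definition "uniformity = (INF e\<in>{0<..}. principal {(x::l2, y). dist x y < e})"
definition "open (U::l2 set) \<longleftrightarrow> (\<forall>x\<in>U. \<forall>\<^sub>F (x', y) in uniformity. x' = x \<longrightarrow> y \<in> U)"

lemma rep_add: "AE t in I01. rep (x + y) t = rep x t + rep y t"
  unfolding plus_l2_def by (intro rep_cls L2_add rep_L2)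
lemma rep_uminus: "AE t in I01. rep (- x) t = - rep x t"
  unfolding uminus_l2_def by (intro rep_cls L2_uminus rep_L2)
lemma rep_diff: "AE t in I01. rep (x - y) t = rep x t - rep y t"
  unfolding minus_l2_def by (intro rep_cls L2_diff rep_L2)
lemma rep_scaleR: "AE t in I01. rep (c *\<^sub>R x) t = c * rep x t"
  unfolding scaleR_l2_def by (intro rep_cls L2_cmult rep_L2)
lemma rep_zero: "AE t in I01. rep 0 t = 0"
  unfolding zero_l2_def by (intro rep_cls L2_const)

instance
proof
  fix x y z :: l2 and a b c :: real
  show "x + y + z = x + (y + z)"
    unfolding l2_eq_iff using rep_add[of "x + y" z] rep_add[of x y] rep_add[of x "y + z"] rep_add[of y z]
    by eventually_elim simp
  show "x + y = y + x"
    unfolding l2_eq_iff using rep_add[of x y] rep_add[of y x] by eventually_elim simp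
  show "0 + x = x"
    unfolding l2_eq_iff using rep_add[of 0 x] rep_zero by eventually_elim simp
  show "- x + x = 0"
    unfolding l2_eq_iff using rep_add[of "- x" x] rep_zero rep_uminus[of x] by eventually_elim simp
  show "x - y = x + - y"
    unfolding l2_eq_iff using rep_add[of x "- y"] rep_diff[of x y] rep_uminus[of y] by eventually_elim simp
  show "a *\<^sub>R (x + y) = a *\<^sub>R x + a *\<^sub>R y"
    unfolding l2_eq_iff using rep_scaleR[of a "x + y"] rep_add[of x y] rep_add[of "a *\<^sub>R x" "a *\<^sub>R y"]
      rep_scaleR[of a x] rep_scaleR[of a y] by eventually_elim (simp add: algebra_simps)
  show "(a + b) *\<^sub>R x = a *\<^sub>R x + b *\<^sub>R x"
    unfolding l2_eq_iff using rep_scaleR[of "a + b" x] rep_add[of "a *\<^sub>R x" "b *\<^sub>R x"]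
      rep_scaleR[of a x] rep_scaleR[of b x] by eventually_elim (simp add: algebra_simps)
  show "a *\<^sub>R b *\<^sub>R x = (a * b) *\<^sub>R x"
    unfolding l2_eq_iff using rep_scaleR[of a "b *\<^sub>R x"] rep_scaleR[of b x] rep_scaleR[of "a * b" x]
    by eventually_elim (simp add: algebra_simps)
  show "1 *\<^sub>R x = x"
    unfolding l2_eq_iff using rep_scaleR[of 1 x] by eventually_elim simp
  show "dist x y = norm (x - y)" by (rule dist_l2_def)
  show "sgn x = inverse (norm x) *\<^sub>R x" by (rule sgn_l2_def)
  show "uniformity = (INF e\<in>{0<..}. principal {(x::l2, y). dist x y < e})" by (rule uniformity_l2_def)
  show "open U \<longleftrightarrow> (\<forall>x\<in>U. \<forall>\<^sub>F (x', y) in uniformity. x' = x \<longrightarrow> y \<in> U)" for U :: "l2 set"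
    by (rule open_l2_def)
  show "inner x y = inner y x" by (simp add: inner_l2_def mult.commute)
  show "inner (x + y) z = inner x z + inner y z"
  proof -
    have "inner (x + y) z = (LINT t|I01. rep x t * rep z t + rep y t * rep z t)"
      unfolding inner_l2_def
    proof (rule integral_cong_AE)
      show "AE t in I01. rep (x + y) t * rep z t = rep x t * rep z t + rep y t * rep z t"
        using rep_add[of x y] by eventually_elim (simp add: algebra_simps)
    qed measurable
    also have "\<dots> = inner x z + inner y z"
      unfolding inner_l2_def by (intro Bochner_Integration.integral_add L2_integrable_mult rep_L2)
    finally show ?thesis .
  qed
  show "inner (a *\<^sub>R x) y = a * inner x y"
  proof -
    have "inner (a *\<^sub>R x) y = (LINT t|I01. a * (rep x t * rep y t))"
      unfolding inner_l2_def
    proof (rule integral_cong_AE)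
      show "AE t in I01. rep (a *\<^sub>R x) t * rep y t = a * (rep x t * rep y t)"
        using rep_scaleR[of a x] by eventually_elim (simp add: algebra_simps)
    qed measurable
    then show ?thesis by (simp add: inner_l2_def)
  qed
  show "0 \<le> inner x x" by (simp add: inner_l2_def)
  show "inner x x = 0 \<longleftrightarrow> x = 0"
  proof -
    have "inner x x = 0 \<longleftrightarrow> (AE t in I01. rep x t * rep x t = 0)"
      unfolding inner_l2_def
      by (rule integral_nonneg_eq_0_iff_AE) (auto intro!: L2_integrable_mult rep_L2)
    also have "\<dots> \<longleftrightarrow> (AE t in I01. rep x t = rep 0 t)"
    proof
      assume "AE t in I01. rep x t * rep x t = 0"
      then show "AE t in I01. rep x t = rep 0 t" using rep_zero by eventually_elim simp
    next
      assume "AE t in I01. rep x t = rep 0 t"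
      then show "AE t in I01. rep x t * rep x t = 0" using rep_zero by eventually_elim simp
    qed
    finally show ?thesis by (simp add: l2_eq_iff)
  qed
  show "norm x = sqrt (inner x x)" by (rule norm_l2_def)
qed

end

lemma cls_add: "f \<in> L2 0 1 \<Longrightarrow> g \<in> L2 0 1 \<Longrightarrow> cls (\<lambda>x. f x + g x) = cls f + cls g"
  unfolding plus_l2_def
  by (intro cls_eqI L2_add rep_L2, simp_all) (use rep_cls[of f] rep_cls[of g] in \<open>auto elim: AE_mp\<close>)

lemma cls_diff: "f \<in> L2 0 1 \<Longrightarrow> g \<in> L2 0 1 \<Longrightarrow> cls (\<lambda>x. f x - g x) = cls f - cls g"
  unfolding minus_l2_def
  by (intro cls_eqI L2_diff rep_L2, simp_all) (use rep_cls[of f] rep_cls[of g] in \<open>auto elim: AE_mp\<close>)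

lemma cls_cmult: "f \<in> L2 0 1 \<Longrightarrow> cls (\<lambda>x. c * f x) = c *\<^sub>R cls f"
proof -
  assume f: "f \<in> L2 0 1"
  have "AE x in I01. c * f x = c * rep (cls f) x"
    using rep_cls[OF f] by eventually_elim simp
  then show ?thesis unfolding scaleR_l2_def by (intro cls_eqI L2_cmult rep_L2 f)
qed

lemma cls_uminus: "f \<in> L2 0 1 \<Longrightarrow> cls (\<lambda>x. - f x) = - cls f"
  using cls_cmult[of f "-1"] by simp

lemma cls_zero: "cls (\<lambda>_. 0) = 0"
  by (simp add: zero_l2_def)

lemma inner_cls:
  assumes f: "f \<in> L2 0 1" and g: "g \<in> L2 0 1"
  shows "cls f \<bullet> cls g = (LINT x|I01. f x * g x)"
  unfolding inner_l2_def
proof (rule integral_cong_AE)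
  show "AE t in I01. rep (cls f) t * rep (cls g) t = f t * g t"
    using rep_cls[OF f] rep_cls[OF g] by eventually_elim simp
qed (use f g in measurable)

lemma norm_cls: "f \<in> L2 0 1 \<Longrightarrow> norm (cls f) = L2_norm 0 1 f"
  by (simp add: norm_eq_sqrt_inner inner_cls L2_norm_def power2_eq_square)

lemma norm_cls_mono:
  assumes f: "f \<in> L2 0 1" and g: "g \<in> L2 0 1" and le: "AE x in I01. \<bar>f x\<bar> \<le> \<bar>g x\<bar>"
  shows "norm (cls f) \<le> norm (cls g)"
proof -
  have "(LINT x|I01. (f x)\<^sup>2) \<le> (LINT x|I01. (g x)\<^sup>2)"
  proof (rule integral_mono_AE)
    show "AE x in I01. (f x)\<^sup>2 \<le> (g x)\<^sup>2" using le by eventually_elim (rule abs_le_square_iff[THEN iffD1])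
  qed (intro L2_integrable_square f g)+
  then show ?thesis by (simp add: norm_cls f g L2_norm_def)
qed

lemma norm_one: "norm (cls (\<lambda>_. 1)) = 1"
  by (simp add: norm_cls L2_const L2_norm_def measure_restrict_space)

lemma norm_cls_le_bound:
  assumes f: "f \<in> borel_measurable I01" and le: "AE x in I01. \<bar>f x\<bar> \<le> C" and C: "0 \<le> C"
  shows "norm (cls f) \<le> C"
proof -
  have "norm (cls f) \<le> norm (cls (\<lambda>_. C * 1))"
    by (rule norm_cls_mono) (use le C in \<open>auto intro!: L2_bounded[OF f le] L2_const\<close>)
  also have "\<dots> = C" unfolding cls_cmult[OF L2_const] using norm_one C by simp
  finally show ?thesis .
qed

lemma L2_abs: "f \<in> L2 a b \<Longrightarrow> (\<lambda>x. \<bar>f x\<bar>) \<in> L2 a b"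
  by (rule L2_dominated[of f _ _ _ 1]) (auto dest: L2_measurable)

lemma integral_abs_le_norm:
  assumes f: "f \<in> L2 0 1"
  shows "(LINT x|I01. \<bar>f x\<bar>) \<le> norm (cls f)"
proof -
  have "(LINT x|I01. \<bar>f x\<bar>) = cls (\<lambda>x. \<bar>f x\<bar>) \<bullet> cls (\<lambda>_. 1)"
    by (simp add: inner_cls L2_abs f L2_const)
  also have "\<dots> \<le> norm (cls (\<lambda>x. \<bar>f x\<bar>)) * norm (cls (\<lambda>_. 1))" by (rule norm_cauchy_schwarz)
  also have "norm (cls (\<lambda>x. \<bar>f x\<bar>)) \<le> norm (cls f)" by (rule norm_cls_mono) (auto intro: L2_abs f)
  finally show ?thesis by (simp add: norm_one)
qed

lemma norm_rep_diff: "(norm (x - y))\<^sup>2 = (LINT t|I01. (rep x t - rep y t)\<^sup>2)"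
proof -
  have "x - y = cls (\<lambda>t. rep x t - rep y t)" by (rule minus_l2_def)
  moreover have "0 \<le> (LINT t|I01. (rep x t - rep y t)\<^sup>2)" by simp
  ultimately show ?thesis by (simp add: norm_cls L2_norm_def L2_diff rep_L2)
qed

text \<open>Riesz-Fischer. On a probability space an L2-Cauchy sequence is L1-Cauchy, so a
  subsequence converges almost everywhere, and Fatou's lemma shows that this limit is the L2 limit
  of the whole sequence.\<close>

instance l2 :: banach
proof
  fix X :: "nat \<Rightarrow> l2" assume X: "Cauchy X"
  define s where "s n = rep (X n)" for n
  have sL: "s n \<in> L2 0 1" for n by (simp add: s_def rep_L2)
  have sm [measurable]: "s n \<in> borel_measurable I01" for n by (simp add: s_def)
  have "\<exists>N. \<forall>i\<ge>N. \<forall>j\<ge>N. (LINT x|I01. norm (s i x - s j x)) < e" if e: "0 < e" for e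
  proof -
    obtain N where N: "\<And>i j. i \<ge> N \<Longrightarrow> j \<ge> N \<Longrightarrow> norm (X i - X j) < e"
      using CauchyD[OF X e] by blast
    have "(LINT x|I01. norm (s i x - s j x)) < e" if "i \<ge> N" "j \<ge> N" for i j
      using integral_abs_le_norm[OF L2_diff[OF sL sL], of i j] N[OF that]
      by (simp add: cls_diff sL s_def cls_rep rep_L2)
    then show ?thesis by blast
  qed
  then obtain r where r: "strict_mono r" "AE x in I01. Cauchy (\<lambda>i. s (r i) x)"
    using cauchy_L1_AE_cauchy_subseq[where M = I01 and s = s] L2_integrable[OF sL] by blast
  define g where "g x = lim (\<lambda>i. s (r i) x)" for x
  have g [measurable]: "g \<in> borel_measurable I01" unfolding g_def by measurable
  have lim: "AE x in I01. (\<lambda>i. s (r i) x) \<longlonglongrightarrow> g x"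
    using r(2) by eventually_elim (simp add: g_def Cauchy_convergent_iff convergent_LIMSEQ_iff)
  have key: "\<exists>N. \<forall>i\<ge>N. integrable I01 (\<lambda>x. (g x - s i x)\<^sup>2) \<and> (LINT x|I01. (g x - s i x)\<^sup>2) \<le> e\<^sup>2" if e: "0 < e" for e
  proof -
    obtain N where N: "\<And>i j. i \<ge> N \<Longrightarrow> j \<ge> N \<Longrightarrow> norm (X i - X j) < e"
      using CauchyD[OF X e] by blast
    have "integrable I01 (\<lambda>x. (g x - s i x)\<^sup>2) \<and> (LINT x|I01. (g x - s i x)\<^sup>2) \<le> e\<^sup>2" if i: "i \<ge> N" for i
    proof -
      have "(\<integral>\<^sup>+x. ennreal ((g x - s i x)\<^sup>2) \<partial>I01)
          = (\<integral>\<^sup>+x. liminf (\<lambda>j. ennreal ((s (r j) x - s i x)\<^sup>2)) \<partial>I01)"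
      proof (rule nn_integral_cong_AE)
        show "AE x in I01. ennreal ((g x - s i x)\<^sup>2) = liminf (\<lambda>j. ennreal ((s (r j) x - s i x)\<^sup>2))"
          using lim
        proof eventually_elim
          case (elim x)
          then have "(\<lambda>j. ennreal ((s (r j) x - s i x)\<^sup>2)) \<longlonglongrightarrow> ennreal ((g x - s i x)\<^sup>2)"
            by (intro tendsto_ennrealI tendsto_intros)
          from lim_imp_Liminf[OF trivial_limit_sequentially this] show ?case by simp
        qed
      qed
      also have "\<dots> \<le> liminf (\<lambda>j. \<integral>\<^sup>+x. ennreal ((s (r j) x - s i x)\<^sup>2) \<partial>I01)"
        by (rule nn_integral_liminf) measurable
      also have "\<dots> \<le> ennreal (e\<^sup>2)"
      proof (rule Liminf_le)
        have "eventually (\<lambda>j. j \<ge> N) sequentially" by (rule eventually_ge_at_top)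
        then show "\<forall>\<^sub>F j in sequentially. (\<integral>\<^sup>+x. ennreal ((s (r j) x - s i x)\<^sup>2) \<partial>I01) \<le> ennreal (e\<^sup>2)"
        proof eventually_elim
          case (elim j)
          then have "r j \<ge> N" using seq_suble[OF r(1), of j] by linarith
          then have "(norm (X (r j) - X i))\<^sup>2 \<le> e\<^sup>2" using N[of "r j" i] i by (intro power_mono) auto
          then have "(LINT x|I01. (s (r j) x - s i x)\<^sup>2) \<le> e\<^sup>2" by (simp add: norm_rep_diff s_def)
          then show ?case
            using nn_integral_eq_integral[OF L2_integrable_square[OF L2_diff[OF sL sL]], of "r j" i]
            by (simp add: ennreal_leI)
        qed
      qed simp
      finally have le: "(\<integral>\<^sup>+x. ennreal ((g x - s i x)\<^sup>2) \<partial>I01) \<le> ennreal (e\<^sup>2)" .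
      then have int: "integrable I01 (\<lambda>x. (g x - s i x)\<^sup>2)"
        by (intro integrableI_nonneg) (auto intro: le_less_trans ennreal_less_top)
      moreover have "(LINT x|I01. (g x - s i x)\<^sup>2) \<le> e\<^sup>2"
        using le nn_integral_eq_integral[OF int] by (simp add: ennreal_le_iff)
      ultimately show ?thesis by blast
    qed
    then show ?thesis by blast
  qed
  have gL: "g \<in> L2 0 1"
  proof -
    obtain i where "integrable I01 (\<lambda>x. (g x - s i x)\<^sup>2)" using key[of 1] by auto
    then have "(\<lambda>x. g x - s i x) \<in> L2 0 1" by (simp add: L2_def)
    from L2_add[OF this sL[of i]] show ?thesis by simp
  qed
  have "X \<longlonglongrightarrow> cls g"
  proof (rule LIMSEQ_I)
    fix e :: real assume e: "0 < e"
    then obtain N where N: "\<forall>i\<ge>N. (LINT x|I01. (g x - s i x)\<^sup>2) \<le> (e/2)\<^sup>2" using key[of "e/2"] by auto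
    have "norm (X i - cls g) < e" if "i \<ge> N" for i
    proof -
      have "X i - cls g = cls (\<lambda>x. s i x - g x)"
        by (simp add: cls_diff sL gL) (simp add: s_def cls_rep)
      then have "norm (X i - cls g) = sqrt (LINT x|I01. (g x - s i x)\<^sup>2)"
        by (simp add: norm_cls L2_diff sL gL L2_norm_def power2_commute)
      also have "\<dots> \<le> sqrt ((e/2)\<^sup>2)" using N that by (intro real_sqrt_le_mono) auto
      also have "\<dots> = e/2" using e by simp
      finally show ?thesis using e by simp
    qed
    then show "\<exists>no. \<forall>n\<ge>no. norm (X n - cls g) < e" by blast
  qed
  then show "convergent X" by (auto simp: convergent_def)
qed

section \<open>Primitives on the unit interval\<close>

lemma integral_I01: "(LINT x|I01. f x) = (LINT x|lebesgue. indicat_real {0<..<1} x * (f x :: real))"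
  by (simp add: integral_restrict_space)

lemma integrable_I01: "integrable I01 f \<longleftrightarrow> integrable lebesgue (\<lambda>x. indicat_real {0<..<1} x * (f x :: real))"
  by (simp add: integrable_restrict_space)

lemma id_measurable_I01 [measurable]: "(\<lambda>x::real. x) \<in> borel_measurable I01"
  by (rule continuous_imp_measurable_on_sets_lebesgue) auto

lemma indicator_measurable_I01 [measurable]:
  "indicat_real {..<y} \<in> borel_measurable I01" "indicat_real {y<..} \<in> borel_measurable I01"
  by measurable

lemma integral_I01_lessThan:
  assumes "y \<le> 1"
  shows "(LINT x|I01. indicat_real {..<y} x * f x) = (LINT x|lebesgue_on {0<..<y}. f x)"
    and "integrable I01 (\<lambda>x. indicat_real {..<y} x * f x) \<longleftrightarrow> integrable (lebesgue_on {0<..<y}) f"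
proof -
  have c: "indicat_real {0<..<1} x * (indicat_real {..<y} x * f x) = indicat_real {0<..<y} x *\<^sub>R f x" for x
    using assms by (auto simp: indicator_def)
  show "(LINT x|I01. indicat_real {..<y} x * f x) = (LINT x|lebesgue_on {0<..<y}. f x)"
    unfolding integral_I01 c by (simp add: integral_restrict_space)
  show "integrable I01 (\<lambda>x. indicat_real {..<y} x * f x) \<longleftrightarrow> integrable (lebesgue_on {0<..<y}) f"
    unfolding integrable_I01 c by (simp add: integrable_restrict_space)
qed

lemma powr_integral_I01:
  assumes p: "-1 < p" and y: "0 \<le> y" "y \<le> 1"
  shows "integrable I01 (\<lambda>x. indicat_real {..<y} x * x powr p)"
    and "(LINT x|I01. indicat_real {..<y} x * x powr p) = y powr (p + 1) / (p + 1)"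
proof -
  have h: "((\<lambda>x. x powr p) has_integral (y powr (p + 1) / (p + 1))) {0<..<y}"
    using has_integral_powr_from_0[OF p y(1)] by (simp add: has_integral_Icc_iff_Ioo)
  then have i: "integrable (lebesgue_on {0<..<y}) (\<lambda>x. x powr p)"
    by (intro absolutely_integrable_imp_integrable nonnegative_absolutely_integrable_1) auto
  then show "integrable I01 (\<lambda>x. indicat_real {..<y} x * x powr p)"
    by (simp add: integral_I01_lessThan y)
  show "(LINT x|I01. indicat_real {..<y} x * x powr p) = y powr (p + 1) / (p + 1)"
    using lebesgue_integral_eq_integral[OF i] h by (simp add: integral_I01_lessThan y integral_unique)
qed

lemma AE_I01_space: "AE x in I01. 0 < x \<and> x < 1"
  by (rule AE_I2) simp

lemma powr_integral_I01_1:
  assumes p: "-1 < p"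
  shows "integrable I01 (\<lambda>x. x powr p)" and "(LINT x|I01. x powr p) = 1 / (p + 1)"
proof -
  have c: "\<And>x. x \<in> space I01 \<Longrightarrow> indicat_real {..<1} x * x powr p = x powr p" by simp
  show "integrable I01 (\<lambda>x. x powr p)"
  proof -
    have "integrable I01 (\<lambda>x. indicat_real {..<1} x * x powr p) \<longleftrightarrow> integrable I01 (\<lambda>x. x powr p)"
      by (rule Bochner_Integration.integrable_cong) auto
    then show ?thesis using powr_integral_I01(1)[OF p, of 1] by simp
  qed
  show "(LINT x|I01. x powr p) = 1 / (p + 1)"
  proof -
    have "(LINT x|I01. indicat_real {..<1} x * x powr p) = (LINT x|I01. x powr p)"
      by (rule Bochner_Integration.integral_cong) auto
    then show ?thesis using powr_integral_I01(2)[OF p, of 1] by simp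
  qed
qed

lemma powr_measurable [measurable]: "(\<lambda>x. x powr p) \<in> borel_measurable I01"
  by (rule continuous_imp_measurable_on_sets_lebesgue) (auto intro!: continuous_intros)

lemma powr_L2: "- 1 < 2 * p \<Longrightarrow> (\<lambda>x. x powr p) \<in> L2 0 1"
proof -
  assume p: "- 1 < 2 * p"
  have "(x powr p)\<^sup>2 = x powr (2 * p)" for x :: real
    by (simp only: power2_eq_square powr_add[symmetric] mult_2)
  then show ?thesis using powr_integral_I01_1(1)[OF p] by (simp add: L2_def)
qed

lemma indicator_L2: "indicat_real {..<y} \<in> L2 0 1"
  by (rule L2_bounded[of _ _ _ 1]) (auto simp: indicator_def)

text \<open>The pairing \<open>ind y \<bullet> g\<close> is the integral of g from 0 to y for y in
  [0, 1]. Unlike a value of g it does not depend on a representative, and it is continuous in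
  y.\<close>

definition ind :: "real \<Rightarrow> l2" where "ind y = cls (indicat_real {..<y})"

lemma inner_ind_cls: "f \<in> L2 0 1 \<Longrightarrow> ind y \<bullet> cls f = (LINT x|I01. indicat_real {..<y} x * f x)"
  by (simp add: ind_def inner_cls indicator_L2)

lemma inner_ind_ind:
  assumes "0 \<le> y" "y \<le> 1" "0 \<le> z" "z \<le> 1"
  shows "ind y \<bullet> ind z = min y z"
proof -
  have "ind y \<bullet> ind z = (LINT x|I01. indicat_real {..<min y z} x * 1)"
    unfolding ind_def inner_cls[OF indicator_L2 indicator_L2]
    by (rule Bochner_Integration.integral_cong) (auto simp: indicator_def)
  also have "\<dots> = min y z"
    using assms integral_I01_lessThan(1)[of "min y z" "\<lambda>_. 1"]
    by (simp add: measure_restrict_space)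
  finally show ?thesis .
qed

lemma norm_ind: "0 \<le> y \<Longrightarrow> y \<le> 1 \<Longrightarrow> norm (ind y) = sqrt y"
  by (simp add: norm_eq_sqrt_inner inner_ind_ind)

lemma norm_ind_diff:
  assumes "0 \<le> y" "y \<le> 1" "0 \<le> z" "z \<le> 1"
  shows "norm (ind y - ind z) = sqrt \<bar>y - z\<bar>"
proof -
  have "(ind y - ind z) \<bullet> (ind y - ind z) = \<bar>y - z\<bar>"
    using assms by (simp add: inner_diff_left inner_diff_right inner_ind_ind min_def)
  then show ?thesis by (simp add: norm_eq_sqrt_inner)
qed

lemma continuous_on_ind: "continuous_on {0..1} ind"
  unfolding continuous_on_iff
proof (intro ballI allI impI)
  fix x e :: real assume x: "x \<in> {0..1}" and e: "0 < e"
  have "dist (ind x') (ind x) < e" if "x' \<in> {0..1}" "dist x' x < e\<^sup>2" for x'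
  proof -
    have "dist (ind x') (ind x) = sqrt \<bar>x' - x\<bar>"
      using that x by (simp add: dist_norm norm_ind_diff)
    also have "\<dots> < sqrt (e\<^sup>2)" using that by (intro real_sqrt_less_mono) (simp add: dist_real_def)
    finally show ?thesis using e by simp
  qed
  then show "\<exists>d>0. \<forall>x'\<in>{0..1}. dist x' x < d \<longrightarrow> dist (ind x') (ind x) < e"
    using e by (intro exI[of _ "e\<^sup>2"]) auto
qed

lemma ind_1: "ind 1 = cls (\<lambda>_. 1)"
  unfolding ind_def by (intro cls_eqI indicator_L2 L2_const AE_I2) (simp add: indicator_def)

lemma continuous_on_primitive: "continuous_on {0..1} (\<lambda>y. ind y \<bullet> g)"
  by (intro continuous_intros continuous_on_ind)

lemma primitive_measurable [measurable]: "(\<lambda>y. ind y \<bullet> g) \<in> borel_measurable I01"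
  by (rule continuous_imp_measurable_on_sets_lebesgue)
    (auto intro: continuous_on_subset[OF continuous_on_primitive])

lemma abs_primitive_le: "0 \<le> y \<Longrightarrow> y \<le> 1 \<Longrightarrow> \<bar>ind y \<bullet> g\<bar> \<le> sqrt y * norm g"
  using Cauchy_Schwarz_ineq2[of "ind y" g] by (simp add: norm_ind)

text \<open>Differences of the hypothesis give zero integrals over compact subintervals, and
  Lebesgue's differentiation theorem recovers f almost everywhere.\<close>

lemma AE_zero_of_primitive_zero:
  fixes f :: "real \<Rightarrow> real"
  assumes f: "integrable I01 f"
    and z: "\<And>y. 0 < y \<Longrightarrow> y < 1 \<Longrightarrow> (LINT x|I01. indicat_real {..<y} x * f x) = 0"
  shows "AE x in I01. f x = 0"
proof -
  define f0 where "f0 x = indicat_real {0<..<1} x * f x" for x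
  have f0: "integrable lebesgue f0" using f unfolding integrable_I01 f0_def .
  have ii: "integrable (lebesgue_on {a..b}) f0" for a b
    using integrable_mult_indicator[of "{a..b}" lebesgue f0] f0 by (simp add: integrable_restrict_space)
  have int0: "integral {a..b} f0 = 0" if ab: "0 < a" "a < b" "b < 1" for a b
  proof -
    have A: "integrable lebesgue (\<lambda>x. indicat_real {..<y} x * f0 x)" for y
      using integrable_mult_indicator[of "{..<y}" lebesgue f0] f0 by simp
    have B: "(LINT x|lebesgue. indicat_real {..<y} x * f0 x) = 0" if "0 < y" "y < 1" for y
      using z[OF that] by (simp add: integral_I01 f0_def mult.left_commute)
    have "integral {a..b} f0 = (LINT x|lebesgue_on {a..b}. f0 x)"
      by (rule lebesgue_integral_eq_integral[symmetric, OF ii]) simp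
    also have "\<dots> = (LINT x|lebesgue. indicat_real {a..b} x *\<^sub>R f0 x)" by (simp add: integral_restrict_space)
    also have "\<dots> = (LINT x|lebesgue. indicat_real {..<b} x * f0 x - indicat_real {..<a} x * f0 x)"
    proof (rule integral_cong_AE)
      have "AE x in lebesgue. x \<noteq> b"
        by (rule AE_completion) (rule AE_lborel_singleton)
      then show "AE x in lebesgue. indicat_real {a..b} x *\<^sub>R f0 x = indicat_real {..<b} x * f0 x - indicat_real {..<a} x * f0 x"
        by eventually_elim (use ab in \<open>auto simp: indicator_def\<close>)
      show "(\<lambda>x. indicat_real {a..b} x *\<^sub>R f0 x) \<in> borel_measurable lebesgue"
        using ii[of a b] by (auto simp: integrable_restrict_space dest: borel_measurable_integrable)
      show "(\<lambda>x. indicat_real {..<b} x * f0 x - indicat_real {..<a} x * f0 x) \<in> borel_measurable lebesgue"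
        using A by (intro borel_measurable_diff borel_measurable_integrable) auto
    qed
    also have "\<dots> = 0" using ab by (subst Bochner_Integration.integral_diff) (auto simp: A B)
    finally show ?thesis .
  qed
  have "f0 integrable_on cbox a b" for a b
    using integrable_on_lebesgue_on[OF ii[of a b]] by simp
  then obtain N where N: "negligible N"
    "\<And>x e. x \<notin> N \<Longrightarrow> 0 < e \<Longrightarrow> \<exists>d>0. \<forall>h. 0 < h \<and> h < d \<longrightarrow>
        norm (integral (cbox x (x + h *\<^sub>R One)) f0 /\<^sub>R h ^ DIM(real) - f0 x) < e"
    using integrable_ccontinuous_explicit[of f0] by metis
  have "f x = 0" if x: "x \<notin> N" "0 < x" "x < 1" for x
  proof (rule ccontr)
    assume "f x \<noteq> 0"
    then have "0 < \<bar>f0 x\<bar>" using x by (simp add: f0_def)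
    then obtain d where d: "0 < d" "\<And>h. 0 < h \<Longrightarrow> h < d \<Longrightarrow>
        norm (integral (cbox x (x + h *\<^sub>R One)) f0 /\<^sub>R h ^ DIM(real) - f0 x) < \<bar>f0 x\<bar>"
      using N(2)[OF x(1)] by metis
    define h where "h = min (d / 2) ((1 - x) / 2)"
    have h: "0 < h" "h < d" "x + h < 1" using d x by (auto simp: h_def min_def field_simps)
    have "integral (cbox x (x + h *\<^sub>R One)) f0 = 0" using int0[of x "x + h"] h x by simp
    then show False using d(2)[OF h(1,2)] by simp
  qed
  moreover have "AE x in lebesgue. x \<notin> N"
    using N(1) unfolding negligible_iff_null_sets by (rule AE_not_in)
  then have "AE x in lebesgue. x \<in> {0<..<1} \<longrightarrow> x \<notin> N"
    by eventually_elim simp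
  then have "AE x in I01. x \<notin> N"
    by (simp add: AE_restrict_space_iff)
  ultimately show ?thesis using AE_I01_space by (auto elim: AE_mp)
qed

lemma eq_0_of_primitive_zero:
  assumes "\<And>y. 0 < y \<Longrightarrow> y < 1 \<Longrightarrow> ind y \<bullet> g = 0"
  shows "g = 0"
proof -
  have "AE x in I01. rep g x = 0"
  proof (rule AE_zero_of_primitive_zero[OF L2_integrable[OF rep_L2]])
    fix y :: real assume "0 < y" "y < 1"
    from assms[OF this] show "(LINT x|I01. indicat_real {..<y} x * rep g x) = 0"
      using inner_ind_cls[OF rep_L2, of y g] by (simp add: cls_rep)
  qed
  then show ?thesis unfolding l2_eq_iff using rep_zero by eventually_elim simp
qed

section \<open>Tail integrals\<close>

definition tail :: "(real \<Rightarrow> real) \<Rightarrow> real \<Rightarrow> real" where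
  "tail p x = (LINT y|I01. indicat_real {x<..} y * p y)"

text \<open>For y > x one has y^(- \<gamma>) \<le> x^(- \<gamma>): a power \<gamma> of the
  singularity is moved from the integrand, where it may destroy integrability, to the outer
  variable. Each application chooses its own \<gamma>.\<close>

lemma tail_bound:
  assumes p [measurable]: "p \<in> borel_measurable I01"
    and le: "\<And>y. 0 < y \<Longrightarrow> y < 1 \<Longrightarrow> \<bar>p y\<bar> \<le> C * y powr q"
    and \<gamma>: "0 \<le> \<gamma>" "0 < q + \<gamma> + 1" and x: "0 < x" "x < 1"
  shows "integrable I01 (\<lambda>y. indicat_real {x<..} y * p y)"
    and "\<bar>tail p x\<bar> \<le> C / (q + \<gamma> + 1) * x powr (- \<gamma>)"
proof -
  have C: "0 \<le> C"
  proof -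
    have "0 \<le> C * x powr q" using le[OF x] by linarith
    then show ?thesis using x by (simp add: zero_le_mult_iff)
  qed
  have i: "integrable I01 (\<lambda>y. C * x powr (- \<gamma>) * y powr (q + \<gamma>))"
    using \<gamma> by (intro integrable_mult_right powr_integral_I01_1) auto
  have b: "norm (indicat_real {x<..} y * p y) \<le> C * x powr (- \<gamma>) * y powr (q + \<gamma>)" if "y \<in> space I01" for y
  proof (cases "x < y")
    case True
    have y: "0 < y" "y < 1" using that by auto
    have "y powr (- \<gamma>) \<le> x powr (- \<gamma>)" using True x \<gamma> by (intro powr_mono2') auto
    then have "y powr (- \<gamma>) * y powr (q + \<gamma>) \<le> x powr (- \<gamma>) * y powr (q + \<gamma>)" by (intro mult_right_mono) auto
    also have "y powr (- \<gamma>) * y powr (q + \<gamma>) = y powr q" by (simp add: powr_add[symmetric])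
    finally have "C * y powr q \<le> C * (x powr (- \<gamma>) * y powr (q + \<gamma>))" using C by (rule mult_left_mono)
    then show ?thesis using le[OF y] True by (simp add: mult.assoc)
  next
    case False then show ?thesis using C by simp
  qed
  show int: "integrable I01 (\<lambda>y. indicat_real {x<..} y * p y)"
    by (rule Bochner_Integration.integrable_bound[OF i]) (measurable, rule AE_I2, use b in force)
  have "\<bar>tail p x\<bar> \<le> (LINT y|I01. norm (indicat_real {x<..} y * p y))"
    unfolding tail_def using integral_norm_bound[of I01 "\<lambda>y. indicat_real {x<..} y * p y"] by simp
  also have "\<dots> \<le> (LINT y|I01. C * x powr (- \<gamma>) * y powr (q + \<gamma>))"
    by (rule integral_mono) (use int i b in auto)
  also have "\<dots> = C * x powr (- \<gamma>) * (1 / (q + \<gamma> + 1))"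
    using powr_integral_I01_1(2)[of "q + \<gamma>"] \<gamma> by simp
  finally show "\<bar>tail p x\<bar> \<le> C / (q + \<gamma> + 1) * x powr (- \<gamma>)" by (simp add: mult_ac)
qed

lemma sigma_finite_I01: "sigma_finite_measure I01"
  using finite_measure_interval[of 0 1] by (simp add: finite_measure_def)

lemma kernel_measurable:
  assumes [measurable]: "p \<in> borel_measurable I01" "h \<in> borel_measurable I01"
  shows "(\<lambda>(x, y). indicat_real {x<..} y * p y * h x) \<in> borel_measurable (I01 \<Otimes>\<^sub>M I01)"
proof -
  have [measurable]: "(\<lambda>z. fst z) \<in> borel_measurable (I01 \<Otimes>\<^sub>M I01)" "(\<lambda>z. snd z) \<in> borel_measurable (I01 \<Otimes>\<^sub>M I01)"
    using measurable_compose[OF measurable_fst id_measurable_I01] measurable_compose[OF measurable_snd id_measurable_I01]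
    by simp_all
  have "(\<lambda>z. if fst z < snd z then p (snd z) * h (fst z) else 0) \<in> borel_measurable (I01 \<Otimes>\<^sub>M I01)"
    by measurable
  moreover have "(\<lambda>z. if fst z < snd z then p (snd z) * h (fst z) else 0) = (\<lambda>(x, y). indicat_real {x<..} y * p y * h x)"
    by (auto simp: fun_eq_iff indicator_def)
  ultimately show ?thesis by simp
qed

lemma tail_measurable [measurable]:
  assumes p: "p \<in> borel_measurable I01"
  shows "tail p \<in> borel_measurable I01"
  unfolding tail_def
  by (rule sigma_finite_measure.borel_measurable_lebesgue_integral[OF sigma_finite_I01])
    (use kernel_measurable[OF p, of "\<lambda>_. 1"] in simp)

lemma tail_L2:
  assumes p [measurable]: "p \<in> borel_measurable I01" and a: "a < 2" "1 \<le> a"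
    and le: "\<And>y. 0 < y \<Longrightarrow> y < 1 \<Longrightarrow> \<bar>p y\<bar> \<le> C * y powr (1/2 - a)"
  shows "tail p \<in> L2 0 1"
proof (rule L2_dominated)
  \<comment> \<open>The exponent (a - 1) / 2 is admissible on both sides: a < 2 makes this power
    square integrable and also gives 1/2 - a + (a - 1) / 2 + 1 = 1 - a / 2 > 0.\<close>
  show "(\<lambda>x. x powr (- ((a - 1) / 2))) \<in> L2 0 1" using a by (intro powr_L2) auto
  show "AE x in I01. \<bar>tail p x\<bar> \<le> C / (1/2 - a + (a - 1) / 2 + 1) * \<bar>x powr (- ((a - 1) / 2))\<bar>"
  proof (rule AE_I2)
    fix x assume "x \<in> space I01"
    then have x: "0 < x" "x < 1" by auto
    have "0 \<le> (a - 1) / 2" "0 < 1/2 - a + (a - 1) / 2 + 1" using a by (auto simp: field_simps)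
    from tail_bound(2)[OF p le this x] show "\<bar>tail p x\<bar> \<le> C / (1/2 - a + (a - 1) / 2 + 1) * \<bar>x powr (- ((a - 1) / 2))\<bar>"
      by simp
  qed
qed measurable

text \<open>Fubini on the triangle x < y: tail integration is adjoint to taking primitives. Besides
  giving the form of G this serves, with a = 1, as the integration by parts in
  \<open>has_weak_deriv_primitive\<close> and \<open>primitive_product\<close>.\<close>

lemma tail_adjoint:
  assumes p [measurable]: "p \<in> borel_measurable I01" and a: "a < 2" "1 \<le> a"
    and le: "\<And>y. 0 < y \<Longrightarrow> y < 1 \<Longrightarrow> \<bar>p y\<bar> \<le> C * y powr (1/2 - a)" and h: "h \<in> L2 0 1"
  shows "(LINT x|I01. tail p x * h x) = (LINT y|I01. p y * (ind y \<bullet> cls h))"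
proof -
  have hm [measurable]: "h \<in> borel_measurable I01" using h by (rule L2_measurable)
  interpret pair_sigma_finite I01 I01
    by (intro pair_sigma_finite.intro sigma_finite_I01)
  let ?f = "\<lambda>x y. indicat_real {x<..} y * p y * h x"
  have abs: "tail (\<lambda>y. \<bar>p y\<bar>) \<in> L2 0 1" by (rule tail_L2[OF _ a, of _ C]) (use le in auto)
  have "integrable (I01 \<Otimes>\<^sub>M I01) (\<lambda>(x, y). ?f x y)"
  proof (rule Fubini_integrable)
    have "integrable I01 (\<lambda>x. tail (\<lambda>y. \<bar>p y\<bar>) x * \<bar>h x\<bar>)"
      by (intro L2_integrable_mult abs L2_abs h)
    then show "integrable I01 (\<lambda>x. LINT y|I01. norm (case (x, y) of (x, y) \<Rightarrow> ?f x y))"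
      by (simp add: tail_def abs_mult)
    show "AE x in I01. integrable I01 (\<lambda>y. case (x, y) of (x, y) \<Rightarrow> ?f x y)"
    proof (rule AE_I2)
      fix x assume "x \<in> space I01"
      then have x: "0 < x" "x < 1" by auto
      have "0 \<le> (a - 1) / 2" "0 < 1/2 - a + (a - 1) / 2 + 1" using a by (auto simp: field_simps)
      from tail_bound(1)[OF p le this x] show "integrable I01 (\<lambda>y. case (x, y) of (x, y) \<Rightarrow> ?f x y)"
        by simp
    qed
  qed (rule kernel_measurable[OF p hm])
  from Fubini_integral[OF this]
  have "(LINT y|I01. LINT x|I01. ?f x y) = (LINT x|I01. LINT y|I01. ?f x y)" .
  moreover have "(LINT x|I01. ?f x y) = p y * (ind y \<bullet> cls h)" for y
  proof -
    have "(LINT x|I01. ?f x y) = (LINT x|I01. p y * (indicat_real {..<y} x * h x))"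
      by (rule Bochner_Integration.integral_cong) (auto simp: indicator_def)
    then show ?thesis by (simp add: inner_ind_cls h)
  qed
  ultimately show ?thesis by (simp add: tail_def)
qed

lemma tail_complement:
  assumes p: "integrable I01 p" and x: "0 < x" "x < 1"
  shows "tail p x = (LINT y|I01. p y) - (LINT y|I01. indicat_real {..<x} y * p y)"
proof -
  have m: "p \<in> borel_measurable I01" using p by auto
  have i: "integrable I01 (\<lambda>y. indicat_real {..<x} y * p y)"
    by (rule Bochner_Integration.integrable_bound[OF p]) (use m in \<open>auto simp: indicator_def\<close>)
  have "tail p x = (LINT y|I01. p y - indicat_real {..<x} y * p y)"
    unfolding tail_def
  proof (rule integral_cong_AE)
    have "AE y in lebesgue. y \<noteq> x" by (rule AE_completion) (rule AE_lborel_singleton)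
    then have "AE y in lebesgue. y \<in> {0<..<1} \<longrightarrow> y \<noteq> x" by eventually_elim simp
    then have "AE y in I01. y \<noteq> x" by (simp add: AE_restrict_space_iff)
    then show "AE y in I01. indicat_real {x<..} y * p y = p y - indicat_real {..<x} y * p y"
      by eventually_elim (auto simp: indicator_def)
  qed (use m in measurable)
  also have "\<dots> = (LINT y|I01. p y) - (LINT y|I01. indicat_real {..<x} y * p y)"
    by (rule Bochner_Integration.integral_diff[OF p i])
  finally show ?thesis .
qed

lemma zero_of_AE_zero_continuous:
  fixes f :: "real \<Rightarrow> real"
  assumes f: "continuous_on {0..1} f" and ae: "AE x in I01. f x = 0" and y: "y \<in> {0..1}"
  shows "f y = 0"
proof (rule ccontr)
  assume "f y \<noteq> 0"
  then obtain e where e: "0 < e" "\<And>z. z \<in> {0..1} \<Longrightarrow> dist z y < e \<Longrightarrow> dist (f z) (f y) < \<bar>f y\<bar>"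
    using f y unfolding continuous_on_iff by (metis zero_less_abs_iff)
  define l where "l = max 0 (y - e)" define r where "r = min 1 (y + e)"
  have lr: "l < r" "0 \<le> l" "r \<le> 1" using e(1) y by (auto simp: l_def r_def)
  have "AE x in I01. x \<notin> {l<..<r}"
    using ae
  proof eventually_elim
    case (elim x)
    show ?case
    proof
      assume "x \<in> {l<..<r}"
      then have "x \<in> {0..1}" "dist x y < e" by (auto simp: l_def r_def dist_real_def)
      from e(2)[OF this] elim show False by (simp add: dist_real_def)
    qed
  qed
  then have "AE x in lebesgue. x \<in> {0<..<1} \<longrightarrow> x \<notin> {l<..<r}" by (simp add: AE_restrict_space_iff)
  then have "AE x in lebesgue. x \<notin> {l<..<r}" by eventually_elim (use lr in auto)
  then have "{l<..<r} \<in> null_sets lebesgue" by (subst (asm) AE_iff_null_sets[symmetric]) auto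
  then have "emeasure lebesgue {l<..<r} = 0" by auto
  then show False using lr by simp
qed

lemma primitive_bound_of_AE_bound:
  assumes le: "AE x in I01. \<bar>rep g x\<bar> \<le> C * x powr (- b)" and b: "b < 1" and y: "0 < y" "y < 1"
  shows "\<bar>ind y \<bullet> g\<bar> \<le> C / (1 - b) * y powr (1 - b)"
proof -
  have i: "integrable I01 (\<lambda>x. C * (indicat_real {..<y} x * x powr (- b)))"
    by (intro integrable_mult_right powr_integral_I01) (use b y in auto)
  have ip: "integrable I01 (\<lambda>x. indicat_real {..<y} x * rep g x)"
    by (intro L2_integrable_mult indicator_L2 rep_L2)
  have "\<bar>ind y \<bullet> g\<bar> = \<bar>LINT x|I01. indicat_real {..<y} x * rep g x\<bar>"
    using inner_ind_cls[OF rep_L2, of y g] by (simp add: cls_rep)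
  also have "\<dots> \<le> (LINT x|I01. \<bar>indicat_real {..<y} x * rep g x\<bar>)"
    by (rule integral_abs_bound)
  also have "\<dots> \<le> (LINT x|I01. C * (indicat_real {..<y} x * x powr (- b)))"
  proof (rule integral_mono_AE)
    show "AE x in I01. \<bar>indicat_real {..<y} x * rep g x\<bar> \<le> C * (indicat_real {..<y} x * x powr (- b))"
      using le by eventually_elim (auto simp: indicator_def)
  qed (use i ip in auto)
  also have "\<dots> = C * (y powr (- b + 1) / (- b + 1))"
    using powr_integral_I01(2)[of "- b" y] b y by simp
  finally show ?thesis by (simp add: add.commute)
qed

lemma cls_sum:
  fixes f :: "nat \<Rightarrow> real \<Rightarrow> real" and n :: nat and c :: "nat \<Rightarrow> real"
  assumes "\<And>k. f k \<in> L2 0 1"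
  shows "(\<lambda>x. \<Sum>k<n. c k * f k x) \<in> L2 0 1 \<and> cls (\<lambda>x. \<Sum>k<n. c k * f k x) = (\<Sum>k<n. c k *\<^sub>R cls (f k))"
proof (induction n)
  case 0 show ?case by (simp add: L2_const cls_zero)
next
  case (Suc n)
  then show ?case
    using L2_add[of "\<lambda>x. \<Sum>k<n. c k * f k x" 0 1 "\<lambda>x. c n * f n x"] L2_cmult[OF assms, of "c n" n]
      cls_add[of "\<lambda>x. \<Sum>k<n. c k * f k x" "\<lambda>x. c n * f n x"] cls_cmult[OF assms, of "c n" n]
    by simp
qed

text \<open>A shift of the index costs only a geometric factor, which a smaller radius
  absorbs.\<close>

lemma fact_add_le: "fact (n + q) \<le> (2 ^ (n + q) * fact n * fact q :: real)"
proof -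
  have "fact (n + q) = (fact q * fact n * real ((n + q) choose q) :: real)"
    using binomial_fact_lemma[of q "n + q"] by (metis add_diff_cancel_right' le_add2 of_nat_fact of_nat_mult)
  also have "\<dots> \<le> fact q * fact n * 2 ^ (n + q)"
  proof (rule mult_left_mono)
    have "real ((n + q) choose q) \<le> real (2 ^ (n + q))" by (rule of_nat_mono) (rule binomial_le_pow2)
    then show "real ((n + q) choose q) \<le> 2 ^ (n + q)" by simp
  qed simp
  finally show ?thesis by (simp add: mult_ac)
qed

section \<open>The inverse of the degenerate operator\<close>

locale degenerate =
  fixes a :: real
  assumes a1: "1 \<le> a" and a2: "a < 2"
begin

text \<open>\<open>u = G g\<close> solves \<open>- (x\<^sup>a u')' = g\<close> with zero flux at \<open>0\<close> and \<open>u 1 = 0\<close>; \<open>dens g\<close> is \<open>- u'\<close>.\<close>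

definition dens :: "l2 \<Rightarrow> real \<Rightarrow> real" where "dens g y = y powr (- a) * (ind y \<bullet> g)"
definition Gf :: "l2 \<Rightarrow> real \<Rightarrow> real" where "Gf g = tail (dens g)"
definition G :: "l2 \<Rightarrow> l2" where "G g = cls (Gf g)"

lemma dens_measurable [measurable]: "dens g \<in> borel_measurable I01"
  unfolding dens_def by measurable

lemma dens_le_of_primitive:
  assumes "\<bar>ind y \<bullet> g\<bar> \<le> C * y powr p" "0 < y"
  shows "\<bar>dens g y\<bar> \<le> C * y powr (p - a)"
proof -
  have "\<bar>dens g y\<bar> = y powr (- a) * \<bar>ind y \<bullet> g\<bar>" by (simp add: dens_def abs_mult)
  also have "\<dots> \<le> y powr (- a) * (C * y powr p)" using assms by (intro mult_left_mono) auto
  also have "\<dots> = C * (y powr (- a) * y powr p)" by simp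
  also have "y powr (- a) * y powr p = y powr (p - a)" by (simp add: powr_add[symmetric])
  finally show ?thesis .
qed

lemma primitive_le_norm: "0 < y \<Longrightarrow> y < 1 \<Longrightarrow> \<bar>ind y \<bullet> g\<bar> \<le> norm g * y powr (1/2)"
  using abs_primitive_le[of y g] by (simp add: powr_half_sqrt mult.commute)

lemma dens_le: "0 < y \<Longrightarrow> y < 1 \<Longrightarrow> \<bar>dens g y\<bar> \<le> norm g * y powr (1/2 - a)"
  by (rule dens_le_of_primitive[OF primitive_le_norm])

lemma Gf_L2: "Gf g \<in> L2 0 1"
  unfolding Gf_def by (rule tail_L2[OF dens_measurable a2 a1 dens_le])

lemma rep_G: "AE x in I01. rep (G g) x = Gf g x"
  unfolding G_def by (rule rep_cls[OF Gf_L2])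

lemma dens_tail_integrable:
  assumes "0 < x" "x < 1"
  shows "integrable I01 (\<lambda>y. indicat_real {x<..} y * dens g y)"
proof (rule tail_bound(1)[OF dens_measurable dens_le])
  show "0 \<le> (a - 1) / 2" "0 < 1/2 - a + (a - 1) / 2 + 1" using a1 a2 by (auto simp: field_simps)
qed (use assms in auto)

lemma dens_add: "dens (g + h) y = dens g y + dens h y"
  by (simp add: dens_def inner_add_right algebra_simps)

lemma dens_scaleR: "dens (c *\<^sub>R g) y = c * dens g y"
  by (simp add: dens_def)

lemma Gf_add: "0 < x \<Longrightarrow> x < 1 \<Longrightarrow> Gf (g + h) x = Gf g x + Gf h x"
  by (simp add: Gf_def tail_def dens_add distrib_left Bochner_Integration.integral_add dens_tail_integrable)

lemma Gf_scaleR: "Gf (c *\<^sub>R g) x = c * Gf g x"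
  by (simp add: Gf_def tail_def dens_scaleR mult.left_commute)

lemma linear_G: "linear G"
proof (rule linearI)
  fix g h c
  have "cls (Gf (g + h)) = cls (\<lambda>x. Gf g x + Gf h x)"
    by (intro cls_eqI Gf_L2 L2_add AE_I2) (simp add: Gf_add)
  then show "G (g + h) = G g + G h" by (simp add: G_def cls_add Gf_L2)
  have "cls (Gf (c *\<^sub>R g)) = cls (\<lambda>x. c * Gf g x)"
    by (intro cls_eqI Gf_L2 L2_cmult AE_I2) (simp add: Gf_scaleR)
  then show "G (c *\<^sub>R g) = c *\<^sub>R G g" by (simp add: G_def cls_cmult Gf_L2)
qed

text \<open>With V the primitive operator, G is V followed by the weight y^(-a) and by the adjoint
  of V. Symmetry, positivity and injectivity are read off from this form.\<close>

lemma G_inner: "G g \<bullet> h = (LINT y|I01. y powr (- a) * (ind y \<bullet> g) * (ind y \<bullet> h))"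
proof -
  have "G g \<bullet> h = cls (Gf g) \<bullet> cls (rep h)" by (simp add: G_def cls_rep)
  also have "\<dots> = (LINT x|I01. tail (dens g) x * rep h x)"
    by (simp add: inner_cls Gf_L2 rep_L2 Gf_def[symmetric])
  also have "\<dots> = (LINT y|I01. dens g y * (ind y \<bullet> cls (rep h)))"
    by (rule tail_adjoint[OF dens_measurable a2 a1 dens_le rep_L2])
  finally show ?thesis by (simp add: dens_def cls_rep)
qed

lemma G_sym: "G g \<bullet> h = g \<bullet> G h"
  by (subst inner_commute[of g], simp only: G_inner, rule Bochner_Integration.integral_cong) auto

lemma G_nonneg: "0 \<le> G g \<bullet> g"
  unfolding G_inner by (rule integral_nonneg_AE) (auto simp: mult.assoc)

text \<open>Cauchy-Schwarz bounds the squared primitive by y |g|^2, and the integral of y^(1 - a) is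
  1 / (2 - a). This is where the scaling constant 2 - a of the contraction comes from.\<close>

lemma G_integrable: "integrable I01 (\<lambda>y. y powr (- a) * (ind y \<bullet> g) * (ind y \<bullet> g))"
  and G_le: "(2 - a) * (G g \<bullet> g) \<le> g \<bullet> g"
proof -
  have i: "integrable I01 (\<lambda>y. (norm g)\<^sup>2 * y powr (1 - a))"
    using a2 by (intro integrable_mult_right powr_integral_I01_1) auto
  have le: "y powr (- a) * (ind y \<bullet> g) * (ind y \<bullet> g) \<le> (norm g)\<^sup>2 * y powr (1 - a)" if "0 < y" "y < 1" for y
  proof -
    have "\<bar>ind y \<bullet> g\<bar>\<^sup>2 \<le> (sqrt y * norm g)\<^sup>2"
      using that by (intro power_mono abs_primitive_le) auto
    then have "(ind y \<bullet> g)\<^sup>2 \<le> y * (norm g)\<^sup>2" using that by (simp add: power_mult_distrib)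
    then have "y powr (- a) * (ind y \<bullet> g)\<^sup>2 \<le> y powr (- a) * (y * (norm g)\<^sup>2)"
      by (intro mult_left_mono) auto
    also have "\<dots> = (norm g)\<^sup>2 * (y powr (- a) * y powr 1)" using that by simp
    also have "y powr (- a) * y powr 1 = y powr (1 - a)" by (simp only: powr_add[symmetric]) simp
    finally show ?thesis by (simp add: power2_eq_square mult.assoc)
  qed
  have nn: "0 \<le> y powr (- a) * (ind y \<bullet> g) * (ind y \<bullet> g)" for y by (simp add: mult.assoc)
  show int: "integrable I01 (\<lambda>y. y powr (- a) * (ind y \<bullet> g) * (ind y \<bullet> g))"
    by (rule Bochner_Integration.integrable_bound[OF i]) (measurable, rule AE_I2, use le nn in auto)
  have "G g \<bullet> g \<le> (LINT y|I01. (norm g)\<^sup>2 * y powr (1 - a))"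
    unfolding G_inner by (rule integral_mono[OF int i]) (use le in auto)
  also have "\<dots> = (norm g)\<^sup>2 * (1 / (2 - a))"
    using powr_integral_I01_1(2)[of "1 - a"] a2 by simp
  finally show "(2 - a) * (G g \<bullet> g) \<le> g \<bullet> g"
    using a2 by (simp add: power2_norm_eq_inner field_simps)
qed

text \<open>A vanishing form makes the primitive zero almost everywhere, hence everywhere by
  continuity.\<close>

lemma G_inj:
  assumes "G g = 0"
  shows "g = 0"
proof (rule eq_0_of_primitive_zero)
  have nn: "0 \<le> y powr (- a) * (ind y \<bullet> g) * (ind y \<bullet> g)" for y by (simp add: mult.assoc)
  have "(LINT y|I01. y powr (- a) * (ind y \<bullet> g) * (ind y \<bullet> g)) = 0"
    using assms by (simp add: G_inner[symmetric])
  then have "AE y in I01. y powr (- a) * (ind y \<bullet> g) * (ind y \<bullet> g) = 0"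
    using integral_nonneg_eq_0_iff_AE[OF G_integrable] nn by blast
  then have ae: "AE y in I01. ind y \<bullet> g = 0"
    using AE_I01_space by eventually_elim auto
  fix y :: real assume "0 < y" "y < 1"
  then show "ind y \<bullet> g = 0"
    using zero_of_AE_zero_continuous[OF continuous_on_primitive ae, of y] by simp
qed

lemma heat_chain:
  obtains v :: "nat \<Rightarrow> real \<Rightarrow> l2"
  where "\<And>n t. 0 < t \<Longrightarrow> (v n has_vector_derivative v (Suc n) t) (at t)"
    and "\<And>n t. 0 < t \<Longrightarrow> v n t = - G (v (Suc n) t)"
    and "\<And>n t. 0 < t \<Longrightarrow> norm (v n t) \<le> fact n / t ^ n * norm u"
    and "(v 0 \<longlongrightarrow> u) (at_right 0)"
proof -
  have "0 < 2 - a" using a2 by simp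
  from heat_chain_exists[OF linear_G G_sym G_nonneg this G_le G_inj, of u] that show thesis by metis
qed

lemma G_bound_of_primitive_bound:
  assumes le: "\<And>y. 0 < y \<Longrightarrow> y < 1 \<Longrightarrow> \<bar>ind y \<bullet> g\<bar> \<le> C * y powr (1 - b)"
    and c: "0 \<le> c" "0 < 2 - a - b + c"
  shows "AE x in I01. \<bar>rep (G g) x\<bar> \<le> C / (2 - a - b + c) * x powr (- c)"
  using rep_G[of g] AE_I01_space
proof eventually_elim
  case (elim x)
  have d: "\<bar>dens g y\<bar> \<le> C * y powr (1 - b - a)" if "0 < y" "y < 1" for y
    using dens_le_of_primitive[OF le[OF that] that(1)] .
  have "\<bar>tail (dens g) x\<bar> \<le> C / ((1 - b - a) + c + 1) * x powr (- c)"
    by (rule tail_bound(2)[OF dens_measurable d]) (use c elim in auto)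
  moreover have "(1 - b - a) + c + 1 = 2 - a - b + c" by simp
  ultimately show ?case using elim by (simp add: Gf_def)
qed

text \<open>Each application of \<open>G\<close> improves the exponent of the singularity at the origin; the choice
  \<open>max 0 (1 / 2 - j (2 - a) / 2)\<close> avoids the logarithmic borderline case.\<close>

lemma G_pow_primitive_bound:
  "\<exists>K\<ge>0. \<forall>g y. 0 < y \<longrightarrow> y < 1 \<longrightarrow>
    \<bar>ind y \<bullet> (G ^^ j) g\<bar> \<le> K * norm g * y powr (1 - max 0 (1/2 - real j * (2 - a) / 2))"
proof (induction j)
  case 0
  show ?case by (rule exI[of _ 1]) (use primitive_le_norm in simp)
next
  case (Suc j)
  define b where "b = max 0 (1/2 - real j * (2 - a) / 2)"
  define c where "c = max 0 (1/2 - real (Suc j) * (2 - a) / 2)"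
  obtain K where K: "0 \<le> K" "\<And>g y. 0 < y \<Longrightarrow> y < 1 \<Longrightarrow> \<bar>ind y \<bullet> (G ^^ j) g\<bar> \<le> K * norm g * y powr (1 - b)"
    using Suc unfolding b_def by blast
  have "0 \<le> real (Suc j) * (2 - a) / 2" using a2 by simp
  then have c: "0 \<le> c" "c < 1" unfolding c_def by linarith+
  \<comment> \<open>Two integrations against the weight could gain 2 - a; claiming only half of it
    leaves the slack (2 - a) / 2 that the strict inequality \<open>e\<close> needs.\<close>
  have "b - (2 - a) / 2 \<le> c" using a2 by (auto simp: b_def c_def max_def field_simps)
  then have e: "0 < 2 - a - b + c" using a2 by (simp add: field_simps)
  show ?case
  proof (intro exI[of _ "K / (2 - a - b + c) / (1 - c)"] conjI allI impI)
    show "0 \<le> K / (2 - a - b + c) / (1 - c)" using K e c by simp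
    fix g y assume y: "(0::real) < y" "y < 1"
    have "AE x in I01. \<bar>rep (G ((G ^^ j) g)) x\<bar> \<le> K * norm g / (2 - a - b + c) * x powr (- c)"
      by (rule G_bound_of_primitive_bound[OF K(2) c(1) e])
    from primitive_bound_of_AE_bound[OF this c(2) y]
    have "\<bar>ind y \<bullet> (G ^^ Suc j) g\<bar> \<le> K * norm g / (2 - a - b + c) / (1 - c) * y powr (1 - c)" by simp
    then show "\<bar>ind y \<bullet> (G ^^ Suc j) g\<bar> \<le> K / (2 - a - b + c) / (1 - c) * norm g
        * y powr (1 - max 0 (1/2 - real (Suc j) * (2 - a) / 2))"
      unfolding c_def[symmetric] by (simp add: mult.commute)
  qed
qed

text \<open>The exponent reaches 0 once j \<ge> 1 / (2 - a), and one further application of G gives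
  an essentially bounded function. After this fixed power of G, \<open>ell\<close> becomes a bounded
  functional on L2.\<close>

lemma G_pow_bounded:
  obtains N K where "0 \<le> K" "\<And>g. AE x in I01. \<bar>rep ((G ^^ N) g) x\<bar> \<le> K * norm g"
proof -
  obtain j :: nat where j: "1 / (2 - a) \<le> real j" using real_arch_simple by blast
  then have "1 \<le> real j * (2 - a)" using a2 by (simp add: field_simps)
  then have z: "max 0 (1/2 - real j * (2 - a) / 2) = 0" by simp
  obtain K where K: "0 \<le> K" "\<And>g y. 0 < y \<Longrightarrow> y < 1 \<Longrightarrow> \<bar>ind y \<bullet> (G ^^ j) g\<bar> \<le> K * norm g * y powr (1 - 0)"
    using G_pow_primitive_bound[of j] unfolding z by blast
  show thesis
  proof (rule that[of "K / (2 - a)" "Suc j"])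
    show "0 \<le> K / (2 - a)" using K a2 by simp
    fix g
    have "AE x in I01. \<bar>rep (G ((G ^^ j) g)) x\<bar> \<le> K * norm g / (2 - a - 0 + 0) * x powr (- 0)"
      by (rule G_bound_of_primitive_bound[OF K(2)]) (use a2 in auto)
    then show "AE x in I01. \<bar>rep ((G ^^ Suc j) g) x\<bar> \<le> K / (2 - a) * norm g"
      using AE_I01_space by eventually_elim (simp add: mult.commute)
  qed
qed

text \<open>Up to the scaling z / (2 - a)^2 of the variable, these are the coefficients of the
  hypergeometric series 0F1 with parameter 1 / (2 - a); (a - 1) / (2 - a) is the order of the
  related Bessel functions. The recursion \<open>bk_Suc\<close> shows the two denominators that
  arise when x^((2 - a) k) is integrated twice.\<close>

definition bk :: "nat \<Rightarrow> real" where
  "bk k = 1 / ((2 - a) ^ (2 * k) * fact k * (\<Prod>j=1..k. real j + (a - 1) / (2 - a)))"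

lemma bk_0: "bk 0 = 1" by (simp add: bk_def)

lemma bk_Suc: "bk (Suc k) = bk k / (((2 - a) * real k + 1) * ((2 - a) * real (Suc k)))"
proof -
  have d: "2 - a \<noteq> 0" using a2 by simp
  have e: "(2 - a) * (real (Suc k) + (a - 1) / (2 - a)) = (2 - a) * real k + 1"
    using d by (simp add: field_simps)
  define Q where "Q = (\<Prod>j=1..k. real j + (a - 1) / (2 - a))"
  define Z where "Z = real (Suc k) + (a - 1) / (2 - a)"
  have "bk (Suc k) = 1 / ((2 - a) ^ (2 * k) * (2 - a) * (2 - a) * (real (Suc k) * fact k) * (Q * Z))"
    by (simp add: bk_def Q_def Z_def mult_ac)
  also have "\<dots> = 1 / (((2 - a) ^ (2 * k) * fact k * Q) * (((2 - a) * Z) * ((2 - a) * real (Suc k))))"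
    by (simp only: mult_ac)
  also have "\<dots> = bk k / (((2 - a) * real k + 1) * ((2 - a) * real (Suc k)))"
    unfolding bk_def Q_def[symmetric] using e by (simp add: Z_def)
  finally show ?thesis .
qed

text \<open>The shift (a - 1) / (2 - a) is nonnegative, so the product dominates k!. This yields the
  decay 1 / (k!)^2 against which Gevrey growth is summed.\<close>

lemma bk_bounds: "0 < bk k" "bk k \<le> 1 / ((2 - a) ^ (2 * k) * (fact k * fact k))"
proof -
  have p: "fact k \<le> (\<Prod>j=1..k. real j + (a - 1) / (2 - a))"
  proof -
    have "(\<Prod>j=1..k. real j) \<le> (\<Prod>j=1..k. real j + (a - 1) / (2 - a))"
      using a1 a2 by (intro prod_mono) auto
    then show ?thesis by (simp add: fact_prod)
  qed
  then have p0: "0 < (\<Prod>j=1..k. real j + (a - 1) / (2 - a))" by (rule less_le_trans[OF fact_gt_zero])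
  show "0 < bk k" unfolding bk_def using a2 p0 by simp
  show "bk k \<le> 1 / ((2 - a) ^ (2 * k) * (fact k * fact k))"
    unfolding bk_def mult.assoc using a2 p p0
    by (intro divide_left_mono mult_left_mono mult_pos_pos zero_less_power) auto
qed

text \<open>With \<open>J g x = \<integral>\<^sub>0\<^sup>x y\<^sup>-\<^sup>a \<integral>\<^sub>0\<^sup>y g\<close>, the functions \<open>P k\<close> are the iterates \<open>J\<^sup>k 1\<close>
  and \<open>G g = ell g - J g\<close> whenever \<open>ell g\<close> is an absolutely convergent integral.\<close>

definition P :: "nat \<Rightarrow> real \<Rightarrow> real" where "P k x = bk k * x powr ((2 - a) * real k)"
definition PL :: "nat \<Rightarrow> l2" where "PL k = cls (P k)"

lemma P_measurable [measurable]: "P k \<in> borel_measurable I01"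
  unfolding P_def by measurable

lemma P_bounds: "0 < x \<Longrightarrow> x < 1 \<Longrightarrow> 0 \<le> P k x \<and> P k x \<le> bk k"
  using bk_bounds(1)[of k] a2 by (auto simp: P_def mult_left_le powr_le1)

lemma P_0: "0 < x \<Longrightarrow> P 0 x = 1" by (simp add: P_def bk_0)

lemma P_L2: "P k \<in> L2 0 1"
  by (rule L2_bounded[of _ _ _ "bk k"]) (measurable, rule AE_I2, use P_bounds[of _ k] in force)

lemma PL_0: "PL 0 = cls (\<lambda>_. 1)"
  unfolding PL_def by (intro cls_eqI P_L2 L2_const AE_I2) (simp add: P_0)

lemma norm_PL_le: "norm (PL k) \<le> bk k"
  unfolding PL_def by (rule norm_cls_le_bound) (use P_bounds[of _ k] bk_bounds(1)[of k] in \<open>auto intro!: AE_I2\<close>)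

lemma inner_ind_PL:
  assumes "0 \<le> y" "y \<le> 1"
  shows "ind y \<bullet> PL k = bk k / ((2 - a) * real k + 1) * y powr ((2 - a) * real k + 1)"
proof -
  have "ind y \<bullet> PL k = (LINT x|I01. bk k * (indicat_real {..<y} x * x powr ((2 - a) * real k)))"
    by (simp add: PL_def inner_ind_cls P_L2 P_def mult.left_commute)
  also have "\<dots> = bk k * (y powr ((2 - a) * real k + 1) / ((2 - a) * real k + 1))"
    using powr_integral_I01(2)[of "(2 - a) * real k" y] assms a2 by (simp add: less_le_trans[of _ 0])
  finally show ?thesis by simp
qed

lemma dens_PL:
  assumes "0 < y" "y < 1"
  shows "dens (PL k) y = bk k / ((2 - a) * real k + 1) * y powr ((2 - a) * real (Suc k) - 1)"
proof -
  have "dens (PL k) y = bk k / ((2 - a) * real k + 1) * (y powr (- a) * y powr ((2 - a) * real k + 1))"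
    using assms by (simp add: dens_def inner_ind_PL)
  also have "y powr (- a) * y powr ((2 - a) * real k + 1) = y powr ((2 - a) * real (Suc k) - 1)"
    by (simp add: powr_add[symmetric] algebra_simps)
  finally show ?thesis .
qed

definition Jf :: "l2 \<Rightarrow> real \<Rightarrow> real" where "Jf g x = (LINT y|I01. indicat_real {..<x} y * dens g y)"
text \<open>Since J g vanishes at 0, this is the value of G g at the origin, obtained without
  choosing a representative.\<close>

definition ell :: "l2 \<Rightarrow> real" where "ell g = (LINT y|I01. dens g y)"

lemma integrable_indicator_dens: "integrable I01 (dens g) \<Longrightarrow> integrable I01 (\<lambda>y. indicat_real {..<x} y * dens g y)"
  by (rule Bochner_Integration.integrable_bound) (auto simp: indicator_def)

lemma Gf_eq: "integrable I01 (dens g) \<Longrightarrow> 0 < x \<Longrightarrow> x < 1 \<Longrightarrow> Gf g x = ell g - Jf g x"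
  unfolding Gf_def ell_def Jf_def by (rule tail_complement)

lemma dens_PL_integrable: "integrable I01 (dens (PL k))"
  and Jf_PL: "0 \<le> x \<Longrightarrow> x \<le> 1 \<Longrightarrow> Jf (PL k) x = P (Suc k) x"
  and ell_PL: "ell (PL k) = bk (Suc k)"
proof -
  let ?q = "(2 - a) * real (Suc k) - 1" let ?c = "bk k / ((2 - a) * real k + 1)"
  have q: "- 1 < ?q" using a2 by simp
  have c: "?c / (?q + 1) = bk (Suc k)" by (simp add: bk_Suc)
  have i: "integrable I01 (\<lambda>y. ?c * y powr ?q)" by (intro integrable_mult_right powr_integral_I01_1 q)
  have eq: "dens (PL k) y = ?c * y powr ?q" if "y \<in> space I01" for y using dens_PL[of y k] that by simp
  show "integrable I01 (dens (PL k))"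
  proof -
    have "integrable I01 (dens (PL k)) \<longleftrightarrow> integrable I01 (\<lambda>y. ?c * y powr ?q)"
      by (rule Bochner_Integration.integrable_cong) (use eq in auto)
    then show ?thesis using i by simp
  qed
  have "ell (PL k) = (LINT y|I01. ?c * y powr ?q)" unfolding ell_def
    by (rule Bochner_Integration.integral_cong[OF refl eq])
  also have "\<dots> = ?c * (1 / (?q + 1))" by (simp only: integral_mult_right_zero powr_integral_I01_1(2)[OF q])
  also have "\<dots> = ?c / (?q + 1)" by simp
  finally show "ell (PL k) = bk (Suc k)" unfolding c .
  assume x: "0 \<le> x" "x \<le> 1"
  have "Jf (PL k) x = (LINT y|I01. ?c * (indicat_real {..<x} y * y powr ?q))" unfolding Jf_def
    by (rule Bochner_Integration.integral_cong[OF refl]) (simp add: eq)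
  also have "\<dots> = ?c * (x powr (?q + 1) / (?q + 1))" using powr_integral_I01(2)[OF q x] by simp
  also have "\<dots> = bk (Suc k) * x powr ((2 - a) * real (Suc k))" unfolding c[symmetric] by simp
  finally show "Jf (PL k) x = P (Suc k) x" by (simp add: P_def)
qed

text \<open>The constant is the value of \<open>P (Suc k)\<close> at x = 1: it restores the zero
  boundary value there.\<close>

lemma G_PL: "G (PL k) = bk (Suc k) *\<^sub>R PL 0 - PL (Suc k)"
proof -
  have "cls (Gf (PL k)) = cls (\<lambda>x. bk (Suc k) * P 0 x - P (Suc k) x)"
    by (intro cls_eqI Gf_L2 L2_diff L2_cmult P_L2 AE_I2)
      (simp add: Gf_eq dens_PL_integrable Jf_PL ell_PL P_0)
  then show ?thesis by (simp add: G_def cls_diff cls_cmult L2_cmult P_L2 PL_def)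
qed

section \<open>Expansion of a chain at the origin\<close>

lemma bounded_dens:
  assumes "AE x in I01. \<bar>rep g x\<bar> \<le> C"
  shows "integrable I01 (dens g)" and "\<bar>ell g\<bar> \<le> C / (2 - a)"
proof -
  have b: "\<bar>ind y \<bullet> g\<bar> \<le> C / (1 - 0) * y powr (1 - 0)" if "0 < y" "y < 1" for y
  proof (rule primitive_bound_of_AE_bound[OF _ _ that])
    show "AE x in I01. \<bar>rep g x\<bar> \<le> C * x powr (- 0)"
      using assms AE_I01_space by eventually_elim simp
  qed simp
  have i: "integrable I01 (\<lambda>y. C * y powr (1 - a))"
    using a2 by (intro integrable_mult_right powr_integral_I01_1) auto
  have le: "\<bar>dens g y\<bar> \<le> C * y powr (1 - a)" if "0 < y" "y < 1" for y
    using dens_le_of_primitive[OF b[OF that] that(1)] by simp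
  show int: "integrable I01 (dens g)"
    by (rule Bochner_Integration.integrable_bound[OF i]) (measurable, rule AE_I2, use le in force)
  have "\<bar>ell g\<bar> \<le> (LINT y|I01. \<bar>dens g y\<bar>)" unfolding ell_def by (rule integral_abs_bound)
  also have "\<dots> \<le> (LINT y|I01. C * y powr (1 - a))" by (rule integral_mono) (use int i le in auto)
  also have "\<dots> = C / (2 - a)" using powr_integral_I01_1(2)[of "1 - a"] a2 by simp
  finally show "\<bar>ell g\<bar> \<le> C / (2 - a)" .
qed

text \<open>J has a nonnegative kernel and maps \<open>P n\<close> to \<open>P (Suc n)\<close>, so a
  pointwise bound by a multiple of \<open>P n\<close> advances by one index.\<close>

lemma Jf_le:
  assumes r: "AE x in I01. \<bar>rep r x\<bar> \<le> B * P n x" and x: "0 < x" "x < 1"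
  shows "\<bar>Jf r x\<bar> \<le> B * P (Suc n) x"
proof -
  have p: "\<bar>ind y \<bullet> r\<bar> \<le> B * (ind y \<bullet> PL n)" for y
  proof -
    have i: "integrable I01 (\<lambda>x. B * (indicat_real {..<y} x * P n x))"
      by (intro integrable_mult_right L2_integrable_mult indicator_L2 P_L2)
    have ip: "integrable I01 (\<lambda>x. indicat_real {..<y} x * rep r x)"
      by (intro L2_integrable_mult indicator_L2 rep_L2)
    have "\<bar>ind y \<bullet> r\<bar> = \<bar>LINT x|I01. indicat_real {..<y} x * rep r x\<bar>"
      using inner_ind_cls[OF rep_L2, of y r] by (simp add: cls_rep)
    also have "\<dots> \<le> (LINT x|I01. \<bar>indicat_real {..<y} x * rep r x\<bar>)" by (rule integral_abs_bound)
    also have "\<dots> \<le> (LINT x|I01. B * (indicat_real {..<y} x * P n x))"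
    proof (rule integral_mono_AE)
      show "AE x in I01. \<bar>indicat_real {..<y} x * rep r x\<bar> \<le> B * (indicat_real {..<y} x * P n x)"
        using r by eventually_elim (auto simp: indicator_def)
    qed (use i ip in auto)
    also have "\<dots> = B * (ind y \<bullet> PL n)" by (simp add: PL_def inner_ind_cls P_L2)
    finally show ?thesis .
  qed
  have d: "\<bar>dens r y\<bar> \<le> B * dens (PL n) y" for y
  proof -
    have "\<bar>dens r y\<bar> = y powr (- a) * \<bar>ind y \<bullet> r\<bar>" by (simp add: dens_def abs_mult)
    also have "\<dots> \<le> y powr (- a) * (B * (ind y \<bullet> PL n))" by (intro mult_left_mono p) auto
    finally show ?thesis by (simp add: dens_def mult_ac)
  qed
  have i: "integrable I01 (\<lambda>y. B * (indicat_real {..<x} y * dens (PL n) y))"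
    by (intro integrable_mult_right integrable_indicator_dens dens_PL_integrable)
  have le: "\<bar>indicat_real {..<x} y * dens r y\<bar> \<le> B * (indicat_real {..<x} y * dens (PL n) y)" for y
    using d[of y] by (auto simp: indicator_def)
  have ir: "integrable I01 (\<lambda>y. indicat_real {..<x} y * dens r y)"
    by (rule Bochner_Integration.integrable_bound[OF i]) (measurable, rule AE_I2, use le in \<open>auto intro: order_trans[OF _ abs_ge_self]\<close>)
  have "\<bar>Jf r x\<bar> \<le> (LINT y|I01. \<bar>indicat_real {..<x} y * dens r y\<bar>)" unfolding Jf_def by (rule integral_abs_bound)
  also have "\<dots> \<le> (LINT y|I01. B * (indicat_real {..<x} y * dens (PL n) y))"
    by (rule integral_mono) (use ir i le in auto)
  also have "\<dots> = B * Jf (PL n) x" by (simp add: Jf_def)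
  finally show ?thesis using x by (simp add: Jf_PL)
qed

text \<open>Iterating v_m = - ell v_(m+1) + J v_(m+1) gives a Taylor expansion at the origin with
  remainder J^n v_(m+n).\<close>

lemma chain_expansion:
  fixes v :: "nat \<Rightarrow> l2"
  assumes v: "\<And>n. v n = - G (v (Suc n))" and B: "\<And>n. AE x in I01. \<bar>rep (v n) x\<bar> \<le> B n"
  shows "AE x in I01. \<bar>rep (v m) x - (\<Sum>k<n. - ell (v (Suc (m + k))) * P k x)\<bar> \<le> B (m + n) * P n x"
proof (induction n arbitrary: m)
  case 0
  show ?case using B[of m] AE_I01_space by eventually_elim (simp add: P_0)
next
  case (Suc n)
  let ?y = "\<lambda>k. - ell (v (Suc k))"
  \<comment> \<open>The remainder of \<open>v (Suc m)\<close> at order n; applying J to it produces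
    the remainder of \<open>v m\<close> at order n + 1.\<close>
  define r where "r = v (Suc m) - (\<Sum>k<n. ?y (Suc m + k) *\<^sub>R PL k)"
  have r: "r = cls (\<lambda>x. rep (v (Suc m)) x - (\<Sum>k<n. ?y (Suc m + k) * P k x))"
    using cls_sum[where f = P and n = n and c = "\<lambda>k. ?y (Suc m + k)", OF P_L2]
    by (simp add: r_def cls_diff rep_L2 cls_rep PL_def)
  have "(\<lambda>x. rep (v (Suc m)) x - (\<Sum>k<n. ?y (Suc m + k) * P k x)) \<in> L2 0 1"
    using cls_sum[where f = P and n = n and c = "\<lambda>k. ?y (Suc m + k)", OF P_L2] by (intro L2_diff rep_L2) auto
  from rep_cls[OF this] have "AE x in I01. rep r x = rep (v (Suc m)) x - (\<Sum>k<n. ?y (Suc m + k) * P k x)"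
    unfolding r .
  then have rb: "AE x in I01. \<bar>rep r x\<bar> \<le> B (Suc m + n) * P n x"
    using Suc[of "Suc m"] by eventually_elim simp
  have dv: "integrable I01 (dens (v (Suc m)))" by (rule bounded_dens(1)[OF B])
  have dr: "dens r y = dens (v (Suc m)) y - (\<Sum>k<n. ?y (Suc m + k) * dens (PL k) y)" for y
    by (simp add: dens_def r_def inner_diff_right inner_sum_right right_diff_distrib sum_distrib_left mult.left_commute)
  have Jr: "Jf r x = Jf (v (Suc m)) x - (\<Sum>k<n. ?y (Suc m + k) * P (Suc k) x)" if "0 < x" "x < 1" for x
  proof -
    have "Jf r x = (LINT y|I01. indicat_real {..<x} y * dens (v (Suc m)) y
        - (\<Sum>k<n. ?y (Suc m + k) * (indicat_real {..<x} y * dens (PL k) y)))"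
      unfolding Jf_def dr by (simp add: right_diff_distrib sum_distrib_left mult.left_commute)
    also have "\<dots> = Jf (v (Suc m)) x - (\<Sum>k<n. ?y (Suc m + k) * Jf (PL k) x)"
      unfolding Jf_def
      by (subst Bochner_Integration.integral_diff, intro integrable_indicator_dens dv,
          intro Bochner_Integration.integrable_sum integrable_mult_right integrable_indicator_dens dens_PL_integrable,
          subst Bochner_Integration.integral_sum, intro integrable_mult_right integrable_indicator_dens dens_PL_integrable)
        simp
    finally show ?thesis using that by (simp add: Jf_PL)
  qed
  have "v m = - cls (Gf (v (Suc m)))" using v[of m] by (simp add: G_def)
  then have "AE x in I01. rep (v m) x = - rep (G (v (Suc m))) x" using rep_uminus[of "G (v (Suc m))"] v[of m] by simp
  then have vm: "AE x in I01. rep (v m) x = - Gf (v (Suc m)) x"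
    using rep_G[of "v (Suc m)"] by eventually_elim simp
  show ?case using vm AE_I01_space
  proof eventually_elim
    case (elim x)
    have "(\<Sum>k<Suc n. ?y (m + k) * P k x) = ?y m + (\<Sum>k<n. ?y (Suc m + k) * P (Suc k) x)"
      using elim by (subst sum.lessThan_Suc_shift) (simp add: P_0)
    then have "rep (v m) x - (\<Sum>k<Suc n. ?y (m + k) * P k x) = Jf r x"
      using elim Gf_eq[OF dv, of x] Jr[of x] by simp
    then show ?case using Jf_le[OF rb, of x] elim by simp
  qed
qed

lemma chain_expansion_norm:
  fixes v :: "nat \<Rightarrow> l2"
  assumes v: "\<And>n. v n = - G (v (Suc n))" and B: "\<And>n. AE x in I01. \<bar>rep (v n) x\<bar> \<le> B n" and B0: "\<And>n. 0 \<le> B n"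
  shows "norm (v m - (\<Sum>k<n. - ell (v (Suc (m + k))) *\<^sub>R PL k)) \<le> B (m + n) * bk n"
proof -
  let ?f = "\<lambda>x. rep (v m) x - (\<Sum>k<n. - ell (v (Suc (m + k))) * P k x)"
  have s: "(\<lambda>x. \<Sum>k<n. - ell (v (Suc (m + k))) * P k x) \<in> L2 0 1"
     "cls (\<lambda>x. \<Sum>k<n. - ell (v (Suc (m + k))) * P k x) = (\<Sum>k<n. - ell (v (Suc (m + k))) *\<^sub>R PL k)"
    using cls_sum[where f = P and n = n and c = "\<lambda>k. - ell (v (Suc (m + k)))", OF P_L2] by (auto simp: PL_def)
  have "v m - (\<Sum>k<n. - ell (v (Suc (m + k))) *\<^sub>R PL k) = cls ?f"
    unfolding cls_diff[OF rep_L2 s(1)] s(2) cls_rep ..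
  moreover have "norm (cls ?f) \<le> B (m + n) * bk n"
  proof (rule norm_cls_le_bound)
    show "AE x in I01. \<bar>?f x\<bar> \<le> B (m + n) * bk n"
      using chain_expansion[where v = v and B = B and m = m and n = n, OF v B] AE_I01_space
    proof eventually_elim
      case (elim x)
      have "B (m + n) * P n x \<le> B (m + n) * bk n" using P_bounds[of x n] B0 elim by (intro mult_left_mono) auto
      then show ?case using elim by linarith
    qed
    show "0 \<le> B (m + n) * bk n" using B0 bk_bounds(1)[of n] by simp
  qed (rule L2_measurable[OF L2_diff[OF rep_L2 s(1)]])
  ultimately show ?thesis by simp
qed

end

context degenerate begin

text \<open>Up to sign v_n is G^N of v_(n+N), hence bounded, at the price of (n + N)! in place of
  n!. The remainder of the expansion is then at most n! / (n!)^2 times a geometric factor, and tends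
  to 0.\<close>

lemma free_evolution:
  fixes u :: l2
  obtains v :: "nat \<Rightarrow> real \<Rightarrow> l2" and y :: "nat \<Rightarrow> real \<Rightarrow> real"
  where "\<And>n t. 0 < t \<Longrightarrow> (v n has_vector_derivative v (Suc n) t) (at t)"
    and "\<And>n t. 0 < t \<Longrightarrow> v n t = - G (v (Suc n) t)"
    and "(v 0 \<longlongrightarrow> u) (at_right 0)"
    and "\<And>n t. 0 < t \<Longrightarrow> (y n has_vector_derivative y (Suc n) t) (at t)"
    and "\<And>m t. 0 < t \<Longrightarrow> (\<lambda>k. y (m + k) t *\<^sub>R PL k) sums v m t"
    and "\<And>r. 0 < r \<Longrightarrow> \<exists>M>0. \<exists>R>0. \<forall>n. \<forall>t\<ge>r. \<bar>y n t\<bar> \<le> M * fact n / R ^ n"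
proof -
  obtain v where v1: "\<And>n t. 0 < t \<Longrightarrow> (v n has_vector_derivative v (Suc n) t) (at t)"
    and v2: "\<And>n t. 0 < t \<Longrightarrow> v n t = - G (v (Suc n) t)"
    and v3: "\<And>n t. 0 < t \<Longrightarrow> norm (v n t) \<le> fact n / t ^ n * norm u"
    and v4: "(v 0 \<longlongrightarrow> u) (at_right 0)"
    using heat_chain[of u] by metis
  obtain N K where K: "0 \<le> K" and NK: "\<And>g. AE x in I01. \<bar>rep ((G ^^ N) g) x\<bar> \<le> K * norm g"
    using G_pow_bounded by metis
  have linN: "linear (G ^^ N)" by (rule linear_funpow[OF linear_G])
  have vpow: "v m t = (G ^^ j) ((- 1) ^ j *\<^sub>R v (m + j) t)" if t: "0 < t" for m j t
  proof (induction j)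
    case (Suc j)
    have "v (m + j) t = - G (v (m + Suc j) t)" using v2[OF t, of "m + j"] by simp
    then have "(- 1) ^ j *\<^sub>R v (m + j) t = G ((- 1) ^ Suc j *\<^sub>R v (m + Suc j) t)"
      by (simp add: linear_scale[OF linear_G] linear_neg[OF linear_G])
    then show ?case using Suc by (simp add: funpow_swap1)
  qed simp
  define B where "B t n = K * norm (v (n + N) t)" for t n
  have B0: "0 \<le> B t n" for t n using K by (simp add: B_def)
  have bd: "AE x in I01. \<bar>rep (v n t) x\<bar> \<le> B t n" if t: "0 < t" for n t
    using NK[of "(- 1) ^ N *\<^sub>R v (n + N) t"] unfolding vpow[OF t, of n N, symmetric]
    by (simp add: B_def)
  \<comment> \<open>Smoothing by G^N makes evaluation at the origin a bounded functional, which
    therefore commutes with the time derivative.\<close>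
  define L where "L w = ell ((G ^^ N) w)" for w
  have L: "bounded_linear L"
  proof (rule bounded_linear_intro[where K = "K / (2 - a)"])
    note i = bounded_dens(1)[OF NK]
    show "L (x + y) = L x + L y" for x y
      unfolding L_def linear_add[OF linN] ell_def dens_add
      by (rule Bochner_Integration.integral_add[OF i i])
    show "L (c *\<^sub>R x) = c *\<^sub>R L x" for c x
      unfolding L_def linear_scale[OF linN] ell_def dens_scaleR by simp
    show "norm (L x) \<le> norm x * (K / (2 - a))" for x
      using bounded_dens(2)[OF NK[of x]] by (simp add: L_def mult.commute)
  qed
  \<comment> \<open>Because v_n = - G v_(n+1), this is the value of v_n at the origin.\<close>
  define y where "y n t = - ell (v (Suc n) t)" for n t
  have yL: "y n t = - L ((- 1) ^ N *\<^sub>R v (Suc n + N) t)" if "0 < t" for n t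
    unfolding y_def L_def using vpow[OF that, of "Suc n" N] by simp
  show thesis
  proof (rule that[of v y])
    fix n and t :: real assume t: "0 < t"
    have "((\<lambda>t. (- 1) ^ N *\<^sub>R v (Suc n + N) t) has_vector_derivative (- 1) ^ N *\<^sub>R v (Suc (Suc n + N)) t) (at t)"
      by (rule bounded_linear.has_vector_derivative[OF bounded_linear_scaleR_right v1[OF t]])
    from has_vector_derivative_minus[OF bounded_linear.has_vector_derivative[OF L this]]
    have "((\<lambda>t. - L ((- 1) ^ N *\<^sub>R v (Suc n + N) t)) has_vector_derivative y (Suc n) t) (at t)"
      unfolding yL[OF t] by simp
    then show "(y n has_vector_derivative y (Suc n) t) (at t)"
      by (rule has_vector_derivative_transform_within_open[of _ _ _ "{0<..}"]) (use t yL in auto)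
  next
    fix m and t :: real assume t: "0 < t"
    let ?S = "\<lambda>n. (\<Sum>k<n. y (m + k) t *\<^sub>R PL k)"
    let ?q = "m + N"
    define C where "C = K * norm u * (2 ^ ?q * fact ?q / t ^ ?q)"
    have le: "norm (?S n - v m t) \<le> C * (inverse (fact n) * (2 / (t * (2 - a)\<^sup>2)) ^ n)" for n
    proof -
      have "norm (v m t - (\<Sum>k<n. - ell (v (Suc (m + k)) t) *\<^sub>R PL k)) \<le> B t (m + n) * bk n"
        by (rule chain_expansion_norm[where v = "\<lambda>n. v n t" and B = "B t", OF v2[OF t] bd[OF t] B0])
      then have 1: "norm (?S n - v m t) \<le> B t (m + n) * bk n" by (simp add: y_def norm_minus_commute)
      have "norm (v (n + ?q) t) \<le> fact (n + ?q) / t ^ (n + ?q) * norm u" by (rule v3[OF t])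
      also have "\<dots> \<le> (2 ^ (n + ?q) * fact n * fact ?q) / t ^ (n + ?q) * norm u"
        using t by (intro mult_right_mono divide_right_mono fact_add_le) auto
      finally have "B t (m + n) \<le> K * ((2 ^ (n + ?q) * fact n * fact ?q) / t ^ (n + ?q) * norm u)"
        unfolding B_def using K by (intro mult_left_mono) (auto simp: add_ac)
      also have "\<dots> = C * (fact n * (2 / t) ^ n)" using t by (simp add: C_def power_add power_divide mult_ac)
      finally have "B t (m + n) * bk n \<le> (C * (fact n * (2 / t) ^ n)) * (1 / ((2 - a) ^ (2 * n) * (fact n * fact n)))"
        using bk_bounds[of n] K t by (intro mult_mono) (auto simp: C_def)
      also have "\<dots> = C * (inverse (fact n) * (2 / (t * (2 - a)\<^sup>2)) ^ n)"
        unfolding power_mult[of "2 - a"] by (simp add: power_divide power_mult_distrib field_simps)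
      finally show ?thesis using 1 by linarith
    qed
    have "summable (\<lambda>n. inverse (fact n) * (2 / (t * (2 - a)\<^sup>2)) ^ n)" by (rule summable_exp)
    from tendsto_mult_right_zero[OF summable_LIMSEQ_zero[OF this], of C]
    have "(\<lambda>n. C * (inverse (fact n) * (2 / (t * (2 - a)\<^sup>2)) ^ n)) \<longlonglongrightarrow> 0" .
    then have "(\<lambda>n. ?S n - v m t) \<longlonglongrightarrow> 0"
      by (rule Lim_null_comparison[rotated]) (use le in auto)
    then show "(\<lambda>k. y (m + k) t *\<^sub>R PL k) sums v m t" unfolding sums_def by (rule LIM_zero_cancel)
  next
    fix r :: real assume r: "0 < r"
    \<comment> \<open>\<open>y n\<close> is computed from \<open>v (Suc n)\<close>, hence one index
      beyond N.\<close>
    let ?q = "Suc N"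
    define C where "C = K / (2 - a) * norm u * (2 ^ ?q * fact ?q / r ^ ?q)"
    have C0: "0 \<le> C" using K r a2 by (simp add: C_def)
    have "\<bar>y n t\<bar> \<le> (C + 1) * fact n / (r / 2) ^ n" if t: "r \<le> t" for n t
    proof -
      have t0: "0 < t" using t r by simp
      have "\<bar>y n t\<bar> \<le> K / (2 - a) * norm (v (n + ?q) t)"
        using bounded_dens(2)[OF bd[OF t0, of "Suc n"]] by (simp add: y_def B_def)
      also have "\<dots> \<le> K / (2 - a) * (fact (n + ?q) / t ^ (n + ?q) * norm u)"
        by (intro mult_left_mono v3 t0) (use K a2 in auto)
      also have "\<dots> \<le> K / (2 - a) * ((2 ^ (n + ?q) * fact n * fact ?q) / r ^ (n + ?q) * norm u)"
        using K a2 t r by (intro mult_left_mono mult_right_mono frac_le fact_add_le power_mono) auto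
      also have "\<dots> = C * fact n / (r / 2) ^ n" using r by (simp add: C_def power_add power_divide mult_ac)
      \<comment> \<open>A positive constant is required, while C is 0 when u is 0.\<close>
      also have "\<dots> \<le> (C + 1) * fact n / (r / 2) ^ n"
        using r by (intro divide_right_mono mult_right_mono) auto
      finally show ?thesis .
    qed
    moreover have "0 < C + 1" "0 < r / 2" using C0 r by auto
    ultimately show "\<exists>M>0. \<exists>R>0. \<forall>n. \<forall>t\<ge>r. \<bar>y n t\<bar> \<le> M * fact n / R ^ n"
      by blast
  qed (rule v1 v2 v4; assumption)+
qed

end

section \<open>Gevrey families of derivatives\<close>

text \<open>Derivatives are carried as an explicit sequence, so that the Leibniz and chain rules
  become formulas on sequences; \<open>gevreyI\<close> translates the result back to
  \<open>nth_deriv\<close>.\<close>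

definition deriv_family :: "real set \<Rightarrow> (nat \<Rightarrow> real \<Rightarrow> real) \<Rightarrow> bool" where
  "deriv_family S D \<longleftrightarrow> (\<forall>n. \<forall>t\<in>S. (D n has_vector_derivative D (Suc n) t) (at t within S))"

definition gevrey_bound :: "real \<Rightarrow> real set \<Rightarrow> (nat \<Rightarrow> real \<Rightarrow> real) \<Rightarrow> bool" where
  "gevrey_bound s S D \<longleftrightarrow> (\<exists>M>0. \<exists>R>0. \<forall>n. \<forall>t\<in>S. \<bar>D n t\<bar> \<le> M * fact n powr s / R ^ n)"

lemma deriv_family_subset: "deriv_family S D \<Longrightarrow> T \<subseteq> S \<Longrightarrow> deriv_family T D"
  unfolding deriv_family_def by (meson has_vector_derivative_within_subset subsetD)

lemma gevrey_bound_subset: "gevrey_bound s S D \<Longrightarrow> T \<subseteq> S \<Longrightarrow> gevrey_bound s T D"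
  unfolding gevrey_bound_def by (meson subsetD)

lemma nth_deriv_deriv_family:
  assumes D: "deriv_family S D" and nb: "\<And>t. t \<in> S \<Longrightarrow> at t within S \<noteq> bot" and h: "\<And>t. t \<in> S \<Longrightarrow> h t = D 0 t"
  shows "t \<in> S \<Longrightarrow> nth_deriv S n h t = D n t"
    and "t \<in> S \<Longrightarrow> (nth_deriv S n h has_vector_derivative D (Suc n) t) (at t within S)"
proof -
  have step: "(nth_deriv S n h has_vector_derivative D (Suc n) t) (at t within S)"
    if "\<And>t. t \<in> S \<Longrightarrow> nth_deriv S n h t = D n t" "t \<in> S" for n t
    using D that unfolding deriv_family_def
    by (intro has_vector_derivative_transform[OF that(2) that(1)]) auto
  have eq: "nth_deriv S n h t = D n t" if "t \<in> S" for t n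
    using that
  proof (induction n arbitrary: t)
    case 0 then show ?case by (simp add: nth_deriv_def h)
  next
    case (Suc n)
    have "nth_deriv S (Suc n) h t = vector_derivative (nth_deriv S n h) (at t within S)"
      by (simp add: nth_deriv_def)
    also have "\<dots> = D (Suc n) t"
      by (rule vector_derivative_within[OF nb[OF Suc.prems] step]) (use Suc in auto)
    finally show ?case .
  qed
  show "t \<in> S \<Longrightarrow> nth_deriv S n h t = D n t" by (rule eq)
  show "t \<in> S \<Longrightarrow> (nth_deriv S n h has_vector_derivative D (Suc n) t) (at t within S)"
    by (rule step) (use eq in auto)
qed

lemma C_inftyI:
  assumes "deriv_family S D" "\<And>t. t \<in> S \<Longrightarrow> at t within S \<noteq> bot" "\<And>t. t \<in> S \<Longrightarrow> h t = D 0 t"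
  shows "h \<in> C_infty S"
  using nth_deriv_deriv_family(2)[OF assms] unfolding C_infty_def by (auto intro: differentiableI_vector)

lemma Icc_within_ne_bot: "t1 < t2 \<Longrightarrow> t \<in> {t1..t2::real} \<Longrightarrow> at t within {t1..t2} \<noteq> bot"
  using trivial_limit_within[of t "{t1..t2}"] islimpt_Icc by (auto simp: trivial_limit_def)

lemma gevreyI:
  assumes "t1 < t2" "deriv_family {t1..t2} D" "gevrey_bound s {t1..t2} D" "\<And>t. t \<in> {t1..t2} \<Longrightarrow> h t = D 0 t"
  shows "h \<in> gevrey s t1 t2" and "t \<in> {t1..t2} \<Longrightarrow> nth_deriv {t1..t2} n h t = D n t"
proof -
  note nb = Icc_within_ne_bot[OF assms(1)]
  show eq: "t \<in> {t1..t2} \<Longrightarrow> nth_deriv {t1..t2} n h t = D n t" for t n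
    by (rule nth_deriv_deriv_family(1)[OF assms(2) nb assms(4)])
  have "h \<in> C_infty {t1..t2}" by (rule C_inftyI[OF assms(2) nb assms(4)])
  then show "h \<in> gevrey s t1 t2"
    using assms(3) eq unfolding gevrey_def gevrey_bound_def by simp
qed

definition leibniz :: "(nat \<Rightarrow> real \<Rightarrow> real) \<Rightarrow> (nat \<Rightarrow> real \<Rightarrow> real) \<Rightarrow> nat \<Rightarrow> real \<Rightarrow> real" where
  "leibniz D E n t = (\<Sum>k\<le>n. real (n choose k) * (D k t * E (n - k) t))"

lemma leibniz_0: "leibniz D E 0 t = D 0 t * E 0 t"
  by (simp add: leibniz_def)

lemma leibniz_sum_Suc:
  fixes x y :: "nat \<Rightarrow> real"
  shows "(\<Sum>k\<le>n. real (n choose k) * (x k * y (Suc (n - k)) + x (Suc k) * y (n - k)))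
    = (\<Sum>k\<le>Suc n. real (Suc n choose k) * (x k * y (Suc n - k)))"
proof -
  have "(\<Sum>k\<le>Suc n. real (Suc n choose k) * (x k * y (Suc n - k)))
    = x 0 * y (Suc n) + (\<Sum>k\<le>n. real (n choose Suc k) * (x (Suc k) * y (n - k)))
       + (\<Sum>k\<le>n. real (n choose k) * (x (Suc k) * y (n - k)))"
    by (subst sum.atMost_Suc_shift) (simp add: sum.distrib[symmetric] algebra_simps)
  also have "x 0 * y (Suc n) + (\<Sum>k\<le>n. real (n choose Suc k) * (x (Suc k) * y (n - k)))
    = (\<Sum>k\<le>Suc n. real (n choose k) * (x k * y (Suc n - k)))"
    by (subst sum.atMost_Suc_shift) simp
  also have "\<dots> = (\<Sum>k\<le>n. real (n choose k) * (x k * y (Suc (n - k))))"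
    by (simp add: Suc_diff_le)
  finally show ?thesis by (simp add: sum.distrib[symmetric] algebra_simps)
qed

lemma deriv_family_leibniz:
  assumes "deriv_family S D" "deriv_family S E"
  shows "deriv_family S (leibniz D E)"
  unfolding deriv_family_def
proof (intro allI ballI)
  fix n t assume t: "t \<in> S"
  have D: "(D k has_real_derivative D (Suc k) t) (at t within S)" and E: "(E k has_real_derivative E (Suc k) t) (at t within S)" for k
    using assms t by (auto simp: deriv_family_def has_real_derivative_iff_has_vector_derivative)
  have "(leibniz D E n has_real_derivative
     (\<Sum>k\<le>n. real (n choose k) * (D k t * E (Suc (n - k)) t + D (Suc k) t * E (n - k) t))) (at t within S)"
    unfolding leibniz_def by (intro DERIV_sum DERIV_cmult DERIV_mult' D E)
  then show "(leibniz D E n has_vector_derivative leibniz D E (Suc n) t) (at t within S)"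
    unfolding leibniz_sum_Suc[of n "\<lambda>k. D k t" "\<lambda>k. E k t"]
    by (simp only: leibniz_def has_real_derivative_iff_has_vector_derivative)
qed

text \<open>Each term satisfies k! (n - k)! \<le> n!, and the binomial coefficients sum to 2^n,
  which halves the radius.\<close>

lemma gevrey_bound_leibniz:
  assumes s: "0 \<le> s" and D: "gevrey_bound s S D" and E: "gevrey_bound s S E"
  shows "gevrey_bound s S (leibniz D E)"
proof -
  obtain M1 R1 where 1: "0 < M1" "0 < R1" "\<And>n t. t \<in> S \<Longrightarrow> \<bar>D n t\<bar> \<le> M1 * fact n powr s / R1 ^ n"
    using D unfolding gevrey_bound_def by blast
  obtain M2 R2 where 2: "0 < M2" "0 < R2" "\<And>n t. t \<in> S \<Longrightarrow> \<bar>E n t\<bar> \<le> M2 * fact n powr s / R2 ^ n"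
    using E unfolding gevrey_bound_def by blast
  define R where "R = min R1 R2"
  have R: "0 < R" "R \<le> R1" "R \<le> R2" using 1 2 by (auto simp: R_def)
  have "\<bar>leibniz D E n t\<bar> \<le> M1 * M2 * fact n powr s / (R / 2) ^ n" if t: "t \<in> S" for n t
  proof -
    have "\<bar>leibniz D E n t\<bar> \<le> (\<Sum>k\<le>n. \<bar>real (n choose k) * (D k t * E (n - k) t)\<bar>)"
      unfolding leibniz_def by (rule sum_abs)
    also have "\<dots> \<le> (\<Sum>k\<le>n. real (n choose k) * (M1 * M2 * fact n powr s / R ^ n))"
    proof (rule sum_mono)
      fix k assume "k \<in> {..n}"
      then have k: "k \<le> n" by simp
      have "\<bar>D k t * E (n - k) t\<bar> \<le> (M1 * fact k powr s / R1 ^ k) * (M2 * fact (n - k) powr s / R2 ^ (n - k))"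
        unfolding abs_mult using 1 2 t by (intro mult_mono) auto
      also have "\<dots> \<le> (M1 * fact k powr s / R ^ k) * (M2 * fact (n - k) powr s / R ^ (n - k))"
        using 1 2 R by (intro mult_mono divide_left_mono power_mono mult_pos_pos zero_less_power) auto
      also have "\<dots> = M1 * M2 * (fact k * fact (n - k)) powr s / R ^ n"
        using k by (simp add: powr_mult power_add[symmetric])
      also have "\<dots> \<le> M1 * M2 * fact n powr s / R ^ n"
      proof -
        have "(fact k * fact (n - k) :: nat) \<le> fact n"
          using dvd_imp_le[OF fact_fact_dvd_fact[of k "n - k"]] k by simp
        then have "(fact k * fact (n - k) :: real) \<le> fact n"
          by (metis of_nat_fact of_nat_le_iff of_nat_mult)
        then show ?thesis using 1 2 R s by (intro divide_right_mono mult_left_mono powr_mono2) auto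
      qed
      finally have z: "\<bar>D k t * E (n - k) t\<bar> \<le> M1 * M2 * fact n powr s / R ^ n" .
      show "\<bar>real (n choose k) * (D k t * E (n - k) t)\<bar> \<le> real (n choose k) * (M1 * M2 * fact n powr s / R ^ n)"
        unfolding abs_mult[of "real (n choose k)"] abs_of_nat by (rule mult_left_mono[OF z]) simp
    qed
    also have "\<dots> = (\<Sum>k\<le>n. real (n choose k)) * (M1 * M2 * fact n powr s / R ^ n)"
      by (simp only: sum_distrib_right)
    also have "(\<Sum>k\<le>n. real (n choose k)) = 2 ^ n"
      using choose_row_sum[of n] by (metis of_nat_numeral of_nat_power of_nat_sum)
    finally show ?thesis by (simp add: power_divide mult_ac)
  qed
  then show ?thesis unfolding gevrey_bound_def using 1 2 R
    by (intro exI[of _ "M1 * M2"] conjI exI[of _ "R / 2"]) auto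
qed

definition affine_family :: "real \<Rightarrow> real \<Rightarrow> (nat \<Rightarrow> real \<Rightarrow> real) \<Rightarrow> nat \<Rightarrow> real \<Rightarrow> real" where
  "affine_family c p D n x = c ^ n * D n (c * (x - p))"

lemma affine_family_0: "affine_family c p D 0 x = D 0 (c * (x - p))"
  by (simp add: affine_family_def)

lemma deriv_family_affine:
  assumes "deriv_family UNIV D"
  shows "deriv_family UNIV (affine_family c p D)"
  unfolding deriv_family_def
proof (intro allI ballI)
  fix n x
  have "(D n has_real_derivative D (Suc n) (c * (x - p))) (at (c * (x - p)))"
    using assms by (simp add: deriv_family_def has_real_derivative_iff_has_vector_derivative)
  moreover have "((\<lambda>x. c * (x - p)) has_real_derivative c) (at x)"
    by (auto intro!: derivative_eq_intros)
  ultimately have "((\<lambda>x. D n (c * (x - p))) has_real_derivative D (Suc n) (c * (x - p)) * c) (at x)"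
    by (rule DERIV_chain2)
  from DERIV_cmult[OF this, of "c ^ n"]
  show "(affine_family c p D n has_vector_derivative affine_family c p D (Suc n) x) (at x within UNIV)"
    by (simp add: affine_family_def[abs_def] has_real_derivative_iff_has_vector_derivative[symmetric] mult_ac)
qed

lemma gevrey_bound_affine:
  assumes D: "gevrey_bound s UNIV D" and c: "c \<noteq> 0"
  shows "gevrey_bound s UNIV (affine_family c p D)"
proof -
  obtain M R where 1: "0 < M" "0 < R" "\<And>n t. \<bar>D n t\<bar> \<le> M * fact n powr s / R ^ n"
    using D unfolding gevrey_bound_def by blast
  have "\<bar>affine_family c p D n t\<bar> \<le> M * fact n powr s / (R / \<bar>c\<bar>) ^ n" for n t
  proof -
    have "\<bar>affine_family c p D n t\<bar> = \<bar>c\<bar> ^ n * \<bar>D n (c * (t - p))\<bar>"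
      by (simp add: affine_family_def abs_mult power_abs)
    also have "\<dots> \<le> \<bar>c\<bar> ^ n * (M * fact n powr s / R ^ n)" by (intro mult_left_mono 1) auto
    finally show ?thesis by (simp add: power_divide mult_ac)
  qed
  then show ?thesis unfolding gevrey_bound_def using 1 c
    by (intro exI[of _ M] conjI exI[of _ "R / \<bar>c\<bar>"]) auto
qed

section \<open>A Gevrey step function\<close>

text \<open>The complex extension of exp (- 1 / x^m) makes Cauchy's estimates available; the
  exponent m sets the Gevrey order 1 + 1 / m.\<close>

definition cflat :: "nat \<Rightarrow> complex \<Rightarrow> complex" where "cflat m z = exp (- (1 / z ^ m))"

definition flat :: "nat \<Rightarrow> nat \<Rightarrow> real \<Rightarrow> real" where
  "flat m n x = (if x \<le> 0 then 0 else Re ((deriv ^^ n) (cflat m) (of_real x)))"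

lemma cflat_holomorphic: "cflat m holomorphic_on (- {0})"
  unfolding cflat_def by (intro holomorphic_intros) auto

text \<open>With q = 1 / x^m the m-th power of the left side is exp (- m q / 2) q^n, which the
  exponential series bounds by n! 2^n. Taking the m-th root leaves the power 1 / m of n!, the excess
  of the Gevrey order over 1.\<close>

lemma powr_exp_bound:
  assumes m: "0 < m" and x: "0 < (x::real)"
  shows "exp (- (1 / (2 * x ^ m))) / x ^ n \<le> fact n powr (1 / real m) * 2 ^ n"
proof -
  define q where "q = 1 / x ^ m"
  have q: "0 < q" using x by (simp add: q_def)
  let ?e = "exp (- (1 / (2 * x ^ m))) / x ^ n"
  have e0: "0 < ?e" using x by simp
  have e1: "exp (- (1 / (2 * x ^ m))) ^ m = exp (real m * (- (1 / (2 * x ^ m))))"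
    by (rule exp_of_nat_mult[symmetric])
  have e2: "(x ^ n) ^ m = (x ^ m) ^ n" by (metis mult.commute power_mult)
  have "?e ^ m = exp (real m * (- (1 / (2 * x ^ m)))) / (x ^ m) ^ n" unfolding power_divide e1 e2 ..
  also have "\<dots> = exp (- (real m * q / 2)) * q ^ n" unfolding q_def power_one_over by simp
  also have "\<dots> \<le> fact n * 2 ^ n"
  proof -
    have "(q / 2) ^ n / fact n \<le> exp (q / 2)" using q by (intro power_fact_le_exp) simp
    also have "exp (q / 2) \<le> exp (real m * q / 2)" using m q by simp
    finally have "q ^ n \<le> exp (real m * q / 2) * (fact n * 2 ^ n)" by (simp add: field_simps power_divide)
    then show ?thesis by (simp add: exp_minus field_simps)
  qed
  finally have "?e ^ m \<le> fact n * 2 ^ n" .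
  then have "(?e ^ m) powr (1 / real m) \<le> (fact n * 2 ^ n) powr (1 / real m)"
    using e0 by (intro powr_mono2) auto
  moreover have "(?e ^ m) powr (1 / real m) = ?e"
  proof -
    have "(z ^ m) powr (1 / real m) = z" if "0 < z" for z :: real
      using that m by (simp add: powr_realpow[symmetric] powr_powr)
    then show ?thesis using e0 by blast
  qed
  moreover have "(fact n * 2 ^ n :: real) powr (1 / real m) \<le> fact n powr (1 / real m) * 2 ^ n"
  proof -
    have "((2::real) ^ n) powr (1 / real m) \<le> (2 ^ n) powr 1" using m by (intro powr_mono) auto
    then show ?thesis by (simp add: powr_mult mult_left_mono)
  qed
  ultimately show ?thesis by linarith
qed

text \<open>Cauchy's estimate on the disc of radius \<open>e * x\<close> around \<open>x\<close>, where the real part of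
  \<open>1 / z\<^sup>m\<close> is still comparable to \<open>1 / x\<^sup>m\<close>.\<close>

lemma cflat_deriv_bound:
  obtains e :: real where "0 < e" "\<And>n x. 0 < x \<Longrightarrow> norm ((deriv ^^ n) (cflat m) (of_real x))
    \<le> fact n / e ^ n * (exp (- (1 / (2 * x ^ m))) / x ^ n)"
proof -
  have "continuous (at 1) (\<lambda>w::complex. Re (1 / w ^ m))" unfolding isCont_def
    by (intro tendsto_Re tendsto_divide tendsto_const tendsto_power tendsto_ident_at) simp
  then obtain d where d: "0 < d" "\<And>w::complex. dist w 1 < d \<Longrightarrow> dist (Re (1 / w ^ m)) (Re (1 / 1 ^ m)) < 1/2"
    unfolding continuous_at_eps_delta by (metis half_gt_zero zero_less_one)
  \<comment> \<open>After the scaling w = z / x only the point 1 matters: e < d controls Re (1 /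
    w^m) near it, and e < 1 keeps the disc away from 0.\<close>
  define e where "e = min (d / 2) (1/2)"
  have e: "0 < e" "e < 1" "e < d" using d by (auto simp: e_def)
  have re: "1/2 \<le> Re (1 / w ^ m)" if "norm (w - 1) \<le> e" for w :: complex
  proof -
    have "dist (Re (1 / w ^ m)) 1 < 1/2" using d(2)[of w] that e by (simp add: dist_norm)
    then show ?thesis unfolding dist_real_def by linarith
  qed
  show thesis
  proof (rule that[OF e(1)])
    fix n and x :: real assume x: "0 < x"
    have nz: "z \<noteq> 0" if "z \<in> cball (complex_of_real x) (e * x)" for z
    proof
      assume "z = 0"
      then have "x \<le> e * x" using that x by (simp add: dist_norm)
      then show False using e x by simp
    qed
    have "norm ((deriv ^^ n) (cflat m) (of_real x)) \<le> fact n * exp (- (1 / (2 * x ^ m))) / (e * x) ^ n"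
    proof (rule Cauchy_inequality)
      show "cflat m holomorphic_on ball (complex_of_real x) (e * x)"
        by (rule holomorphic_on_subset[OF cflat_holomorphic]) (use nz in force)
      show "continuous_on (cball (complex_of_real x) (e * x)) (cflat m)"
        by (rule continuous_on_subset[OF holomorphic_on_imp_continuous_on[OF cflat_holomorphic]]) (use nz in force)
      show "0 < e * x" using e x by simp
      fix z assume z: "norm (complex_of_real x - z) = e * x"
      define w where "w = z / of_real x"
      have zw: "z = of_real x * w" using x by (simp add: w_def)
      have "norm (w - 1) * x = norm ((w - 1) * of_real x)" using x by (simp add: norm_mult)
      also have "(w - 1) * of_real x = z - of_real x" by (simp add: zw algebra_simps)
      also have "norm (z - of_real x) = e * x" using z by (simp add: norm_minus_commute)
      finally have "norm (w - 1) \<le> e" using x by simp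
      then have "1/2 \<le> Re (1 / w ^ m)" by (rule re)
      then have "1 / (2 * x ^ m) \<le> Re (1 / w ^ m) / x ^ m" using x by (simp add: divide_simps)
      also have "\<dots> = Re (1 / z ^ m)"
      proof -
        have "1 / z ^ m = (1 / w ^ m) / of_real (x ^ m)" by (simp add: zw power_mult_distrib)
        then show ?thesis by (simp only: Re_divide_of_real)
      qed
      finally show "norm (cflat m z) \<le> exp (- (1 / (2 * x ^ m)))"
        by (simp add: cflat_def)
    qed
    then show "norm ((deriv ^^ n) (cflat m) (of_real x)) \<le> fact n / e ^ n * (exp (- (1 / (2 * x ^ m))) / x ^ n)"
      by (simp add: power_mult_distrib)
  qed
qed

lemma deriv_family_flat:
  assumes m: "0 < m"
  shows "deriv_family UNIV (flat m)"
  unfolding deriv_family_def has_real_derivative_iff_has_vector_derivative[symmetric]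
proof (intro allI ballI)
  fix n and x :: real
  obtain e where e: "0 < e" "\<And>n x. 0 < x \<Longrightarrow> norm ((deriv ^^ n) (cflat m) (of_real x))
    \<le> fact n / e ^ n * (exp (- (1 / (2 * x ^ m))) / x ^ n)" using cflat_deriv_bound[of m] by metis
  consider "x < 0" | "x = 0" | "0 < x" by linarith
  then show "(flat m n has_real_derivative flat m (Suc n) x) (at x within UNIV)"
  proof cases
    case 1
    have "((\<lambda>_. 0) has_real_derivative 0) (at x)" by simp
    then have "(flat m n has_real_derivative 0) (at x)"
      by (rule has_field_derivative_transform_within_open[of _ _ _ "{..<0}"]) (use 1 in \<open>auto simp: flat_def\<close>)
    then show ?thesis using 1 by (simp add: flat_def)
  next
    case 2
    have "(flat m n has_real_derivative 0) (at 0)"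
    proof (rule DERIV_zero_of_quadratic_bound)
      \<comment> \<open>Taking n + 2 in \<open>powr_exp_bound\<close> leaves two powers of x for the
        quadratic bound at 0.\<close>
      let ?K = "fact n / e ^ n * (fact (n + 2) powr (1 / real m) * 2 ^ (n + 2))"
      fix x :: real
      show "\<bar>flat m n x\<bar> \<le> ?K * x\<^sup>2"
      proof (cases "x \<le> 0")
        case True then show ?thesis using e by (simp add: flat_def)
      next
        case False
        then have x: "0 < x" by simp
        have "\<bar>flat m n x\<bar> \<le> norm ((deriv ^^ n) (cflat m) (of_real x))"
          using x abs_Re_le_cmod by (simp add: flat_def)
        also have "\<dots> \<le> fact n / e ^ n * (exp (- (1 / (2 * x ^ m))) / x ^ n)" by (rule e(2)[OF x])
        also have "exp (- (1 / (2 * x ^ m))) / x ^ n = exp (- (1 / (2 * x ^ m))) / x ^ (n + 2) * x\<^sup>2"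
          using x by (simp add: power_add power2_eq_square)
        also have "fact n / e ^ n * (exp (- (1 / (2 * x ^ m))) / x ^ (n + 2) * x\<^sup>2) \<le> ?K * x\<^sup>2"
        proof -
          have "fact n / e ^ n * (exp (- (1 / (2 * x ^ m))) / x ^ (n + 2)) \<le> ?K"
            by (rule mult_left_mono[OF powr_exp_bound[OF m x]]) (use e in simp)
          then have "fact n / e ^ n * (exp (- (1 / (2 * x ^ m))) / x ^ (n + 2)) * x\<^sup>2 \<le> ?K * x\<^sup>2"
            by (rule mult_right_mono) simp
          then show ?thesis by (simp only: mult.assoc)
        qed
        finally show ?thesis .
      qed
    qed (simp add: flat_def)
    then show ?thesis using 2 by (simp add: flat_def)
  next
    case 3
    have "(deriv ^^ n) (cflat m) holomorphic_on (- {0})"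
      by (rule holomorphic_higher_deriv[OF cflat_holomorphic]) auto
    then have "((deriv ^^ n) (cflat m) has_field_derivative (deriv ^^ Suc n) (cflat m) (of_real x)) (at (of_real x))"
      using 3 holomorphic_derivI[of "(deriv ^^ n) (cflat m)" "- {0}" "of_real x"] by (auto simp: open_Compl)
    from has_field_derivative_Re[OF has_vector_derivative_real_field[OF this, of UNIV]]
    have "((\<lambda>x. Re ((deriv ^^ n) (cflat m) (of_real x))) has_real_derivative Re ((deriv ^^ Suc n) (cflat m) (of_real x))) (at x)"
      by simp
    then have "(flat m n has_real_derivative Re ((deriv ^^ Suc n) (cflat m) (of_real x))) (at x)"
      by (rule has_field_derivative_transform_within_open[of _ _ _ "{0<..}"]) (use 3 in \<open>auto simp: flat_def\<close>)
    then show ?thesis using 3 by (simp add: flat_def)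
  qed
qed

lemma gevrey_bound_flat:
  assumes m: "0 < m" and s: "1 + 1 / real m \<le> s"
  shows "gevrey_bound s UNIV (flat m)"
proof -
  obtain e where e: "0 < e" "\<And>n x. 0 < x \<Longrightarrow> norm ((deriv ^^ n) (cflat m) (of_real x))
    \<le> fact n / e ^ n * (exp (- (1 / (2 * x ^ m))) / x ^ n)" using cflat_deriv_bound[of m] by metis
  have "\<bar>flat m n x\<bar> \<le> 1 * fact n powr s / (e / 2) ^ n" for n x
  proof (cases "x \<le> 0")
    case True then show ?thesis using e by (simp add: flat_def)
  next
    case False
    then have x: "0 < x" by simp
    have "\<bar>flat m n x\<bar> \<le> norm ((deriv ^^ n) (cflat m) (of_real x))"
      using x abs_Re_le_cmod by (simp add: flat_def)
    also have "\<dots> \<le> fact n / e ^ n * (exp (- (1 / (2 * x ^ m))) / x ^ n)" by (rule e(2)[OF x])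
    also have "\<dots> \<le> fact n / e ^ n * (fact n powr (1 / real m) * 2 ^ n)"
      using e by (intro mult_left_mono powr_exp_bound m x) auto
    also have "\<dots> = fact n powr (1 + 1 / real m) / (e / 2) ^ n"
      by (simp add: powr_add power_divide)
    also have "\<dots> \<le> 1 * fact n powr s / (e / 2) ^ n"
    proof -
      have "(fact n :: real) powr (1 + 1 / real m) \<le> fact n powr s"
        using s by (intro powr_mono) (auto simp: fact_ge_1)
      then show ?thesis using e by (intro divide_right_mono) auto
    qed
    finally show ?thesis .
  qed
  then show ?thesis unfolding gevrey_bound_def using e by (intro exI[of _ 1] conjI exI[of _ "e / 2"]) auto
qed

lemma flat_0: "flat m 0 x = (if x \<le> 0 then 0 else exp (- (1 / x ^ m)))"
proof -
  have "- (1 / complex_of_real x ^ m) = complex_of_real (- (1 / x ^ m))" by simp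
  then show ?thesis by (simp only: flat_def cflat_def funpow_0 exp_of_real Re_complex_of_real)
qed

text \<open>The bump \<open>flat m 0 x * flat m 0 (1 - x)\<close> is integrated and divided by its
  mass; m is taken so large that 1 + 1 / m \<le> s.\<close>

lemma gevrey_step_exists:
  assumes s: "1 < s"
  obtains \<theta> where "deriv_family UNIV \<theta>" "gevrey_bound s UNIV \<theta>" "\<And>x. x \<le> 0 \<Longrightarrow> \<theta> 0 x = 0"
    "\<And>x. 1 \<le> x \<Longrightarrow> \<theta> 0 x = 1" "\<And>x. \<bar>\<theta> 0 x\<bar> \<le> 1"
proof -
  obtain m :: nat where m: "1 / (s - 1) < real m" using reals_Archimedean2 by blast
  have m0: "0 < m"
  proof (rule ccontr)
    assume "\<not> 0 < m" then show False using m s by simp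
  qed
  have "1 < real m * (s - 1)" using m s by (simp add: field_simps)
  then have ms: "1 + 1 / real m \<le> s" using m0 by (simp add: field_simps)
  define \<rho> where "\<rho> = leibniz (flat m) (affine_family (-1) 1 (flat m))"
  have df: "deriv_family UNIV \<rho>" unfolding \<rho>_def
    by (intro deriv_family_leibniz deriv_family_affine deriv_family_flat m0)
  have gb: "gevrey_bound s UNIV \<rho>" unfolding \<rho>_def
    using s by (intro gevrey_bound_leibniz gevrey_bound_affine gevrey_bound_flat m0 ms) auto
  have \<rho>0: "\<rho> 0 x = flat m 0 x * flat m 0 (1 - x)" for x
    by (simp add: \<rho>_def leibniz_0 affine_family_0)
  have \<rho>nn: "0 \<le> \<rho> 0 x" for x by (simp add: \<rho>0 flat_0)
  have \<rho>pos: "0 < \<rho> 0 x" if "0 < x" "x < 1" for x using that by (simp add: \<rho>0 flat_0)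
  have \<rho>z: "\<rho> 0 x = 0" if "x \<le> 0 \<or> 1 \<le> x" for x using that by (auto simp: \<rho>0 flat_0)
  have \<rho>d: "(\<rho> n has_real_derivative \<rho> (Suc n) x) (at x)" for n x
    using df by (simp add: deriv_family_def has_real_derivative_iff_has_vector_derivative)
  have cont: "continuous_on S (\<rho> 0)" for S
    using \<rho>d[of 0] by (meson DERIV_isCont continuous_at_imp_continuous_on)
  \<comment> \<open>The lower limit - 1 makes every x \<ge> 0 an interior point of the interval of
    integration, so the derivative there is two-sided.\<close>
  define H where "H x = integral {-1..x} (\<rho> 0)" for x
  have Hz: "H x = 0" if "x \<le> 0" for x
  proof -
    have "H x = integral {-1..x} (\<lambda>_. 0)" unfolding H_def by (rule integral_cong) (use \<rho>z that in auto)
    then show ?thesis by simp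
  qed
  have Hd: "(H has_real_derivative \<rho> 0 x) (at x)" for x
  proof (cases "x < 0")
    case True
    have "((\<lambda>_. 0) has_real_derivative 0) (at x)" by simp
    then have "(H has_real_derivative 0) (at x)"
      by (rule has_field_derivative_transform_within_open[of _ _ _ "{..<0}"]) (use True Hz in auto)
    then show ?thesis using True \<rho>z by simp
  next
    case False
    have "(H has_real_derivative \<rho> 0 x) (at x within {-1..x + 1})"
      unfolding H_def by (rule integral_has_real_derivative[OF cont]) (use False in auto)
    then show ?thesis using False by (simp add: at_within_Icc_at)
  qed
  have H1: "H x = H 1" if "1 \<le> x" for x
  proof -
    have "(H has_real_derivative 0) (at z within {1..})" if "z \<in> {1..}" for z
      using has_field_derivative_at_within[OF Hd[of z]] \<rho>z[of z] that by simp
    then obtain c where "\<And>z. z \<in> {1..} \<Longrightarrow> H z = c"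
      using has_field_derivative_zero_constant[of "{1..}" H] by auto
    then show ?thesis using that by (metis atLeast_iff order_refl)
  qed
  have mono: "H x \<le> H z" if "x \<le> z" for x z
    by (rule DERIV_nonneg_imp_nondecreasing[OF that]) (use Hd \<rho>nn in blast)
  have c: "0 < H 1"
  proof -
    obtain z where "0 < z" "z < 1" "H 1 - H 0 = (1 - 0) * \<rho> 0 z"
      using MVT2[of 0 1 H "\<rho> 0"] Hd by auto
    then show ?thesis using \<rho>pos[of z] Hz[of 0] by simp
  qed
  define \<theta> where "\<theta> n x = (case n of 0 \<Rightarrow> H x / H 1 | Suc k \<Rightarrow> \<rho> k x / H 1)" for n x
  show thesis
  proof (rule that[of \<theta>])
    show "deriv_family UNIV \<theta>"
      unfolding deriv_family_def has_real_derivative_iff_has_vector_derivative[symmetric]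
    proof (intro allI ballI)
      fix n x
      show "(\<theta> n has_real_derivative \<theta> (Suc n) x) (at x within UNIV)"
      proof (cases n)
        case 0
        then show ?thesis using DERIV_cdivide[OF Hd[of x], of "H 1"] by (simp add: \<theta>_def[abs_def])
      next
        case (Suc k)
        then show ?thesis using DERIV_cdivide[OF \<rho>d[of k x], of "H 1"] by (simp add: \<theta>_def[abs_def])
      qed
    qed
    have b: "\<bar>\<theta> 0 x\<bar> \<le> 1" for x
    proof -
      have "0 \<le> H x" using mono[of "min x 0" x] Hz[of "min x 0"] by simp
      moreover have "H x \<le> H 1" using mono[of x 1] H1[of x] by (cases "x \<le> 1") auto
      ultimately show ?thesis using c by (simp add: \<theta>_def)
    qed
    show "\<bar>\<theta> 0 x\<bar> \<le> 1" for x by (rule b)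
    show "gevrey_bound s UNIV \<theta>"
    proof -
      obtain M R where 1: "0 < M" "0 < R" "\<And>n t. \<bar>\<rho> n t\<bar> \<le> M * fact n powr s / R ^ n"
        using gb unfolding gevrey_bound_def by blast
      \<comment> \<open>Derivatives of the step are those of the bump with the index shifted by one,
        which costs a factor R; the summand 1 covers the step itself.\<close>
      have "\<bar>\<theta> n t\<bar> \<le> (1 + M * R / H 1) * fact n powr s / R ^ n" for n t
      proof (cases n)
        case 0
        have "0 \<le> M * R / H 1" using 1 c by simp
        then show ?thesis using b[of t] 0 by simp
      next
        case (Suc k)
        have "\<bar>\<theta> n t\<bar> = \<bar>\<rho> k t\<bar> / H 1" using c by (simp add: \<theta>_def Suc)
        also have "\<dots> \<le> (M * fact k powr s / R ^ k) / H 1" using 1 c by (intro divide_right_mono) auto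
        also have "\<dots> = M * R / H 1 * fact k powr s / R ^ n" using 1 by (simp add: Suc)
        also have "\<dots> \<le> (1 + M * R / H 1) * fact n powr s / R ^ n"
        proof (intro divide_right_mono mult_mono powr_mono2)
          show "(fact k :: real) \<le> fact n" by (rule fact_mono) (simp add: Suc)
        qed (use 1 c s in auto)
        finally show ?thesis .
      qed
      then show ?thesis unfolding gevrey_bound_def using 1 c
        by (intro exI[of _ "1 + M * R / H 1"] conjI exI[of _ R]) (auto intro: add_pos_pos)
    qed
    show "x \<le> 0 \<Longrightarrow> \<theta> 0 x = 0" for x by (simp add: \<theta>_def Hz)
    show "1 \<le> x \<Longrightarrow> \<theta> 0 x = 1" for x using H1[of x] c by (simp add: \<theta>_def)
  qed
qed

section \<open>Test functions and weak derivatives\<close>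

lemma test_functionsI:
  assumes D: "deriv_family UNIV D" and cd: "a < c" "d < b" and z: "\<And>x. x \<notin> {c..d} \<Longrightarrow> D 0 x = 0"
  shows "D 0 \<in> test_functions a b" and "nth_deriv UNIV n (D 0) x = D n x"
proof -
  have "D 0 \<in> C_infty UNIV" by (rule C_inftyI[OF D]) auto
  then show "D 0 \<in> test_functions a b" using cd z unfolding test_functions_def by blast
  show "nth_deriv UNIV n (D 0) x = D n x" by (rule nth_deriv_deriv_family(1)[OF D]) auto
qed

lemma deriv_family_nth_deriv:
  assumes "h \<in> C_infty UNIV"
  shows "deriv_family UNIV (\<lambda>n. nth_deriv UNIV n h)"
  unfolding deriv_family_def
proof (intro allI ballI)
  fix n t
  have "nth_deriv UNIV n h differentiable (at t)" using assms by (simp add: C_infty_def)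
  then have "(nth_deriv UNIV n h has_vector_derivative vector_derivative (nth_deriv UNIV n h) (at t)) (at t)"
    by (simp add: vector_derivative_works)
  then show "(nth_deriv UNIV n h has_vector_derivative nth_deriv UNIV (Suc n) h t) (at t within UNIV)"
    by (simp add: nth_deriv_def)
qed

lemma test_functionsE:
  assumes "\<phi> \<in> test_functions a b"
  obtains D c d where "deriv_family UNIV D" "a < c" "d < b" "\<And>n x. x \<notin> {c..d} \<Longrightarrow> D n x = 0" "\<phi> = D 0"
    "\<And>n. nth_deriv UNIV n \<phi> = D n"
proof -
  obtain c d where cd: "a < c" "d < b" "\<And>x. x \<notin> {c..d} \<Longrightarrow> \<phi> x = 0" and C: "\<phi> \<in> C_infty UNIV"
    using assms unfolding test_functions_def by blast
  define D where "D n = nth_deriv UNIV n \<phi>" for n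
  have D: "deriv_family UNIV D" unfolding D_def by (rule deriv_family_nth_deriv[OF C])
  have z: "D n x = 0" if "x \<notin> {c..d}" for n x
    using that
  proof (induction n arbitrary: x)
    case 0 then show ?case using cd by (simp add: D_def nth_deriv_def)
  next
    case (Suc n)
    have "((\<lambda>_. 0::real) has_vector_derivative 0) (at x)" by simp
    then have "(D n has_vector_derivative 0) (at x)"
      by (rule has_vector_derivative_transform_within_open[of _ _ _ "- {c..d}"]) (use Suc in auto)
    moreover have "(D n has_vector_derivative D (Suc n) x) (at x)" using D by (simp add: deriv_family_def)
    ultimately show ?case by (metis vector_derivative_at)
  qed
  show thesis by (rule that[OF D cd(1,2) z]) (auto simp: D_def nth_deriv_def)
qed

lemma deriv_family_DERIV: "deriv_family UNIV D \<Longrightarrow> (D n has_real_derivative D (Suc n) x) (at x)"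
  by (simp add: deriv_family_def has_real_derivative_iff_has_vector_derivative)

lemma deriv_family_continuous: "deriv_family UNIV D \<Longrightarrow> continuous_on S (D n)"
  by (meson deriv_family_DERIV DERIV_isCont continuous_at_imp_continuous_on)

lemma test_functions_lincomb:
  assumes "\<phi> \<in> test_functions a b" "\<psi> \<in> test_functions a b"
  shows "(\<lambda>x. p * \<phi> x + q * \<psi> x) \<in> test_functions a b"
proof -
  obtain D c d where D: "deriv_family UNIV D" "a < c" "d < b" "\<And>n x. x \<notin> {c..d} \<Longrightarrow> D n x = 0" "\<phi> = D 0"
    using test_functionsE[OF assms(1)] by metis
  obtain E c' d' where E: "deriv_family UNIV E" "a < c'" "d' < b" "\<And>n x. x \<notin> {c'..d'} \<Longrightarrow> E n x = 0" "\<psi> = E 0"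
    using test_functionsE[OF assms(2)] by metis
  define F where "F n x = p * D n x + q * E n x" for n x
  have "deriv_family UNIV F"
    unfolding deriv_family_def has_real_derivative_iff_has_vector_derivative[symmetric] F_def[abs_def]
    using deriv_family_DERIV[OF D(1)] deriv_family_DERIV[OF E(1)] by (auto intro!: DERIV_add DERIV_cmult)
  then have "F 0 \<in> test_functions a b"
  proof (rule test_functionsI(1)[where c = "min c c'" and d = "max d d'"])
    fix x assume "x \<notin> {min c c'..max d d'}"
    then have "x \<notin> {c..d}" "x \<notin> {c'..d'}" by auto
    from D(4)[OF this(1)] E(4)[OF this(2)] show "F 0 x = 0" unfolding F_def by simp
  qed (use D E in auto)
  then show ?thesis by (simp add: F_def[abs_def] D E)
qed

lemma test_functions_deriv:
  assumes "\<phi> \<in> test_functions a b"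
  shows "nth_deriv UNIV 1 \<phi> \<in> test_functions a b" and "nth_deriv UNIV 1 (nth_deriv UNIV 1 \<phi>) = nth_deriv UNIV 2 \<phi>"
proof -
  obtain D c d where D: "deriv_family UNIV D" "a < c" "d < b" "\<And>n x. x \<notin> {c..d} \<Longrightarrow> D n x = 0" "\<And>n. nth_deriv UNIV n \<phi> = D n"
    using test_functionsE[OF assms] by metis
  have E: "deriv_family UNIV (\<lambda>n. D (Suc n))" using D(1) by (simp add: deriv_family_def)
  have "D (Suc 0) \<in> test_functions a b"
    using test_functionsI(1)[OF E D(2,3)] D(4) by auto
  then show "nth_deriv UNIV 1 \<phi> \<in> test_functions a b" by (simp add: D)
  show "nth_deriv UNIV 1 (nth_deriv UNIV 1 \<phi>) = nth_deriv UNIV 2 \<phi>"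
    by (simp add: nth_deriv_def numeral_2_eq_2)
qed

lemma test_function_bounded:
  assumes "\<phi> \<in> test_functions a b"
  obtains C where "\<And>x. \<bar>\<phi> x\<bar> \<le> C"
proof -
  obtain D c d where D: "deriv_family UNIV D" "a < c" "d < b" "\<And>n x. x \<notin> {c..d} \<Longrightarrow> D n x = 0" "\<phi> = D 0"
    using test_functionsE[OF assms] by metis
  have "bounded (\<phi> ` {c..d})" unfolding D(5)
    by (intro compact_imp_bounded compact_continuous_image deriv_family_continuous D) auto
  then obtain C where C: "\<And>x. x \<in> {c..d} \<Longrightarrow> \<bar>\<phi> x\<bar> \<le> C" unfolding bounded_real by blast
  have "\<bar>\<phi> x\<bar> \<le> max C 0" for x using C[of x] D(4)[of x 0] D(5) by (cases "x \<in> {c..d}") auto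
  then show thesis by (rule that)
qed

lemma test_function_continuous: "\<phi> \<in> test_functions a b \<Longrightarrow> continuous_on S \<phi>"
  by (elim test_functionsE) (simp add: deriv_family_continuous)

lemma continuous_measurable_interval: "continuous_on {a<..<b} f \<Longrightarrow> f \<in> borel_measurable (lebesgue_on {a<..<b::real})"
  by (rule continuous_imp_measurable_on_sets_lebesgue) auto

lemma test_function_measurable: "\<phi> \<in> test_functions a b \<Longrightarrow> \<phi> \<in> borel_measurable (lebesgue_on {c<..<d})"
  by (intro continuous_measurable_interval test_function_continuous)

lemma test_function_L2: "\<phi> \<in> test_functions a b \<Longrightarrow> \<phi> \<in> L2 c d"
  using test_function_bounded[of \<phi> a b] by (metis AE_I2 L2_bounded test_function_measurable)

lemma continuous_L2:
  assumes "continuous_on {a..b} f"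
  shows "f \<in> L2 a b"
proof -
  have "bounded (f ` {a..b})" by (intro compact_imp_bounded compact_continuous_image assms) auto
  then obtain C where C: "\<And>x. x \<in> {a..b} \<Longrightarrow> \<bar>f x\<bar> \<le> C" unfolding bounded_real by blast
  show ?thesis
    by (rule L2_bounded[where C = C])
      (auto intro!: continuous_measurable_interval continuous_on_subset[OF assms] AE_I2 C)
qed

lemma integral_interval_continuous:
  fixes f :: "real \<Rightarrow> real"
  assumes "continuous_on {a..b} f"
  shows "(LINT x|lebesgue_on {a<..<b}. f x) = integral {a..b} f"
proof -
  have "(LINT x|lebesgue_on {a<..<b}. f x) = integral {a<..<b} f"
    by (rule lebesgue_integral_eq_integral[OF L2_integrable[OF continuous_L2[OF assms]]]) simp
  then show ?thesis by (simp add: integral_open_interval_real)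
qed

lemma has_weak_deriv_C1:
  assumes ab: "a \<le> b" and d: "\<And>x. x \<in> {a..b} \<Longrightarrow> (g has_real_derivative h x) (at x within {a..b})"
    and h: "continuous_on {a..b} h"
  shows "has_weak_deriv a b 1 g h"
  unfolding has_weak_deriv_def
proof
  fix \<phi> assume \<phi>: "\<phi> \<in> test_functions a b"
  obtain D c e where D: "deriv_family UNIV D" "a < c" "e < b" "\<And>n x. x \<notin> {c..e} \<Longrightarrow> D n x = 0" "\<phi> = D 0"
     "\<And>n. nth_deriv UNIV n \<phi> = D n"
    using test_functionsE[OF \<phi>] by metis
  have g: "continuous_on {a..b} g" using d by (meson DERIV_continuous continuous_on_eq_continuous_within)
  note Dc = deriv_family_continuous[OF D(1)]
  have "((\<lambda>x. g x * D 0 x) has_real_derivative g x * D (Suc 0) x + h x * D 0 x) (at x within {a..b})" if "x \<in> {a..b}" for x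
    by (rule DERIV_mult'[OF d[OF that] has_field_derivative_at_within[OF deriv_family_DERIV[OF D(1)]]])
  then have "((\<lambda>x. g x * D 1 x + h x * D 0 x) has_integral g b * D 0 b - g a * D 0 a) {a..b}"
    using ab by (intro fundamental_theorem_of_calculus) (auto simp: has_real_derivative_iff_has_vector_derivative)
  moreover have "D 0 a = 0" "D 0 b = 0" using D by auto
  ultimately have "integral {a..b} (\<lambda>x. g x * D 1 x + h x * D 0 x) = 0" by (simp add: integral_unique)
  then have "integral {a..b} (\<lambda>x. g x * D 1 x) + integral {a..b} (\<lambda>x. h x * D 0 x) = 0"
    by (subst (asm) Henstock_Kurzweil_Integration.integral_add)
      (auto intro!: integrable_continuous_interval continuous_intros g h Dc)
  then show "(LINT x|lebesgue_on {a<..<b}. g x * nth_deriv UNIV 1 \<phi> x) = (- 1) ^ 1 * (LINT x|lebesgue_on {a<..<b}. h x * \<phi> x)"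
    unfolding D(6) unfolding D(5) by (simp add: integral_interval_continuous continuous_on_mult g h Dc)
qed

lemma has_weak_deriv_2:
  assumes "has_weak_deriv a b 1 g h" "has_weak_deriv a b 1 h k"
  shows "has_weak_deriv a b 2 g k"
  unfolding has_weak_deriv_def
proof
  fix \<phi> assume \<phi>: "\<phi> \<in> test_functions a b"
  have "(LINT x|lebesgue_on {a<..<b}. g x * nth_deriv UNIV 2 \<phi> x) = - (LINT x|lebesgue_on {a<..<b}. h x * nth_deriv UNIV 1 \<phi> x)"
    using assms(1) test_functions_deriv[OF \<phi>] unfolding has_weak_deriv_def by fastforce
  also have "\<dots> = (LINT x|lebesgue_on {a<..<b}. k x * \<phi> x)"
    using assms(2) \<phi> unfolding has_weak_deriv_def by simp
  finally show "(LINT x|lebesgue_on {a<..<b}. g x * nth_deriv UNIV 2 \<phi> x) = (- 1)\<^sup>2 * (LINT x|lebesgue_on {a<..<b}. k x * \<phi> x)"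
    by simp
qed

text \<open>\<open>Sobolev\<close> supplies the weak derivatives of each order separately; testing
  with the derivative of a test function links the second to the first.\<close>

lemma has_weak_deriv_1_of_2:
  assumes "has_weak_deriv a b 1 g h" "has_weak_deriv a b 2 g k"
  shows "has_weak_deriv a b 1 h k"
  unfolding has_weak_deriv_def
proof
  fix \<phi> assume \<phi>: "\<phi> \<in> test_functions a b"
  have "(LINT x|lebesgue_on {a<..<b}. g x * nth_deriv UNIV 2 \<phi> x) = - (LINT x|lebesgue_on {a<..<b}. h x * nth_deriv UNIV 1 \<phi> x)"
    using assms(1) test_functions_deriv[OF \<phi>] unfolding has_weak_deriv_def by fastforce
  moreover have "(LINT x|lebesgue_on {a<..<b}. g x * nth_deriv UNIV 2 \<phi> x) = (LINT x|lebesgue_on {a<..<b}. k x * \<phi> x)"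
    using assms(2) \<phi> unfolding has_weak_deriv_def by simp
  ultimately show "(LINT x|lebesgue_on {a<..<b}. h x * nth_deriv UNIV 1 \<phi> x) = (- 1) ^ 1 * (LINT x|lebesgue_on {a<..<b}. k x * \<phi> x)"
    by simp
qed

lemma has_weak_deriv_0: "has_weak_deriv a b 0 g g"
  by (simp add: has_weak_deriv_def nth_deriv_def)

lemma has_weak_deriv_diff:
  assumes "g \<in> L2 a b" "g' \<in> L2 a b" "h \<in> L2 a b" "h' \<in> L2 a b"
    and "has_weak_deriv a b n g h" "has_weak_deriv a b n g' h'"
  shows "has_weak_deriv a b n (\<lambda>x. g x - g' x) (\<lambda>x. h x - h' x)"
  unfolding has_weak_deriv_def
proof
  fix \<phi> assume \<phi>: "\<phi> \<in> test_functions a b"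
  have dn: "nth_deriv UNIV n \<phi> \<in> L2 a b"
  proof -
    obtain D c d where D: "deriv_family UNIV D" "\<And>n. nth_deriv UNIV n \<phi> = D n"
      using test_functionsE[OF \<phi>] by metis
    then show ?thesis by (simp add: continuous_L2 deriv_family_continuous)
  qed
  note i = L2_integrable_mult[OF assms(1) dn] L2_integrable_mult[OF assms(2) dn]
    L2_integrable_mult[OF assms(3) test_function_L2[OF \<phi>]] L2_integrable_mult[OF assms(4) test_function_L2[OF \<phi>]]
  show "(LINT x|lebesgue_on {a<..<b}. (g x - g' x) * nth_deriv UNIV n \<phi> x) = (- 1) ^ n * (LINT x|lebesgue_on {a<..<b}. (h x - h' x) * \<phi> x)"
    unfolding left_diff_distrib Bochner_Integration.integral_diff[OF i(1,2)] Bochner_Integration.integral_diff[OF i(3,4)]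
      right_diff_distrib bspec[OF assms(5)[unfolded has_weak_deriv_def] \<phi>] bspec[OF assms(6)[unfolded has_weak_deriv_def] \<phi>] ..
qed

text \<open>Product of a step rising between 1 / c and 2 / c and one falling between y - 1 / c and
  y, where c = n + 2. At y itself both the product and the indicator are 0.\<close>

lemma test_function_approx:
  assumes y: "0 < y" "y < 1"
  obtains \<phi> where "\<And>n::nat. \<phi> n \<in> test_functions 0 1" "\<And>n x. \<bar>\<phi> n x\<bar> \<le> 1"
    "\<And>x. 0 < x \<Longrightarrow> x < 1 \<Longrightarrow> (\<lambda>n. \<phi> n x) \<longlonglongrightarrow> indicat_real {..<y} x"
proof -
  have s: "(1::real) < 2" by simp
  obtain \<theta> where \<theta>: "deriv_family UNIV \<theta>" "\<And>x. x \<le> 0 \<Longrightarrow> \<theta> 0 x = 0"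
    "\<And>x. 1 \<le> x \<Longrightarrow> \<theta> 0 x = 1" "\<And>x. \<bar>\<theta> 0 x\<bar> \<le> 1"
    by (rule gevrey_step_exists[OF s]) blast
  define c where "c n = real n + 2" for n
  have c: "0 < c n" for n by (simp add: c_def)
  define D where "D n = leibniz (affine_family (c n) (1 / c n) \<theta>) (affine_family (- c n) y \<theta>)" for n
  have D: "deriv_family UNIV (D n)" for n
    unfolding D_def by (intro deriv_family_leibniz deriv_family_affine \<theta>)
  have D0: "D n 0 x = \<theta> 0 (c n * x - 1) * \<theta> 0 (c n * (y - x))" for n x
    using c[of n] by (simp add: D_def leibniz_0 affine_family_0 algebra_simps)
  show thesis
  proof (rule that[of "\<lambda>n. D n 0"])
    fix n
    show "D n 0 \<in> test_functions 0 1"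
    proof (rule test_functionsI(1)[OF D, where c = "1 / c n" and d = y])
      fix x assume "x \<notin> {1 / c n..y}"
      then consider "x < 1 / c n" | "y < x" by force
      then have "c n * x - 1 \<le> 0 \<or> c n * (y - x) \<le> 0"
        using c[of n] by cases (auto simp: field_simps mult_nonneg_nonpos)
      then show "D n 0 x = 0" using \<theta>(2) by (auto simp: D0)
    qed (use c y in auto)
    show "\<bar>D n 0 x\<bar> \<le> 1" for x
      unfolding D0 abs_mult using \<theta>(4) by (intro mult_le_one) auto
  next
    fix x :: real assume x: "0 < x" "x < 1"
    show "(\<lambda>n. D n 0 x) \<longlonglongrightarrow> indicat_real {..<y} x"
    proof (cases "x < y")
      case True
      obtain N1 :: nat where N1: "2 / x \<le> real N1" using real_arch_simple by blast
      obtain N2 :: nat where N2: "1 / (y - x) \<le> real N2" using real_arch_simple by blast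
      have "D n 0 x = 1" if n: "n \<ge> max N1 N2" for n
      proof -
        have "2 / x \<le> c n" "1 / (y - x) \<le> c n" using N1 N2 n by (auto simp: c_def)
        then have "1 \<le> c n * x - 1" "1 \<le> c n * (y - x)" using x True by (auto simp: field_simps)
        then show ?thesis using \<theta>(3) by (simp add: D0)
      qed
      then have "\<forall>\<^sub>F n in sequentially. D n 0 x = indicat_real {..<y} x"
        using True eventually_ge_at_top[of "max N1 N2"] by (auto elim!: eventually_mono)
      then show ?thesis by (rule tendsto_eventually)
    next
      case False
      have "D n 0 x = 0" for n
      proof -
        have "c n * (y - x) \<le> 0" using False c[of n] by (simp add: mult_nonneg_nonpos)
        then show ?thesis using \<theta>(2) by (simp add: D0)
      qed
      then show ?thesis using False by simp
    qed
  qed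
qed

text \<open>Dominated convergence along smoothed indicators reduces the claim to vanishing
  primitives.\<close>

lemma fundamental_lemma:
  assumes w: "w \<in> L2 0 1" and z: "\<And>\<phi>. \<phi> \<in> test_functions 0 1 \<Longrightarrow> (LINT x|I01. w x * \<phi> x) = 0"
  shows "AE x in I01. w x = 0"
proof (rule AE_zero_of_primitive_zero[OF L2_integrable[OF w]])
  fix y :: real assume y: "0 < y" "y < 1"
  obtain \<phi> where \<phi>: "\<And>n::nat. \<phi> n \<in> test_functions 0 1" "\<And>n x. \<bar>\<phi> n x\<bar> \<le> 1"
    "\<And>x. 0 < x \<Longrightarrow> x < 1 \<Longrightarrow> (\<lambda>n. \<phi> n x) \<longlonglongrightarrow> indicat_real {..<y} x"
    using test_function_approx[OF y] by metis
  have [measurable]: "w \<in> borel_measurable I01" by (rule L2_measurable[OF w])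
  have [measurable]: "\<phi> n \<in> borel_measurable I01" for n by (rule test_function_measurable[OF \<phi>(1)])
  have "(\<lambda>n. LINT x|I01. w x * \<phi> n x) \<longlonglongrightarrow> (LINT x|I01. indicat_real {..<y} x * w x)"
  proof (rule integral_dominated_convergence[where w = "\<lambda>x. \<bar>w x\<bar>"])
    show "integrable I01 (\<lambda>x. \<bar>w x\<bar>)" by (intro integrable_abs L2_integrable w)
    show "AE x in I01. (\<lambda>n. w x * \<phi> n x) \<longlonglongrightarrow> indicat_real {..<y} x * w x"
    proof (rule AE_I2)
      fix x assume "x \<in> space I01"
      then have "(\<lambda>n. w x * \<phi> n x) \<longlonglongrightarrow> w x * indicat_real {..<y} x" by (intro tendsto_intros \<phi>(3)) auto
      then show "(\<lambda>n. w x * \<phi> n x) \<longlonglongrightarrow> indicat_real {..<y} x * w x" by (simp add: mult.commute)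
    qed
    show "AE x in I01. norm (w x * \<phi> n x) \<le> \<bar>w x\<bar>" for n
      using \<phi>(2)[of n] by (intro AE_I2) (simp add: abs_mult mult_left_le)
  qed measurable
  then have "(\<lambda>n. 0) \<longlonglongrightarrow> (LINT x|I01. indicat_real {..<y} x * w x)" unfolding z[OF \<phi>(1)] .
  from LIMSEQ_unique[OF this tendsto_const] show "(LINT x|I01. indicat_real {..<y} x * w x) = 0" .
qed

lemma has_weak_deriv_unique:
  assumes "h \<in> L2 0 1" "k \<in> L2 0 1" "has_weak_deriv 0 1 n g h" "has_weak_deriv 0 1 n g k"
  shows "AE x in I01. h x = k x"
proof -
  have "AE x in I01. h x - k x = 0"
  proof (rule fundamental_lemma[OF L2_diff[OF assms(1,2)]])
    fix \<phi> assume \<phi>: "\<phi> \<in> test_functions 0 1"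
    note bspec[OF assms(3)[unfolded has_weak_deriv_def] \<phi>] bspec[OF assms(4)[unfolded has_weak_deriv_def] \<phi>]
    from trans[OF this(1)[symmetric] this(2)]
    have "(- 1) ^ n * (LINT x|I01. h x * \<phi> x) = (- 1) ^ n * (LINT x|I01. k x * \<phi> x)" .
    moreover have "(- 1 :: real) ^ n \<noteq> 0" by simp
    ultimately have e: "(LINT x|I01. h x * \<phi> x) = (LINT x|I01. k x * \<phi> x)" using mult_left_cancel by blast
    have i: "integrable I01 (\<lambda>x. h x * \<phi> x)" "integrable I01 (\<lambda>x. k x * \<phi> x)"
      by (intro L2_integrable_mult assms test_function_L2[OF \<phi>])+
    show "(LINT x|I01. (h x - k x) * \<phi> x) = 0"
      unfolding left_diff_distrib Bochner_Integration.integral_diff[OF i] e by simp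
  qed
  then show ?thesis by simp
qed

lemma weak_deriv_props:
  assumes "\<exists>h\<in>L2 a b. has_weak_deriv a b n g h"
  shows "weak_deriv a b n g \<in> L2 a b" "has_weak_deriv a b n g (weak_deriv a b n g)"
proof -
  have "weak_deriv a b n g \<in> L2 a b \<and> has_weak_deriv a b n g (weak_deriv a b n g)"
    unfolding weak_deriv_def by (rule someI_ex[OF assms[unfolded Bex_def]])
  then show "weak_deriv a b n g \<in> L2 a b" "has_weak_deriv a b n g (weak_deriv a b n g)" by auto
qed

lemma weak_deriv_eqI:
  assumes "h \<in> L2 0 1" "has_weak_deriv 0 1 n g h"
  shows "weak_deriv 0 1 n g \<in> L2 0 1" "cls (weak_deriv 0 1 n g) = cls h"
proof -
  have e: "\<exists>h\<in>L2 0 1. has_weak_deriv 0 1 n g h" using assms by blast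
  show "weak_deriv 0 1 n g \<in> L2 0 1" by (rule weak_deriv_props[OF e])
  show "cls (weak_deriv 0 1 n g) = cls h"
    by (rule cls_eqI[OF weak_deriv_props(1)[OF e] assms(1)
        has_weak_deriv_unique[OF weak_deriv_props(1)[OF e] assms(1) weak_deriv_props(2)[OF e] assms(2)]])
qed

lemma tail_test_deriv:
  assumes \<phi>: "\<phi> \<in> test_functions 0 1" and x: "0 < x" "x < 1"
  shows "tail (nth_deriv UNIV 1 \<phi>) x = - \<phi> x"
proof -
  obtain D c d where D: "deriv_family UNIV D" "0 < c" "d < 1" "\<And>n x. x \<notin> {c..d} \<Longrightarrow> D n x = 0" "\<phi> = D 0"
     "\<And>n. nth_deriv UNIV n \<phi> = D n"
    using test_functionsE[OF \<phi>] by metis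
  have F: "integral {p..q} (D 1) = D 0 q - D 0 p" if "p \<le> q" for p q
    using that deriv_family_DERIV[OF D(1), of 0]
    by (intro integral_unique fundamental_theorem_of_calculus)
      (auto simp: has_real_derivative_iff_has_vector_derivative intro: has_vector_derivative_at_within)
  have c: "continuous_on S (D 1)" for S by (rule deriv_family_continuous[OF D(1)])
  have "tail (D 1) x = (LINT y|I01. D 1 y) - (LINT y|I01. indicat_real {..<x} y * D 1 y)"
    by (rule tail_complement[OF L2_integrable[OF continuous_L2[OF c]] x])
  also have "(LINT y|I01. D 1 y) = D 0 1 - D 0 0"
    using F[of 0 1] by (simp only: integral_interval_continuous[OF c])
  also have "(LINT y|I01. indicat_real {..<x} y * D 1 y) = D 0 x - D 0 0"
    using F[of 0 x] x integral_I01_lessThan(1)[of x "D 1"] integral_interval_continuous[OF c, of 0 x] by simp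
  also have "D 0 1 - D 0 0 - (D 0 x - D 0 0) = - D 0 x" using D by simp
  finally show ?thesis unfolding D(6) unfolding D(5) .
qed

lemma has_weak_deriv_primitive:
  assumes h: "h \<in> L2 0 1" and g: "AE x in I01. g x = c + ind x \<bullet> cls h" and gL: "g \<in> L2 0 1"
  shows "has_weak_deriv 0 1 1 g h"
  unfolding has_weak_deriv_def
proof
  fix \<phi> assume \<phi>: "\<phi> \<in> test_functions 0 1"
  let ?d = "nth_deriv UNIV 1 \<phi>"
  have d: "?d \<in> test_functions 0 1" by (rule test_functions_deriv[OF \<phi>])
  have dm [measurable]: "?d \<in> borel_measurable I01" by (rule test_function_measurable[OF d])
  have [measurable]: "g \<in> borel_measurable I01" "h \<in> borel_measurable I01" "\<phi> \<in> borel_measurable I01"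
    using gL h test_function_measurable[OF \<phi>] by (auto intro: L2_measurable)
  obtain C where C: "\<And>x. \<bar>?d x\<bar> \<le> C" using test_function_bounded[OF d] by metis
  have C0: "0 \<le> C" using C[of 0] by linarith
  \<comment> \<open>On (0, 1) the weight y^(-1/2) is at least 1, so a bounded function satisfies the
    growth condition of \<open>tail_adjoint\<close> with a = 1.\<close>
  have b: "\<bar>?d y\<bar> \<le> C * y powr (1/2 - 1)" if "0 < y" "y < 1" for y
  proof -
    have "1 \<le> y powr (1/2 - 1)" using that powr_mono2'[of "- (1/2)" y 1] by simp
    then have "C * 1 \<le> C * y powr (1/2 - 1)" using C0 by (intro mult_left_mono) auto
    then show ?thesis using C[of y] by linarith
  qed
  have iF: "(\<lambda>y. ind y \<bullet> cls h) \<in> L2 0 1" by (rule continuous_L2[OF continuous_on_primitive])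
  have t1: "(LINT x|I01. tail ?d x * h x) = (LINT y|I01. ?d y * (ind y \<bullet> cls h))"
    by (rule tail_adjoint[OF dm _ _ b h]) auto
  have t2: "(LINT x|I01. tail ?d x * h x) = (LINT x|I01. - (h x * \<phi> x))"
    by (rule Bochner_Integration.integral_cong) (auto simp: tail_test_deriv[OF \<phi>, unfolded One_nat_def])
  have t3: "(LINT x|I01. ?d x) = 0"
  proof -
    have "has_weak_deriv 0 1 1 (\<lambda>_. 1) (\<lambda>_. 0)"
      by (rule has_weak_deriv_C1) auto
    then show ?thesis using \<phi> unfolding has_weak_deriv_def by fastforce
  qed
  have "(LINT x|I01. g x * ?d x) = (LINT x|I01. c * ?d x + ?d x * (ind x \<bullet> cls h))"
  proof (rule integral_cong_AE)
    show "AE x in I01. g x * ?d x = c * ?d x + ?d x * (ind x \<bullet> cls h)"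
      using g by eventually_elim (simp add: algebra_simps)
  qed measurable
  also have "\<dots> = (LINT x|I01. c * ?d x) + (LINT x|I01. ?d x * (ind x \<bullet> cls h))"
    by (intro Bochner_Integration.integral_add integrable_mult_right L2_integrable L2_integrable_mult test_function_L2[OF d] iF)
  also have "\<dots> = - (LINT x|I01. h x * \<phi> x)" using t1 t2 t3 by simp
  finally show "(LINT x|I01. g x * ?d x) = (- 1) ^ 1 * (LINT x|I01. h x * \<phi> x)" by simp
qed

lemma test_function_antiderivative:
  assumes \<eta>: "\<eta> \<in> test_functions 0 1"
  obtains H D c d where "deriv_family UNIV D" "0 < c" "d < 1" "\<And>n x. x \<notin> {c..d} \<Longrightarrow> D n x = 0" "\<eta> = D 0"
     "\<And>n. nth_deriv UNIV n \<eta> = D n" "\<And>x. (H has_real_derivative D 0 x) (at x)" "\<And>x. x < c \<Longrightarrow> H x = 0"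
     "H 1 = (LINT x|I01. \<eta> x)"
proof -
  obtain D c d where D: "deriv_family UNIV D" "0 < c" "d < 1" "\<And>n x. x \<notin> {c..d} \<Longrightarrow> D n x = 0" "\<eta> = D 0"
     "\<And>n. nth_deriv UNIV n \<eta> = D n"
    using test_functionsE[OF \<eta>] by metis
  have cont: "continuous_on S (D 0)" for S by (rule deriv_family_continuous[OF D(1)])
  define H where "H x = integral {0..x} (D 0)" for x
  have Hz: "H x = 0" if "x < c" for x
  proof -
    have "H x = integral {0..x} (\<lambda>_. 0)" unfolding H_def by (rule integral_cong) (use D that in auto)
    then show ?thesis by simp
  qed
  have Hd: "(H has_real_derivative D 0 x) (at x)" for x
  proof (cases "x < c")
    case True
    have "((\<lambda>_. 0) has_real_derivative 0) (at x)" by simp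
    then have "(H has_real_derivative 0) (at x)"
      by (rule has_field_derivative_transform_within_open[of _ _ _ "{..<c}"]) (use True Hz in auto)
    then show ?thesis using True D by simp
  next
    case False
    have "(H has_real_derivative D 0 x) (at x within {0..x + 1})"
      unfolding H_def by (rule integral_has_real_derivative[OF cont]) (use False D in auto)
    then show ?thesis using False D by (simp add: at_within_Icc_at)
  qed
  have H1: "H 1 = (LINT x|I01. \<eta> x)" using integral_interval_continuous[OF cont, of 0 1] by (simp add: H_def D(5))
  show thesis by (rule that[OF D Hd Hz H1])
qed

text \<open>Beyond the support the antiderivative is constant, and the zero mean makes that constant
  0.\<close>

lemma test_function_primitive:
  assumes \<eta>: "\<eta> \<in> test_functions 0 1" and z: "(LINT x|I01. \<eta> x) = 0"
  obtains \<phi> where "\<phi> \<in> test_functions 0 1" "nth_deriv UNIV 1 \<phi> = \<eta>"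
proof -
  obtain H D c d where D: "deriv_family UNIV D" "0 < c" "d < 1" "\<And>n x. x \<notin> {c..d} \<Longrightarrow> D n x = 0" "\<eta> = D 0"
    and D': "\<And>n. nth_deriv UNIV n \<eta> = D n"
    and Hd: "\<And>x. (H has_real_derivative D 0 x) (at x)" and Hz: "\<And>x. x < c \<Longrightarrow> H x = 0" and H1': "H 1 = (LINT x|I01. \<eta> x)"
    by (rule test_function_antiderivative[OF \<eta>]) blast
  have H1: "H 1 = 0" using H1' z by simp
  have Hz': "H x = 0" if "d < x" for x
  proof -
    have "(H has_real_derivative 0) (at z within {d<..})" if "z \<in> {d<..}" for z
      using has_field_derivative_at_within[OF Hd[of z]] D(4)[of z 0] that by simp
    then obtain c where "\<And>z. z \<in> {d<..} \<Longrightarrow> H z = c"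
      using has_field_derivative_zero_constant[of "{d<..}" H] by auto
    then show ?thesis using H1 that D(3) by (metis greaterThan_iff)
  qed
  define E where "E n = (case n of 0 \<Rightarrow> H | Suc k \<Rightarrow> D k)" for n
  have E: "deriv_family UNIV E"
    unfolding deriv_family_def has_real_derivative_iff_has_vector_derivative[symmetric]
  proof (intro allI ballI)
    fix n x
    show "(E n has_real_derivative E (Suc n) x) (at x within UNIV)"
      using Hd[of x] deriv_family_DERIV[OF D(1)] by (cases n) (simp_all add: E_def)
  qed
  have z: "E 0 x = 0" if "x \<notin> {c..d}" for x using that Hz[of x] Hz'[of x] by (auto simp: E_def)
  show thesis
    by (rule that[OF test_functionsI(1)[OF E D(2,3) z]])
      (use test_functionsI(2)[OF E D(2,3) z, of 1] in \<open>auto simp: E_def D(5) fun_eq_iff\<close>)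
qed

text \<open>After subtraction of the primitive of h, the difference is orthogonal to every
  derivative of a test function. Each test function is such a derivative plus a multiple of a fixed
  \<kappa> of nonzero mean, which identifies the difference as a constant.\<close>

lemma du_Bois_Reymond:
  assumes g: "g \<in> L2 0 1" and h: "h \<in> L2 0 1" and gh: "has_weak_deriv 0 1 1 g h"
  obtains c where "AE x in I01. g x = c + ind x \<bullet> cls h"
proof -
  let ?F = "\<lambda>x. ind x \<bullet> cls h"
  have F: "?F \<in> L2 0 1" by (rule continuous_L2[OF continuous_on_primitive])
  have "has_weak_deriv 0 1 1 ?F h" by (rule has_weak_deriv_primitive[OF h _ F, of 0]) simp
  from has_weak_deriv_diff[OF g F h h gh this]
  have w0: "(LINT x|I01. (g x - ?F x) * nth_deriv UNIV 1 \<phi> x) = 0" if "\<phi> \<in> test_functions 0 1" for \<phi>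
    using that unfolding has_weak_deriv_def by simp
  have w: "(\<lambda>x. g x - ?F x) \<in> L2 0 1" by (rule L2_diff[OF g F])
  obtain \<kappa> where \<kappa>: "\<kappa> \<in> test_functions 0 1" "(LINT x|I01. \<kappa> x) \<noteq> 0"
  proof -
    \<comment> \<open>Otherwise the fundamental lemma would force the constant 1 to vanish.\<close>
    have "\<exists>\<kappa>\<in>test_functions 0 1. (LINT x|I01. \<kappa> x) \<noteq> 0"
    proof (rule ccontr)
      assume "\<not> ?thesis"
      then have "AE x in I01. (1::real) = 0" by (intro fundamental_lemma L2_const) simp
      from zero_of_AE_zero_continuous[OF continuous_on_const this, of 0] show False by simp
    qed
    then show thesis using that by blast
  qed
  define c where "c = (LINT x|I01. (g x - ?F x) * \<kappa> x) / (LINT x|I01. \<kappa> x)"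
  have "AE x in I01. (g x - ?F x) - c = 0"
  proof (rule fundamental_lemma[OF L2_diff[OF w L2_const]])
    fix \<eta> assume \<eta>: "\<eta> \<in> test_functions 0 1"
    define p where "p = (LINT x|I01. \<eta> x) / (LINT x|I01. \<kappa> x)"
    note i = L2_integrable[OF test_function_L2[OF \<eta>]] L2_integrable[OF test_function_L2[OF \<kappa>(1)]]
    note iw = L2_integrable_mult[OF w test_function_L2[OF \<eta>]] L2_integrable_mult[OF w test_function_L2[OF \<kappa>(1)]]
    have t: "(\<lambda>x. 1 * \<eta> x + (- p) * \<kappa> x) \<in> test_functions 0 1"
      by (rule test_functions_lincomb[OF \<eta> \<kappa>(1)])
    have "(LINT x|I01. 1 * \<eta> x + (- p) * \<kappa> x) = (LINT x|I01. \<eta> x) + (- p) * (LINT x|I01. \<kappa> x)"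
      by (subst Bochner_Integration.integral_add) (use i in auto)
    also have "\<dots> = 0" using \<kappa>(2) by (simp add: p_def)
    finally obtain \<phi> where \<phi>: "\<phi> \<in> test_functions 0 1" "nth_deriv UNIV 1 \<phi> = (\<lambda>x. 1 * \<eta> x + (- p) * \<kappa> x)"
      using test_function_primitive[OF t] by metis
    have "0 = (LINT x|I01. (g x - ?F x) * \<eta> x + (- p) * ((g x - ?F x) * \<kappa> x))"
      using w0[OF \<phi>(1)] unfolding \<phi>(2) by (simp add: algebra_simps)
    also have "\<dots> = (LINT x|I01. (g x - ?F x) * \<eta> x) + (- p) * (LINT x|I01. (g x - ?F x) * \<kappa> x)"
      by (subst Bochner_Integration.integral_add) (use iw in auto)
    finally have "(LINT x|I01. (g x - ?F x) * \<eta> x) = p * (LINT x|I01. (g x - ?F x) * \<kappa> x)" by simp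
    also have "\<dots> = c * (LINT x|I01. \<eta> x)" by (simp add: p_def c_def)
    finally have e: "(LINT x|I01. (g x - ?F x) * \<eta> x) = c * (LINT x|I01. \<eta> x)" .
    have "(LINT x|I01. ((g x - ?F x) - c) * \<eta> x) = (LINT x|I01. (g x - ?F x) * \<eta> x - c * \<eta> x)"
      by (simp add: left_diff_distrib)
    also have "\<dots> = (LINT x|I01. (g x - ?F x) * \<eta> x) - (LINT x|I01. c * \<eta> x)"
      by (rule Bochner_Integration.integral_diff[OF iw(1)]) (use i in simp)
    finally show "(LINT x|I01. ((g x - ?F x) - c) * \<eta> x) = 0" using e by simp
  qed
  then have "AE x in I01. g x = c + ?F x" by eventually_elim simp
  then show thesis by (rule that)
qed

lemma trace_eqI:
  assumes F: "continuous_on {0..1} F" and e: "AE x in I01. F x = g x" and c: "c \<in> {0..1}"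
  shows "trace 0 1 g c = F c"
  unfolding trace_def
proof (rule the_equality)
  show "\<exists>G. continuous_on {0..1} G \<and> (AE x in lebesgue_on {0<..<1}. G x = g x) \<and> F c = G c"
    using F e by blast
  fix v assume "\<exists>G. continuous_on {0..1} G \<and> (AE x in lebesgue_on {0<..<1}. G x = g x) \<and> v = G c"
  then obtain H where H: "continuous_on {0..1} H" "AE x in I01. H x = g x" "v = H c" by blast
  have "AE x in I01. H x - F x = 0" using e H(2) by eventually_elim simp
  then have "H c - F c = 0" by (rule zero_of_AE_zero_continuous[OF continuous_on_diff[OF H(1) F] _ c])
  then show "v = F c" using H by simp
qed

section \<open>The degenerate operator on weakly differentiable functions\<close>

lemma powr_le_1: "0 < x \<Longrightarrow> x < 1 \<Longrightarrow> 0 \<le> p \<Longrightarrow> x powr p \<le> (1::real)"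
  by (rule powr_le1) auto

lemma product_L2:
  assumes f: "f \<in> L2 0 1" and p: "0 \<le> p"
  shows "(\<lambda>x. x powr p * f x) \<in> L2 0 1"
proof (rule L2_dominated[OF f, where C = 1])
  have [measurable]: "f \<in> borel_measurable I01" by (rule L2_measurable[OF f])
  show "(\<lambda>x. x powr p * f x) \<in> borel_measurable I01" by measurable
  show "AE x in I01. \<bar>x powr p * f x\<bar> \<le> 1 * \<bar>f x\<bar>"
    unfolding abs_mult using p by (intro AE_I2 mult_right_mono) (auto simp: powr_le_1)
qed

context degenerate begin

text \<open>The expanded form of \<open>(x\<^sup>a \<psi>')'\<close>, with \<open>f = \<psi>'\<close> and \<open>g = \<psi>''\<close>.\<close>

definition Lf :: "(real \<Rightarrow> real) \<Rightarrow> (real \<Rightarrow> real) \<Rightarrow> real \<Rightarrow> real" where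
  "Lf f g x = a * (x powr (a - 1) * f x) + x powr a * g x"

lemma Lf_L2: "f \<in> L2 0 1 \<Longrightarrow> g \<in> L2 0 1 \<Longrightarrow> Lf f g \<in> L2 0 1"
  unfolding Lf_def using a1 by (intro L2_add L2_cmult product_L2) auto

lemma Lf_diff: "(\<lambda>x. Lf f g x - Lf f' g' x) = Lf (\<lambda>x. f x - f' x) (\<lambda>x. g x - g' x)"
  by (simp add: Lf_def fun_eq_iff algebra_simps)

lemma norm_Lf_le:
  assumes f: "f \<in> L2 0 1" and g: "g \<in> L2 0 1"
  shows "norm (cls (Lf f g)) \<le> a * norm (cls f) + norm (cls g)"
proof -
  have p: "norm (cls (\<lambda>x. x powr p * f x)) \<le> norm (cls f)" if f: "f \<in> L2 0 1" and p: "0 \<le> p" for f p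
  proof (rule norm_cls_mono[OF product_L2[OF f p] f], rule AE_I2)
    fix x assume "x \<in> space I01"
    then have "x powr p * \<bar>f x\<bar> \<le> 1 * \<bar>f x\<bar>" using p by (intro mult_right_mono) (auto simp: powr_le_1)
    then show "\<bar>x powr p * f x\<bar> \<le> \<bar>f x\<bar>" by (simp add: abs_mult)
  qed
  have p1: "(\<lambda>x. x powr (a - 1) * f x) \<in> L2 0 1" and p2: "(\<lambda>x. x powr a * g x) \<in> L2 0 1"
    using a1 by (auto intro!: product_L2 f g)
  have "cls (Lf f g) = a *\<^sub>R cls (\<lambda>x. x powr (a - 1) * f x) + cls (\<lambda>x. x powr a * g x)"
    unfolding Lf_def[abs_def] cls_add[OF L2_cmult[OF p1] p2] cls_cmult[OF p1] ..
  then have "norm (cls (Lf f g)) \<le> norm (a *\<^sub>R cls (\<lambda>x. x powr (a - 1) * f x)) + norm (cls (\<lambda>x. x powr a * g x))"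
    by (simp only: norm_triangle_ineq)
  also have "norm (a *\<^sub>R cls (\<lambda>x. x powr (a - 1) * f x)) \<le> a * norm (cls f)"
    using a1 p[OF f, of "a - 1"] by (simp add: mult_left_mono)
  also have "norm (cls (\<lambda>x. x powr a * g x)) \<le> norm (cls g)" using a1 p[OF g, of a] by simp
  finally show ?thesis by simp
qed

text \<open>The integrated product rule for x^a H with H = c + primitive of h. As H is only the
  primitive of an L2 function, the rule comes from Fubini, applied with the truncated derivative
  \<open>p\<close> of x^a; the boundary term at 0 vanishes with x^a.\<close>

lemma primitive_product:
  assumes h: "h \<in> L2 0 1" and y: "0 \<le> y" "y \<le> 1"
  shows "ind y \<bullet> cls (Lf (\<lambda>x. c + ind x \<bullet> cls h) h) = y powr a * (c + ind y \<bullet> cls h)"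
proof -
  let ?F = "\<lambda>x. ind x \<bullet> cls h"
  have F: "?F \<in> L2 0 1" by (rule continuous_L2[OF continuous_on_primitive])
  have cF: "(\<lambda>x. c + ?F x) \<in> L2 0 1" by (intro L2_add L2_const F)
  have [measurable]: "h \<in> borel_measurable I01" by (rule L2_measurable[OF h])
  define p where "p x = indicat_real {..<y} x * (a * x powr (a - 1))" for x
  have pm [measurable]: "p \<in> borel_measurable I01" unfolding p_def by measurable
  have pa: "0 \<le> p x \<and> p x \<le> a" if "0 < x" "x < 1" for x
    using that a1 powr_le_1[of x "a - 1"] by (auto simp: p_def indicator_def mult_left_le)
  have pL: "p \<in> L2 0 1" by (rule L2_bounded[of _ _ _ a]) (measurable, rule AE_I2, use pa in force)
  have pint: "(LINT x|I01. indicat_real {..<z} x * p x) = (min z y) powr a" if z: "0 \<le> z" "z \<le> 1" for z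
  proof -
    have "(LINT x|I01. indicat_real {..<z} x * p x) = (LINT x|I01. a * (indicat_real {..<min z y} x * x powr (a - 1)))"
      by (rule Bochner_Integration.integral_cong) (auto simp: p_def indicator_def)
    also have "\<dots> = a * ((min z y) powr (a - 1 + 1) / (a - 1 + 1))"
      using powr_integral_I01(2)[of "a - 1" "min z y"] a1 y z by simp
    finally show ?thesis using a1 by simp
  qed
  have ptot: "(LINT x|I01. p x) = y powr a"
  proof -
    have "(LINT x|I01. p x) = (LINT x|I01. indicat_real {..<1} x * p x)"
      by (rule Bochner_Integration.integral_cong) auto
    then show ?thesis using pint[of 1] y by (simp add: min_def split: if_splits)
  qed
  have b: "\<bar>p x\<bar> \<le> a * x powr (1/2 - 1)" if x: "0 < x" "x < 1" for x
  proof -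
    have "1 \<le> x powr (1/2 - 1)" using x powr_mono2'[of "- (1/2)" x 1] by simp
    then have "a * 1 \<le> a * x powr (1/2 - 1)" using a1 by (intro mult_left_mono) auto
    then show ?thesis using pa[OF x] by linarith
  qed
  have tail: "tail p x = indicat_real {..<y} x * (y powr a - x powr a)" if x: "0 < x" "x < 1" for x
    using tail_complement[OF L2_integrable[OF pL] x] ptot pint[of x] x by (auto simp: indicator_def min_def)
  have "(LINT x|I01. p x * ?F x) = (LINT x|I01. tail p x * h x)"
    by (rule tail_adjoint[symmetric, OF pm _ _ b h]) auto
  also have "\<dots> = (LINT x|I01. y powr a * (indicat_real {..<y} x * h x) - indicat_real {..<y} x * (x powr a * h x))"
    by (rule Bochner_Integration.integral_cong) (auto simp: tail algebra_simps)
  also have "\<dots> = y powr a * ?F y - (LINT x|I01. indicat_real {..<y} x * (x powr a * h x))"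
    using a1 by (subst Bochner_Integration.integral_diff)
      (auto intro!: integrable_mult_right L2_integrable_mult indicator_L2 h product_L2 simp: inner_ind_cls h)
  finally have 2: "(LINT x|I01. p x * ?F x) = y powr a * ?F y - (LINT x|I01. indicat_real {..<y} x * (x powr a * h x))" .
  have "ind y \<bullet> cls (Lf (\<lambda>x. c + ?F x) h) = (LINT x|I01. indicat_real {..<y} x * Lf (\<lambda>x. c + ?F x) h x)"
    by (rule inner_ind_cls[OF Lf_L2[OF cF h]])
  also have "\<dots> = (LINT x|I01. (c * p x + p x * ?F x) + indicat_real {..<y} x * (x powr a * h x))"
    by (rule Bochner_Integration.integral_cong) (auto simp: Lf_def p_def algebra_simps)
  also have "\<dots> = (c * (LINT x|I01. p x) + (LINT x|I01. p x * ?F x)) + (LINT x|I01. indicat_real {..<y} x * (x powr a * h x))"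
  proof -
    have "0 \<le> a" using a1 by simp
    note i = integrable_mult_right[OF L2_integrable[OF pL], of c] L2_integrable_mult[OF pL F]
      L2_integrable_mult[OF indicator_L2 product_L2[OF h this], of y]
    show ?thesis
      unfolding Bochner_Integration.integral_add[OF Bochner_Integration.integrable_add[OF i(1,2)] i(3)]
        Bochner_Integration.integral_add[OF i(1,2)] by simp
  qed
  also have "\<dots> = y powr a * (c + ?F y)" unfolding 2 ptot by (simp add: algebra_simps)
  finally show ?thesis .
qed

definition Aop :: "(real \<Rightarrow> real) \<Rightarrow> real \<Rightarrow> real" where
  "Aop \<psi> = Lf (weak_deriv 0 1 1 \<psi>) (weak_deriv 0 1 2 \<psi>)"

lemma Sobolev_2_weak_deriv:
  assumes "\<psi> \<in> Sobolev 2 0 1"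
  shows "\<psi> \<in> L2 0 1" "n \<le> 2 \<Longrightarrow> weak_deriv 0 1 n \<psi> \<in> L2 0 1" "n \<le> 2 \<Longrightarrow> has_weak_deriv 0 1 n \<psi> (weak_deriv 0 1 n \<psi>)"
  using assms weak_deriv_props[of 0 1 n \<psi>] unfolding Sobolev_def by auto

text \<open>All that the weak formulation asks of \<psi> is expressed by the single class A \<psi>.
  The flux is its primitive, without a constant since x^a kills the continuous function \<psi>' at
  0; at x = 1 the weight is 1, so the flux there is \<psi>'(1); dividing the flux by x^a and
  integrating from 1 gives \<psi> = - G (A \<psi>).\<close>

lemma Sobolev_2_structure:
  assumes \<psi>: "\<psi> \<in> Sobolev 2 0 1"
  shows "Aop \<psi> \<in> L2 0 1"
    and "weak_deriv 0 1 1 (flux a \<psi>) \<in> L2 0 1" and "cls (weak_deriv 0 1 1 (flux a \<psi>)) = cls (Aop \<psi>)"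
    and "trace 0 1 (weak_deriv 0 1 1 \<psi>) 1 = ind 1 \<bullet> cls (Aop \<psi>)"
    and "trace 0 1 \<psi> 1 = 0 \<Longrightarrow> cls \<psi> = - G (cls (Aop \<psi>))"
proof -
  define h1 where "h1 = weak_deriv 0 1 1 \<psi>"
  define h2 where "h2 = weak_deriv 0 1 2 \<psi>"
  have L: "\<psi> \<in> L2 0 1" "h1 \<in> L2 0 1" "h2 \<in> L2 0 1"
    unfolding h1_def h2_def using Sobolev_2_weak_deriv[OF \<psi>] by auto
  have w1: "has_weak_deriv 0 1 1 \<psi> h1" and w2: "has_weak_deriv 0 1 2 \<psi> h2"
    unfolding h1_def h2_def using Sobolev_2_weak_deriv[OF \<psi>] by auto
  obtain c0 where c0: "AE x in I01. \<psi> x = c0 + ind x \<bullet> cls h1" using du_Bois_Reymond[OF L(1,2) w1] by metis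
  obtain c1 where c1: "AE x in I01. h1 x = c1 + ind x \<bullet> cls h2"
    using du_Bois_Reymond[OF L(2,3) has_weak_deriv_1_of_2[OF w1 w2]] by metis
  let ?H = "\<lambda>x. c1 + ind x \<bullet> cls h2"
  have H: "?H \<in> L2 0 1" by (intro L2_add L2_const continuous_L2[OF continuous_on_primitive])
  define k where "k = Lf ?H h2"
  have k: "k \<in> L2 0 1" unfolding k_def by (rule Lf_L2[OF H L(3)])
  have A: "Aop \<psi> = Lf h1 h2" by (simp add: Aop_def h1_def h2_def)
  show AL: "Aop \<psi> \<in> L2 0 1" unfolding A by (rule Lf_L2[OF L(2,3)])
  have Ak: "cls (Aop \<psi>) = cls k"
  proof (rule cls_eqI[OF AL k])
    show "AE x in I01. Aop \<psi> x = k x" using c1 by eventually_elim (simp add: A k_def Lf_def)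
  qed
  have K: "ind y \<bullet> cls k = y powr a * ?H y" if "0 \<le> y" "y \<le> 1" for y
    unfolding k_def by (rule primitive_product[OF L(3) that])
  have fl: "flux a \<psi> x = x powr a * h1 x" for x by (simp add: flux_def h1_def)
  have fL: "flux a \<psi> \<in> L2 0 1" unfolding fl[abs_def] using a1 by (intro product_L2 L) auto
  have fe: "AE x in I01. flux a \<psi> x = 0 + ind x \<bullet> cls k"
    using c1 AE_I01_space by eventually_elim (simp add: fl K)
  have wf: "has_weak_deriv 0 1 1 (flux a \<psi>) k" by (rule has_weak_deriv_primitive[OF k fe fL])
  show "weak_deriv 0 1 1 (flux a \<psi>) \<in> L2 0 1" by (rule weak_deriv_eqI(1)[OF k wf])
  show "cls (weak_deriv 0 1 1 (flux a \<psi>)) = cls (Aop \<psi>)" unfolding Ak by (rule weak_deriv_eqI(2)[OF k wf])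
  have "trace 0 1 h1 1 = ?H 1"
  proof (rule trace_eqI)
    show "continuous_on {0..1} ?H" by (intro continuous_intros continuous_on_ind)
    show "AE x in I01. ?H x = h1 x" using c1 by eventually_elim simp
  qed simp
  then show "trace 0 1 (weak_deriv 0 1 1 \<psi>) 1 = ind 1 \<bullet> cls (Aop \<psi>)"
    unfolding Ak h1_def[symmetric] using K[of 1] by simp
  assume tr: "trace 0 1 \<psi> 1 = 0"
  have "trace 0 1 \<psi> 1 = c0 + ind 1 \<bullet> cls h1"
  proof (rule trace_eqI[where F = "\<lambda>x. c0 + ind x \<bullet> cls h1"])
    show "continuous_on {0..1} (\<lambda>x. c0 + ind x \<bullet> cls h1)" by (intro continuous_intros continuous_on_ind)
    show "AE x in I01. c0 + ind x \<bullet> cls h1 = \<psi> x" using c0 by eventually_elim simp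
  qed simp
  then have c0': "c0 = - (ind 1 \<bullet> cls h1)" using tr by simp
  have d: "AE y in I01. dens (cls k) y = h1 y"
    using c1 AE_I01_space by eventually_elim (simp add: dens_def K powr_minus)
  have [measurable]: "h1 \<in> borel_measurable I01" by (rule L2_measurable[OF L(2)])
  have tot: "(LINT y|I01. h1 y) = ind 1 \<bullet> cls h1"
    unfolding inner_ind_cls[OF L(2)] by (rule Bochner_Integration.integral_cong) auto
  have Gk: "Gf (cls k) x = ind 1 \<bullet> cls h1 - ind x \<bullet> cls h1" if x: "0 < x" "x < 1" for x
  proof -
    have "Gf (cls k) x = tail h1 x"
      unfolding Gf_def tail_def
    proof (rule integral_cong_AE)
      show "AE y in I01. indicat_real {x<..} y * dens (cls k) y = indicat_real {x<..} y * h1 y"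
        using d by eventually_elim simp
    qed measurable
    also have "\<dots> = ind 1 \<bullet> cls h1 - ind x \<bullet> cls h1"
      unfolding tail_complement[OF L2_integrable[OF L(2)] x] tot inner_ind_cls[OF L(2), of x] ..
    finally show ?thesis .
  qed
  have "cls \<psi> = cls (\<lambda>x. - Gf (cls k) x)"
  proof (rule cls_eqI[OF L(1) L2_uminus[OF Gf_L2]])
    show "AE x in I01. \<psi> x = - Gf (cls k) x"
      using c0 AE_I01_space by eventually_elim (simp add: Gk c0')
  qed
  then show "cls \<psi> = - G (cls (Aop \<psi>))" by (simp add: Ak G_def cls_uminus Gf_L2)
qed

lemma cls_weak_deriv_diff:
  assumes "\<psi> \<in> Sobolev 2 0 1" "\<psi>' \<in> Sobolev 2 0 1" "n \<le> 2"
  shows "weak_deriv 0 1 n (\<lambda>x. \<psi> x - \<psi>' x) \<in> L2 0 1"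
    and "cls (weak_deriv 0 1 n (\<lambda>x. \<psi> x - \<psi>' x)) = cls (weak_deriv 0 1 n \<psi>) - cls (weak_deriv 0 1 n \<psi>')"
proof -
  note 1 = Sobolev_2_weak_deriv(1)[OF assms(1)] Sobolev_2_weak_deriv(1)[OF assms(2)]
  note 2 = Sobolev_2_weak_deriv(2)[OF assms(1) assms(3)] Sobolev_2_weak_deriv(2)[OF assms(2) assms(3)]
  note 3 = Sobolev_2_weak_deriv(3)[OF assms(1) assms(3)] Sobolev_2_weak_deriv(3)[OF assms(2) assms(3)]
  note w = weak_deriv_eqI[OF L2_diff[OF 2] has_weak_deriv_diff[OF 1 2 3]]
  show "weak_deriv 0 1 n (\<lambda>x. \<psi> x - \<psi>' x) \<in> L2 0 1" by (rule w(1))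
  show "cls (weak_deriv 0 1 n (\<lambda>x. \<psi> x - \<psi>' x)) = cls (weak_deriv 0 1 n \<psi>) - cls (weak_deriv 0 1 n \<psi>')"
    unfolding w(2) cls_diff[OF 2] ..
qed

lemma Aop_diff_le:
  assumes "\<psi> \<in> Sobolev 2 0 1" "\<psi>' \<in> Sobolev 2 0 1"
  shows "norm (cls (Aop \<psi>) - cls (Aop \<psi>')) \<le> (a + 1) * Sobolev_norm 2 0 1 (\<lambda>x. \<psi> x - \<psi>' x)"
proof -
  let ?w = "\<lambda>n. weak_deriv 0 1 n (\<lambda>x. \<psi> x - \<psi>' x)"
  note L = Sobolev_2_weak_deriv(2)[OF assms(1)] Sobolev_2_weak_deriv(2)[OF assms(2)]
  have L1: "weak_deriv 0 1 1 \<psi> \<in> L2 0 1" "weak_deriv 0 1 2 \<psi> \<in> L2 0 1"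
    "weak_deriv 0 1 1 \<psi>' \<in> L2 0 1" "weak_deriv 0 1 2 \<psi>' \<in> L2 0 1" by (auto intro: L)
  have n: "L2_norm 0 1 (?w n) \<le> Sobolev_norm 2 0 1 (\<lambda>x. \<psi> x - \<psi>' x)" if "n \<le> 2" for n
  proof -
    have "(L2_norm 0 1 (?w n))\<^sup>2 \<le> (\<Sum>n\<le>2. (L2_norm 0 1 (?w n))\<^sup>2)"
      using that by (intro member_le_sum) auto
    then have "sqrt ((L2_norm 0 1 (?w n))\<^sup>2) \<le> Sobolev_norm 2 0 1 (\<lambda>x. \<psi> x - \<psi>' x)"
      unfolding Sobolev_norm_def by (rule real_sqrt_le_mono)
    moreover have "0 \<le> L2_norm 0 1 (?w n)" by (simp add: L2_norm_def)
    ultimately show ?thesis by simp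
  qed
  have m: "norm (cls (weak_deriv 0 1 n \<psi>) - cls (weak_deriv 0 1 n \<psi>')) \<le> Sobolev_norm 2 0 1 (\<lambda>x. \<psi> x - \<psi>' x)" if "n \<le> 2" for n
    using n[OF that] unfolding norm_cls[OF cls_weak_deriv_diff(1)[OF assms that], symmetric] cls_weak_deriv_diff(2)[OF assms that] .
  have e: "cls (Aop \<psi>) - cls (Aop \<psi>') = cls (Lf (\<lambda>x. weak_deriv 0 1 1 \<psi> x - weak_deriv 0 1 1 \<psi>' x) (\<lambda>x. weak_deriv 0 1 2 \<psi> x - weak_deriv 0 1 2 \<psi>' x))"
    by (simp only: Aop_def cls_diff[OF Lf_L2[OF L1(1,2)] Lf_L2[OF L1(3,4)], symmetric] Lf_diff)
  have "norm (cls (Aop \<psi>) - cls (Aop \<psi>')) \<le> a * norm (cls (\<lambda>x. weak_deriv 0 1 1 \<psi> x - weak_deriv 0 1 1 \<psi>' x))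
      + norm (cls (\<lambda>x. weak_deriv 0 1 2 \<psi> x - weak_deriv 0 1 2 \<psi>' x))"
    unfolding e by (rule norm_Lf_le[OF L2_diff[OF L1(1,3)] L2_diff[OF L1(2,4)]])
  also have "\<dots> \<le> a * Sobolev_norm 2 0 1 (\<lambda>x. \<psi> x - \<psi>' x) + Sobolev_norm 2 0 1 (\<lambda>x. \<psi> x - \<psi>' x)"
    unfolding cls_diff[OF L1(1,3)] cls_diff[OF L1(2,4)]
    by (intro add_mono mult_left_mono m) (use a1 in auto)
  finally show ?thesis by (simp add: algebra_simps)
qed

lemma continuous_on_Aop:
  assumes "\<psi> \<in> C0_into I (Sobolev 2 0 1) (Sobolev_norm 2 0 1)"
  shows "continuous_on I (\<lambda>t. cls (Aop (\<psi> t)))"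
  unfolding continuous_on_def
proof
  fix t0 assume t0: "t0 \<in> I"
  have S: "\<And>t. t \<in> I \<Longrightarrow> \<psi> t \<in> Sobolev 2 0 1"
    and lim: "((\<lambda>t. Sobolev_norm 2 0 1 (\<lambda>x. \<psi> t x - \<psi> t0 x)) \<longlongrightarrow> 0) (at t0 within I)"
    using assms t0 by (auto simp: C0_into_def)
  have "((\<lambda>t. cls (Aop (\<psi> t)) - cls (Aop (\<psi> t0))) \<longlongrightarrow> 0) (at t0 within I)"
  proof (rule Lim_null_comparison)
    show "\<forall>\<^sub>F t in at t0 within I. norm (cls (Aop (\<psi> t)) - cls (Aop (\<psi> t0))) \<le> (a + 1) * Sobolev_norm 2 0 1 (\<lambda>x. \<psi> t x - \<psi> t0 x)"
      unfolding eventually_at_filter by (intro always_eventually allI impI Aop_diff_le S t0)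
    show "((\<lambda>t. (a + 1) * Sobolev_norm 2 0 1 (\<lambda>x. \<psi> t x - \<psi> t0 x)) \<longlongrightarrow> 0) (at t0 within I)"
      by (rule tendsto_mult_right_zero[OF lim])
  qed
  then show "((\<lambda>t. cls (Aop (\<psi> t))) \<longlongrightarrow> cls (Aop (\<psi> t0))) (at t0 within I)"
    by (rule LIM_zero_cancel)
qed

text \<open>The equation (x^a \<phi>')' = h is integrated explicitly. As h vanishes near 0, so does
  the flux H, and x^(-a) H has no singularity; the compact support of h is what places the solution
  in H^2.\<close>

lemma stationary_test_function:
  assumes h: "h \<in> test_functions 0 1"
  obtains \<phi> where "\<phi> \<in> Sobolev 2 0 1" "trace 0 1 (flux a \<phi>) 0 = 0" "trace 0 1 \<phi> 1 = 0" "cls (Aop \<phi>) = cls h"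
proof -
  obtain H D c d where D: "deriv_family UNIV D" "0 < c" "d < 1" "\<And>n x. x \<notin> {c..d} \<Longrightarrow> D n x = 0" "h = D 0"
    and Hd: "\<And>x. (H has_real_derivative D 0 x) (at x)" and Hz: "\<And>x. x < c \<Longrightarrow> H x = 0"
    by (rule test_function_antiderivative[OF h]) blast
  have Hc: "continuous_on S H" for S using Hd by (meson DERIV_isCont continuous_at_imp_continuous_on)
  define f1 where "f1 x = x powr (- a) * H x" for x
  define f2 where "f2 x = - a * x powr (- a - 1) * H x + x powr (- a) * D 0 x" for x
  have f1d: "(f1 has_real_derivative f2 x) (at x)" for x
  proof (cases "x < c")
    case True
    have "((\<lambda>_. 0) has_real_derivative 0) (at x)" by simp
    then have "(f1 has_real_derivative 0) (at x)"
      by (rule has_field_derivative_transform_within_open[of _ _ _ "{..<c}"]) (use True Hz in \<open>auto simp: f1_def\<close>)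
    then show ?thesis using True D(4)[of x 0] Hz by (simp add: f2_def)
  next
    case False
    then have x: "0 < x" using D by simp
    have "((\<lambda>x. x powr (- a)) has_real_derivative (- a) * x powr (- a - 1)) (at x)"
      by (rule has_real_derivative_powr[OF x])
    from DERIV_mult'[OF this Hd[of x]] show ?thesis by (simp add: f1_def[abs_def] f2_def add.commute)
  qed
  have f1c: "continuous_on S f1" for S using f1d by (meson DERIV_isCont continuous_at_imp_continuous_on)
  have "isCont f2 x" for x
  proof (cases "x < c")
    case True
    have "\<forall>\<^sub>F z in nhds x. f2 z = 0"
      using eventually_nhds_in_open[of "{..<c}" x] True
      by (auto elim!: eventually_mono simp: f2_def Hz D(4))
    then show ?thesis using isCont_cong[of f2 "\<lambda>_. 0" x] by simp
  next
    case False
    then have x: "0 < x" using D by simp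
    have "isCont H x" "isCont (D 0) x" using Hd deriv_family_DERIV[OF D(1)] by (blast intro: DERIV_isCont)+
    then show ?thesis unfolding f2_def using x by (intro continuous_intros) auto
  qed
  then have f2c: "continuous_on S f2" for S by (simp add: continuous_at_imp_continuous_on)
  define \<phi> where "\<phi> x = integral {0..x} f1 - integral {0..1} f1" for x
  have \<phi>d: "(\<phi> has_real_derivative f1 x) (at x within {0..1})" if "x \<in> {0..1}" for x
  proof -
    have "((\<lambda>x. integral {0..x} f1) has_real_derivative f1 x) (at x within {0..1})"
      by (rule integral_has_real_derivative[OF f1c that])
    from DERIV_diff[OF this DERIV_const[of "integral {0..1} f1"]] show ?thesis by (simp add: \<phi>_def[abs_def])
  qed
  have \<phi>c: "continuous_on {0..1} \<phi>" using \<phi>d by (meson DERIV_continuous continuous_on_eq_continuous_within)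
  note L = continuous_L2[OF \<phi>c] continuous_L2[OF f1c, of 0 1] continuous_L2[OF f2c, of 0 1]
  have w1: "has_weak_deriv 0 1 1 \<phi> f1" by (rule has_weak_deriv_C1[OF _ \<phi>d f1c]) simp
  have "has_weak_deriv 0 1 1 f1 f2"
    by (rule has_weak_deriv_C1[OF _ has_field_derivative_at_within[OF f1d] f2c]) simp
  then have w2: "has_weak_deriv 0 1 2 \<phi> f2" by (rule has_weak_deriv_2[OF w1])
  have S: "\<phi> \<in> Sobolev 2 0 1"
  proof -
    have "\<exists>h\<in>L2 0 1. has_weak_deriv 0 1 n \<phi> h" if "n \<le> 2" for n
    proof -
      consider "n = 0" | "n = 1" | "n = 2" using \<open>n \<le> 2\<close> by linarith
      then show ?thesis by cases (use L w1 w2 has_weak_deriv_0[of 0 1 \<phi>] in blast)+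
    qed
    then show ?thesis using L by (simp add: Sobolev_def)
  qed
  have e1: "AE x in I01. weak_deriv 0 1 1 \<phi> x = f1 x" and e2: "AE x in I01. weak_deriv 0 1 2 \<phi> x = f2 x"
    using weak_deriv_eqI[OF L(2) w1] weak_deriv_eqI[OF L(3) w2] cls_eq_iff L by auto
  have t1: "trace 0 1 \<phi> 1 = 0"
    using trace_eqI[OF \<phi>c, of \<phi> 1] by (simp add: \<phi>_def)
  have "trace 0 1 (flux a \<phi>) 0 = H 0"
  proof (rule trace_eqI[OF Hc])
    show "AE x in I01. H x = flux a \<phi> x"
      using e1 AE_I01_space by eventually_elim (simp add: flux_def f1_def powr_minus)
  qed simp
  then have t0: "trace 0 1 (flux a \<phi>) 0 = 0" using Hz D by simp
  have "cls (Aop \<phi>) = cls h"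
  proof (rule cls_eqI[OF Sobolev_2_structure(1)[OF S] test_function_L2[OF h]])
    show "AE x in I01. Aop \<phi> x = h x"
      using e1 e2 AE_I01_space
    proof eventually_elim
      case (elim x)
      then have x: "0 < x" by simp
      have p1: "x powr (a - 1) * x powr (- a) = x powr (- 1)" "x powr a * x powr (- a - 1) = x powr (- 1)"
        "x powr a * x powr (- a) = 1" using x by (simp_all add: powr_add[symmetric])
      have "Aop \<phi> x = a * (x powr (a - 1) * f1 x) + x powr a * f2 x" using elim by (simp add: Aop_def Lf_def)
      also have "\<dots> = a * ((x powr (a - 1) * x powr (- a)) * H x) - a * ((x powr a * x powr (- a - 1)) * H x)
          + (x powr a * x powr (- a)) * D 0 x"
        unfolding f1_def f2_def by (simp add: algebra_simps)
      finally show ?case unfolding p1 by (simp add: D(5))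
    qed
  qed
  then show thesis using that S t0 t1 by blast
qed

end

section \<open>Weak solutions\<close>

lemma integral_Icc_continuous:
  fixes f :: "real \<Rightarrow> real"
  assumes "continuous_on {a..b} f"
  shows "(LINT x|lebesgue_on {a..b}. f x) = integral {a..b} f"
  by (intro lebesgue_integral_eq_integral absolutely_integrable_imp_integrable absolutely_integrable_continuous_real assms) simp_all

lemma C0_into_continuous:
  assumes "f \<in> C0_into I (L2 0 1) (L2_norm 0 1)"
  shows "continuous_on I (\<lambda>t. cls (f t))"
  unfolding continuous_on_def
proof
  fix t0 assume t0: "t0 \<in> I"
  have L: "\<And>t. t \<in> I \<Longrightarrow> f t \<in> L2 0 1"
    and lim: "((\<lambda>t. L2_norm 0 1 (\<lambda>x. f t x - f t0 x)) \<longlongrightarrow> 0) (at t0 within I)"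
    using assms t0 by (auto simp: C0_into_def)
  have "((\<lambda>t. cls (f t) - cls (f t0)) \<longlongrightarrow> 0) (at t0 within I)"
  proof (rule Lim_null_comparison[OF _ lim])
    have "norm (cls (f t) - cls (f t0)) \<le> L2_norm 0 1 (\<lambda>x. f t x - f t0 x)" if "t \<in> I" for t
      unfolding cls_diff[OF L[OF that] L[OF t0], symmetric] norm_cls[OF L2_diff[OF L[OF that] L[OF t0]]] ..
    then show "\<forall>\<^sub>F t in at t0 within I. norm (cls (f t) - cls (f t0)) \<le> L2_norm 0 1 (\<lambda>x. f t x - f t0 x)"
      unfolding eventually_at_filter by (intro always_eventually allI impI)
  qed
  then show "((\<lambda>t. cls (f t)) \<longlongrightarrow> cls (f t0)) (at t0 within I)" by (rule LIM_zero_cancel)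
qed

lemma C0_into_rep:
  assumes "continuous_on I F"
  shows "(\<lambda>t. rep (F t)) \<in> C0_into I (L2 0 1) (L2_norm 0 1)"
  unfolding C0_into_def
proof (intro CollectI conjI ballI rep_L2)
  fix t0 assume "t0 \<in> I"
  then have "((\<lambda>t. norm (F t - F t0)) \<longlongrightarrow> 0) (at t0 within I)"
    using assms unfolding continuous_on_def by (intro tendsto_norm_zero LIM_zero) auto
  moreover have "L2_norm 0 1 (\<lambda>x. rep (F t) x - rep (F t0) x) = norm (F t - F t0)" for t
    unfolding norm_cls[OF L2_diff[OF rep_L2 rep_L2], symmetric] cls_diff[OF rep_L2 rep_L2] cls_rep ..
  ultimately show "((\<lambda>t. L2_norm 0 1 (\<lambda>x. rep (F t) x - rep (F t0) x)) \<longlongrightarrow> 0) (at t0 within I)" by simp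
qed

lemma C1_L2_deriv_has_vector_derivative:
  assumes "C1_L2_deriv I 0 1 \<psi> \<psi>t" and t0: "t0 \<in> I"
  shows "((\<lambda>t. cls (\<psi> t)) has_vector_derivative cls (\<psi>t t0)) (at t0 within I)"
proof -
  have L: "\<And>t. t \<in> I \<Longrightarrow> \<psi> t \<in> L2 0 1" "\<And>t. t \<in> I \<Longrightarrow> \<psi>t t \<in> L2 0 1"
    and lim: "((\<lambda>t. L2_norm 0 1 (\<lambda>x. (\<psi> t x - \<psi> t0 x) / (t - t0) - \<psi>t t0 x)) \<longlongrightarrow> 0) (at t0 within I)"
    using assms by (auto simp: C1_L2_deriv_def C0_into_def)
  have e: "L2_norm 0 1 (\<lambda>x. (\<psi> t x - \<psi> t0 x) / (t - t0) - \<psi>t t0 x)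
      = norm (cls (\<psi> t) - cls (\<psi> t0) - (t - t0) *\<^sub>R cls (\<psi>t t0)) / norm (t - t0)"
    if t: "t \<noteq> t0" "t \<in> I" for t
  proof -
    note d = L2_diff[OF L(1)[OF t(2)] L(1)[OF t0]]
    have d': "(\<lambda>x. (\<psi> t x - \<psi> t0 x) / (t - t0)) \<in> L2 0 1"
      using L2_cmult[OF d, of "1 / (t - t0)"] by simp
    have "cls (\<lambda>x. (\<psi> t x - \<psi> t0 x) / (t - t0)) = (1 / (t - t0)) *\<^sub>R (cls (\<psi> t) - cls (\<psi> t0))"
      using cls_cmult[OF d, of "1 / (t - t0)"] cls_diff[OF L(1)[OF t(2)] L(1)[OF t0]] by simp
    then have "L2_norm 0 1 (\<lambda>x. (\<psi> t x - \<psi> t0 x) / (t - t0) - \<psi>t t0 x)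
      = norm ((1 / (t - t0)) *\<^sub>R (cls (\<psi> t) - cls (\<psi> t0)) - cls (\<psi>t t0))"
      unfolding norm_cls[OF L2_diff[OF d' L(2)[OF t0]], symmetric] cls_diff[OF d' L(2)[OF t0]] by simp
    also have "(1 / (t - t0)) *\<^sub>R (cls (\<psi> t) - cls (\<psi> t0)) - cls (\<psi>t t0)
      = (1 / (t - t0)) *\<^sub>R (cls (\<psi> t) - cls (\<psi> t0) - (t - t0) *\<^sub>R cls (\<psi>t t0))"
      using t by (simp add: scaleR_diff_right)
    finally show ?thesis by (simp add: abs_divide)
  qed
  show ?thesis
    unfolding has_vector_derivative_def has_derivative_iff_norm
  proof (intro conjI bounded_linear_scaleR_left)
    have "\<forall>\<^sub>F t in at t0 within I. L2_norm 0 1 (\<lambda>x. (\<psi> t x - \<psi> t0 x) / (t - t0) - \<psi>t t0 x)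
      = norm (cls (\<psi> t) - cls (\<psi> t0) - (t - t0) *\<^sub>R cls (\<psi>t t0)) / norm (t - t0)"
      unfolding eventually_at_filter by (intro always_eventually allI impI e)
    then show "((\<lambda>t. norm (cls (\<psi> t) - cls (\<psi> t0) - (t - t0) *\<^sub>R cls (\<psi>t t0)) / norm (t - t0)) \<longlongrightarrow> 0) (at t0 within I)"
      by (rule Lim_transform_eventually[OF lim])
  qed
qed

lemma C1_Sobolev:
  assumes ab: "a \<le> b" and d: "\<And>x. x \<in> {a..b} \<Longrightarrow> (g has_real_derivative h x) (at x within {a..b})"
    and h: "continuous_on {a..b} h"
  shows "g \<in> Sobolev 1 a b"
proof -
  have g: "continuous_on {a..b} g" using d by (meson DERIV_continuous continuous_on_eq_continuous_within)
  have "\<exists>k\<in>L2 a b. has_weak_deriv a b n g k" if "n \<le> 1" for n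
  proof (cases "n = 0")
    case True
    then show ?thesis using has_weak_deriv_0 continuous_L2[OF g] by blast
  next
    case False
    then have "n = 1" using that by simp
    then show ?thesis using has_weak_deriv_C1[OF ab d h] continuous_L2[OF h] by blast
  qed
  then show ?thesis using continuous_L2[OF g] by (simp add: Sobolev_def)
qed

context degenerate begin

text \<open>After scaling by 2 - a the form bounds give a positive contraction, whose norm bound
  comes from the Bernstein argument.\<close>

lemma bounded_linear_G: "bounded_linear G"
proof -
  have "linear (\<lambda>x. (2 - a) *\<^sub>R G x)" by (rule linear_compose_scale_right[OF linear_G])
  moreover have "((2 - a) *\<^sub>R G x) \<bullet> y = x \<bullet> ((2 - a) *\<^sub>R G y)" for x y using G_sym[of x y] by simp
  moreover have "0 \<le> ((2 - a) *\<^sub>R G x) \<bullet> x" for x using G_nonneg[of x] a2 by simp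
  moreover have "((2 - a) *\<^sub>R G x) \<bullet> x \<le> x \<bullet> x" for x using G_le[of x] by simp
  ultimately have "positive_contraction (\<lambda>x. (2 - a) *\<^sub>R G x)" by (rule positive_contraction.intro)
  then have "bounded_linear (\<lambda>x. (2 - a) *\<^sub>R G x)" by (rule positive_contraction.bounded_linear_B)
  from bounded_linear_compose[OF bounded_linear_scaleR_right this, of "1 / (2 - a)"]
  show ?thesis using a2 by simp
qed

text \<open>Differentiate the pairing of F and \<psi>. Writing \<psi> = - G (A \<psi>) and moving G
  to F' by symmetry, the equation replaces G F' by U - F, so that all x-derivatives fall on \<psi>.
  The remaining term \<open>U t * (ind 1 \<bullet> A t)\<close> is the boundary term with
  \<psi>'(1).\<close>

lemma weak_solution_of_evolution:
  assumes T: "0 < T" and F: "continuous_on {0..T} F" and F0: "F 0 = cls f0" and f0: "f0 \<in> L2 0 1"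
    and Fd: "\<And>t. 0 < t \<Longrightarrow> t \<le> T \<Longrightarrow> (F has_vector_derivative Fd t) (at t within {0..T})"
    and eq: "\<And>t. 0 < t \<Longrightarrow> t \<le> T \<Longrightarrow> F t = U t *\<^sub>R ind 1 - G (Fd t)"
    and U: "U \<in> Sobolev 1 0 T" "continuous_on {0..T} U"
  shows "weak_solution a T f0 U (\<lambda>t. rep (F t))"
  unfolding weak_solution_def
proof (intro conjI ballI allI impI f0 U C0_into_rep F)
  fix t' \<psi> \<psi>t
  assume t': "t' \<in> {0..T}"
  assume H: "C1_L2_deriv {0..t'} 0 1 \<psi> \<psi>t \<and>
        \<psi> \<in> C0_into {0..t'} (Sobolev 2 0 1) (Sobolev_norm 2 0 1) \<and>
        (\<forall>t\<in>{0..t'}. trace 0 1 (flux a (\<psi> t)) 0 = 0 \<and> trace 0 1 (\<psi> t) 1 = 0)"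
  have sub: "{0..t'} \<subseteq> {0..T}" using t' by auto
  have C1: "C1_L2_deriv {0..t'} 0 1 \<psi> \<psi>t" and C0: "\<psi> \<in> C0_into {0..t'} (Sobolev 2 0 1) (Sobolev_norm 2 0 1)"
    and tr: "\<And>t. t \<in> {0..t'} \<Longrightarrow> trace 0 1 (\<psi> t) 1 = 0" using H by auto
  have \<psi>L: "\<psi> t \<in> L2 0 1" "\<psi>t t \<in> L2 0 1" "\<psi> t \<in> Sobolev 2 0 1" if "t \<in> {0..t'}" for t
    using C1 C0 that by (auto simp: C1_L2_deriv_def C0_into_def)
  define A where "A t = cls (Aop (\<psi> t))" for t
  have A: "continuous_on {0..t'} A" unfolding A_def by (rule continuous_on_Aop[OF C0])
  have \<psi>A: "cls (\<psi> t) = - G (A t)" if "t \<in> {0..t'}" for t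
    unfolding A_def by (rule Sobolev_2_structure(5)[OF \<psi>L(3)[OF that] tr[OF that]])
  have \<psi>c: "continuous_on {0..t'} (\<lambda>t. cls (\<psi> t))" "continuous_on {0..t'} (\<lambda>t. cls (\<psi>t t))"
    using C1 by (auto simp: C1_L2_deriv_def intro: C0_into_continuous)
  have Fc: "continuous_on {0..t'} F" and Uc: "continuous_on {0..t'} U"
    using continuous_on_subset[OF F sub] continuous_on_subset[OF U(2) sub] by auto
  define k where "k t = F t \<bullet> (cls (\<psi>t t) + A t) - U t * (ind 1 \<bullet> A t)" for t
  have "((\<lambda>t. F t \<bullet> cls (\<psi> t)) has_vector_derivative k t) (at t)" if t: "t \<in> {0<..<t'}" for t
  proof -
    have "at t within {0..T} = at t" "at t within {0..t'} = at t"
      using t t' by (auto intro!: at_within_Icc_at)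
    then have d: "(F has_vector_derivative Fd t) (at t)" "((\<lambda>t. cls (\<psi> t)) has_vector_derivative cls (\<psi>t t)) (at t)"
      using Fd[of t] C1_L2_deriv_has_vector_derivative[OF C1, of t] t t' by auto
    have "((\<lambda>t. F t \<bullet> cls (\<psi> t)) has_vector_derivative F t \<bullet> cls (\<psi>t t) + Fd t \<bullet> cls (\<psi> t)) (at t)"
      by (rule bounded_bilinear.has_vector_derivative[OF bounded_bilinear_inner d])
    moreover have "Fd t \<bullet> cls (\<psi> t) = F t \<bullet> A t - U t * (ind 1 \<bullet> A t)"
    proof -
      have "Fd t \<bullet> cls (\<psi> t) = - (G (Fd t) \<bullet> A t)" using t by (simp add: \<psi>A G_sym)
      also have "G (Fd t) = U t *\<^sub>R ind 1 - F t" using eq[of t] t t' by simp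
      finally show ?thesis by (simp add: inner_diff_left)
    qed
    ultimately show ?thesis by (simp add: k_def inner_add_right add_diff_eq)
  qed
  \<comment> \<open>F is differentiable only for t > 0; with continuity at 0 the fundamental theorem
    still holds on the closed interval.\<close>
  then have FTC: "(k has_integral F t' \<bullet> cls (\<psi> t') - F 0 \<bullet> cls (\<psi> 0)) {0..t'}"
    using t' by (intro fundamental_theorem_of_calculus_interior continuous_intros Fc \<psi>c) auto
  have i1: "(LINT t|lebesgue_on {0..t'}. LINT x|I01. rep (F t) x * (\<psi>t t x + weak_deriv 0 1 1 (flux a (\<psi> t)) x))
      = integral {0..t'} (\<lambda>t. F t \<bullet> (cls (\<psi>t t) + A t))"
  proof -
    have "(LINT x|I01. rep (F t) x * (\<psi>t t x + weak_deriv 0 1 1 (flux a (\<psi> t)) x)) = F t \<bullet> (cls (\<psi>t t) + A t)"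
      if t: "t \<in> {0..t'}" for t
    proof -
      note s = Sobolev_2_structure(2,3)[OF \<psi>L(3)[OF t]]
      have "(LINT x|I01. rep (F t) x * (\<psi>t t x + weak_deriv 0 1 1 (flux a (\<psi> t)) x))
        = cls (rep (F t)) \<bullet> cls (\<lambda>x. \<psi>t t x + weak_deriv 0 1 1 (flux a (\<psi> t)) x)"
        by (rule inner_cls[symmetric, OF rep_L2 L2_add[OF \<psi>L(2)[OF t] s(1)]])
      then show ?thesis unfolding cls_add[OF \<psi>L(2)[OF t] s(1)] s(2) cls_rep A_def .
    qed
    then have "(LINT t|lebesgue_on {0..t'}. LINT x|I01. rep (F t) x * (\<psi>t t x + weak_deriv 0 1 1 (flux a (\<psi> t)) x))
      = (LINT t|lebesgue_on {0..t'}. F t \<bullet> (cls (\<psi>t t) + A t))"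
      by (intro Bochner_Integration.integral_cong) auto
    also have "\<dots> = integral {0..t'} (\<lambda>t. F t \<bullet> (cls (\<psi>t t) + A t))"
      by (intro integral_Icc_continuous continuous_intros Fc \<psi>c A)
    finally show ?thesis .
  qed
  have i2: "(LINT t|lebesgue_on {0..t'}. U t * trace 0 1 (weak_deriv 0 1 1 (\<psi> t)) 1)
      = integral {0..t'} (\<lambda>t. U t * (ind 1 \<bullet> A t))"
  proof -
    have "(LINT t|lebesgue_on {0..t'}. U t * trace 0 1 (weak_deriv 0 1 1 (\<psi> t)) 1)
      = (LINT t|lebesgue_on {0..t'}. U t * (ind 1 \<bullet> A t))"
      by (intro Bochner_Integration.integral_cong) (auto simp: A_def Sobolev_2_structure(4)[OF \<psi>L(3), unfolded One_nat_def])
    also have "\<dots> = integral {0..t'} (\<lambda>t. U t * (ind 1 \<bullet> A t))"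
      by (intro integral_Icc_continuous continuous_intros Uc A)
    finally show ?thesis .
  qed
  have i3: "(LINT x|I01. rep (F t') x * \<psi> t' x) = F t' \<bullet> cls (\<psi> t')"
    using inner_cls[OF rep_L2[of "F t'"] \<psi>L(1)[of t']] t' by (simp add: cls_rep)
  have i4: "(LINT x|I01. f0 x * \<psi> 0 x) = F 0 \<bullet> cls (\<psi> 0)"
    using inner_cls[OF f0 \<psi>L(1)[of 0]] t' by (simp add: F0)
  have "integral {0..t'} k = integral {0..t'} (\<lambda>t. F t \<bullet> (cls (\<psi>t t) + A t)) - integral {0..t'} (\<lambda>t. U t * (ind 1 \<bullet> A t))"
    unfolding k_def
    by (intro Henstock_Kurzweil_Integration.integral_diff integrable_continuous_interval continuous_intros Fc \<psi>c A Uc)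
  then show "(LINT t|lebesgue_on {0..t'}. LINT x|I01. rep (F t) x * (\<psi>t t x + weak_deriv 0 1 1 (flux a (\<psi> t)) x)) =
        (LINT x|I01. rep (F t') x * \<psi> t' x) - (LINT x|I01. f0 x * \<psi> 0 x) +
        (LINT t|lebesgue_on {0..t'}. U t * trace 0 1 (weak_deriv 0 1 1 (\<psi> t)) 1)"
    unfolding i1 i2 i3 i4 using integral_unique[OF FTC] by linarith
qed

text \<open>For a test function constant in time, the terms with \<open>f0\<close> and
  \<open>u\<close> are common to any two solutions and cancel in their difference.\<close>

lemma weak_solution_stationary:
  assumes f: "weak_solution a T f0 u f" and t': "t' \<in> {0..T}"
    and \<phi>: "\<phi> \<in> Sobolev 2 0 1" "trace 0 1 (flux a \<phi>) 0 = 0" "trace 0 1 \<phi> 1 = 0"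
  shows "integral {0..t'} (\<lambda>t. cls (f t) \<bullet> cls (Aop \<phi>)) = cls (f t') \<bullet> cls \<phi> - (LINT x|I01. f0 x * \<phi> x)
    + (LINT t|lebesgue_on {0..t'}. u t * trace 0 1 (weak_deriv 0 1 1 \<phi>) 1)"
proof -
  have fC: "f \<in> C0_into {0..T} (L2 0 1) (L2_norm 0 1)" using f by (simp add: weak_solution_def)
  then have fL: "\<And>t. t \<in> {0..T} \<Longrightarrow> f t \<in> L2 0 1" by (simp add: C0_into_def)
  have sub: "{0..t'} \<subseteq> {0..T}" using t' by auto
  have fc: "continuous_on {0..t'} (\<lambda>t. cls (f t))" by (rule continuous_on_subset[OF C0_into_continuous[OF fC] sub])
  have \<phi>L: "\<phi> \<in> L2 0 1" by (rule Sobolev_2_weak_deriv(1)[OF \<phi>(1)])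
  have z: "L2_norm 0 1 (\<lambda>x. 0) = 0" by (simp add: L2_norm_def)
  have "Sobolev_norm 2 0 1 (\<lambda>x. \<phi> x - \<phi> x) = 0"
  proof -
    have "L2_norm 0 1 (weak_deriv 0 1 n (\<lambda>x. \<phi> x - \<phi> x)) = 0" if "n \<le> 2" for n
      using norm_cls[OF cls_weak_deriv_diff(1)[OF \<phi>(1) \<phi>(1) that]]
      unfolding cls_weak_deriv_diff(2)[OF \<phi>(1) \<phi>(1) that] by simp
    then show ?thesis unfolding Sobolev_norm_def by simp
  qed
  then have s: "(\<lambda>_. \<phi>) \<in> C0_into {0..t'} (Sobolev 2 0 1) (Sobolev_norm 2 0 1)"
    using \<phi>(1) by (simp add: C0_into_def)
  have c: "C1_L2_deriv {0..t'} 0 1 (\<lambda>_. \<phi>) (\<lambda>_ _. 0)"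
    using \<phi>L z by (simp add: C1_L2_deriv_def C0_into_def L2_const)
  have id: "(LINT t|lebesgue_on {0..t'}. LINT x|I01. f t x * (0 + weak_deriv 0 1 1 (flux a \<phi>) x)) =
        (LINT x|I01. f t' x * \<phi> x) - (LINT x|I01. f0 x * \<phi> x) +
        (LINT t|lebesgue_on {0..t'}. u t * trace 0 1 (weak_deriv 0 1 1 \<phi>) 1)"
  proof -
    have all: "\<forall>t'\<in>{0..T}. \<forall>\<psi> \<psi>t.
        C1_L2_deriv {0..t'} 0 1 \<psi> \<psi>t \<and>
        \<psi> \<in> C0_into {0..t'} (Sobolev 2 0 1) (Sobolev_norm 2 0 1) \<and>
        (\<forall>t\<in>{0..t'}. trace 0 1 (flux a (\<psi> t)) 0 = 0 \<and> trace 0 1 (\<psi> t) 1 = 0) \<longrightarrow>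
        (LINT t|lebesgue_on {0..t'}. LINT x|I01. f t x * (\<psi>t t x + weak_deriv 0 1 1 (flux a (\<psi> t)) x)) =
        (LINT x|I01. f t' x * \<psi> t' x) - (LINT x|I01. f0 x * \<psi> 0 x) +
        (LINT t|lebesgue_on {0..t'}. u t * trace 0 1 (weak_deriv 0 1 1 (\<psi> t)) 1)"
      using f unfolding weak_solution_def by (elim conjE)
    show ?thesis
      by (rule mp[OF spec[OF spec[OF bspec[OF all t'], of "\<lambda>_. \<phi>"], of "\<lambda>_ _. 0"]]) (intro conjI ballI c s \<phi>)
  qed
  note st = Sobolev_2_structure(2,3)[OF \<phi>(1)]
  have "(LINT t|lebesgue_on {0..t'}. LINT x|I01. f t x * (0 + weak_deriv 0 1 1 (flux a \<phi>) x))
     = (LINT t|lebesgue_on {0..t'}. cls (f t) \<bullet> cls (Aop \<phi>))"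
  proof (rule Bochner_Integration.integral_cong[OF refl])
    fix t assume "t \<in> space (lebesgue_on {0..t'})"
    then have "t \<in> {0..T}" using t' by auto
    from inner_cls[OF fL[OF this] st(1)]
    show "(LINT x|I01. f t x * (0 + weak_deriv 0 1 1 (flux a \<phi>) x)) = cls (f t) \<bullet> cls (Aop \<phi>)"
      unfolding st(2) add_0_left by (rule sym)
  qed
  also have "\<dots> = integral {0..t'} (\<lambda>t. cls (f t) \<bullet> cls (Aop \<phi>))"
    by (intro integral_Icc_continuous continuous_intros fc)
  finally show ?thesis unfolding id inner_cls[OF fL[OF t'] \<phi>L] by (rule sym)
qed

text \<open>Energy argument: the difference \<open>E\<close> of two solutions has a primitive \<open>m\<close> with
  \<open>G E = - m\<close>, so \<open>m \<bullet> G m\<close> is nonnegative, starts at zero and has derivative \<open>- 2 m \<bullet> m\<close>.\<close>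

lemma weak_solution_unique:
  assumes T: "0 < T" and f: "weak_solution a T f0 u f" and g: "weak_solution a T f0 u g"
  shows "AE x in I01. f T x = g T x"
proof -
  have C: "f \<in> C0_into {0..T} (L2 0 1) (L2_norm 0 1)" "g \<in> C0_into {0..T} (L2 0 1) (L2_norm 0 1)"
    using f g by (auto simp: weak_solution_def)
  define E where "E t = cls (f t) - cls (g t)" for t
  have cf: "continuous_on {0..T} (\<lambda>t. cls (f t))" and cg: "continuous_on {0..T} (\<lambda>t. cls (g t))"
    by (rule C0_into_continuous[OF C(1)], rule C0_into_continuous[OF C(2)])
  have Ec: "continuous_on {0..T} E" unfolding E_def by (intro continuous_intros cf cg)
  define m where "m t = integral {0..t} E" for t
  have Gm: "G (E t') = - m t'" if t': "t' \<in> {0..T}" for t'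
  proof -
    have sub: "{0..t'} \<subseteq> {0..T}" using t' by auto
    note cont = continuous_on_subset[OF cf sub] continuous_on_subset[OF cg sub] continuous_on_subset[OF Ec sub]
    have key: "(G (E t') + m t') \<bullet> cls h = 0" if h: "h \<in> test_functions 0 1" for h
    proof -
      obtain \<phi> where \<phi>: "\<phi> \<in> Sobolev 2 0 1" "trace 0 1 (flux a \<phi>) 0 = 0" "trace 0 1 \<phi> 1 = 0" "cls (Aop \<phi>) = cls h"
        using stationary_test_function[OF h] by metis
      have "integral {0..t'} (\<lambda>t. E t \<bullet> cls h)
        = integral {0..t'} (\<lambda>t. cls (f t) \<bullet> cls (Aop \<phi>)) - integral {0..t'} (\<lambda>t. cls (g t) \<bullet> cls (Aop \<phi>))"
        unfolding E_def \<phi>(4) inner_diff_left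
        by (intro Henstock_Kurzweil_Integration.integral_diff integrable_continuous_interval continuous_intros cont)
      also have "\<dots> = E t' \<bullet> cls \<phi>"
        unfolding weak_solution_stationary[OF f t' \<phi>(1-3)] weak_solution_stationary[OF g t' \<phi>(1-3)]
        by (simp add: E_def inner_diff_left)
      also have "cls \<phi> = - G (cls h)" using Sobolev_2_structure(5)[OF \<phi>(1,3)] \<phi>(4) by simp
      finally have "integral {0..t'} (\<lambda>t. E t \<bullet> cls h) = - (G (E t') \<bullet> cls h)" by (simp add: G_sym)
      moreover have "integral {0..t'} (\<lambda>t. E t \<bullet> cls h) = m t' \<bullet> cls h"
        unfolding m_def
        using integral_linear[OF integrable_continuous_interval[OF cont(3)] bounded_linear_inner_left[of "cls h"]]
        by (simp add: o_def)
      ultimately show ?thesis by (simp add: inner_add_left)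
    qed
    have "AE x in I01. rep (G (E t') + m t') x = 0"
    proof (rule fundamental_lemma[OF rep_L2])
      fix h assume h: "h \<in> test_functions 0 1"
      show "(LINT x|I01. rep (G (E t') + m t') x * h x) = 0"
        using key[OF h] inner_cls[OF rep_L2 test_function_L2[OF h], of "G (E t') + m t'"] by (simp add: cls_rep)
    qed
    then have "G (E t') + m t' = 0"
      unfolding l2_eq_iff using rep_zero by eventually_elim simp
    then show ?thesis by (simp add: eq_neg_iff_add_eq_0)
  qed
  have md: "(m has_vector_derivative E t) (at t within {0..T})" if "t \<in> {0..T}" for t
    unfolding m_def by (rule integral_has_vector_derivative[OF Ec that])
  have mc: "continuous_on {0..T} m"
    using md by (meson continuous_on_eq_continuous_within has_vector_derivative_continuous)
  define q where "q t = m t \<bullet> G (m t)" for t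
  have qd: "(q has_vector_derivative - 2 * (m t \<bullet> m t)) (at t within {0..T})" if t: "t \<in> {0..T}" for t
  proof -
    have "((\<lambda>t. G (m t)) has_vector_derivative G (E t)) (at t within {0..T})"
      by (rule bounded_linear.has_vector_derivative[OF bounded_linear_G md[OF t]])
    from bounded_bilinear.has_vector_derivative[OF bounded_bilinear_inner md[OF t] this]
    have "(q has_vector_derivative m t \<bullet> G (E t) + E t \<bullet> G (m t)) (at t within {0..T})" unfolding q_def .
    moreover have "m t \<bullet> G (E t) + E t \<bullet> G (m t) = - 2 * (m t \<bullet> m t)"
      using Gm[OF t] G_sym[of "E t" "m t"] by simp
    ultimately show ?thesis by simp
  qed
  have q0: "q t = 0" if t: "t \<in> {0..T}" for t
  proof -
    have "((\<lambda>t. - 2 * (m t \<bullet> m t)) has_integral (q t - q 0)) {0..t}"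
    proof (rule fundamental_theorem_of_calculus)
      fix x assume "x \<in> {0..t}"
      then show "(q has_vector_derivative - 2 * (m x \<bullet> m x)) (at x within {0..t})"
        using t by (intro has_vector_derivative_within_subset[OF qd]) auto
    qed (use t in simp)
    from has_integral_neg[OF this] have "0 \<le> - (q t - q 0)"
      by (rule has_integral_nonneg) simp
    moreover have "q 0 = 0" by (simp add: q_def m_def)
    moreover have "0 \<le> q t" using G_nonneg[of "m t"] by (simp add: q_def inner_commute)
    ultimately show ?thesis by simp
  qed
  have TT: "T \<in> {0..T}" using T by simp
  \<comment> \<open>As q vanishes identically, its derivative
    \<open>- 2 * (m T \<bullet> m T)\<close> is 0; hence m T = 0, and injectivity of G gives E T =
    0.\<close>
  have "(q has_vector_derivative 0) (at T within {0..T})"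
    by (rule has_vector_derivative_transform[OF TT, where f = "\<lambda>_. 0"]) (use q0 in auto)
  from vector_derivative_unique_within[OF Icc_within_ne_bot[OF T TT] qd[OF TT] this]
  have "m T = 0" by simp
  then have "G (E T) = 0" using Gm[OF TT] by simp
  then have "cls (f T) = cls (g T)" using G_inj[of "E T"] by (simp add: E_def)
  moreover have "f T \<in> L2 0 1" "g T \<in> L2 0 1" using C TT by (auto simp: C0_into_def)
  ultimately show ?thesis by (simp add: cls_eq_iff)
qed

end

section \<open>Series in the derivatives of the flat output\<close>

lemma deriv_family_eq_on_open:
  assumes D: "deriv_family S D" and E: "deriv_family S E" and V: "open V"
    and nb: "\<And>t. t \<in> S \<Longrightarrow> at t within S \<noteq> bot"
    and eq: "\<And>t. t \<in> S \<Longrightarrow> t \<in> V \<Longrightarrow> D 0 t = E 0 t" and t: "t \<in> S" "t \<in> V"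
  shows "D n t = E n t"
  using t
proof (induction n arbitrary: t)
  case 0 then show ?case using eq by blast
next
  case (Suc n)
  obtain e where e: "0 < e" "ball t e \<subseteq> V" using V Suc.prems open_contains_ball by blast
  have 1: "(D n has_vector_derivative D (Suc n) t) (at t within S)" "(E n has_vector_derivative E (Suc n) t) (at t within S)"
    using D E Suc.prems by (auto simp: deriv_family_def)
  have "(E n has_vector_derivative D (Suc n) t) (at t within S)"
    by (rule has_vector_derivative_transform_within[OF 1(1) e(1) Suc.prems(1)])
      (use Suc.IH e in \<open>auto simp: dist_commute subset_iff\<close>)
  then show ?case using vector_derivative_unique_within[OF nb[OF Suc.prems(1)] _ 1(2)] by blast
qed

text \<open>The ratio of consecutive terms is Q (k + 1)^(s - 2), which tends to 0 because s <
  2.\<close>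

lemma summable_power_fact_powr:
  fixes Q s :: real
  assumes Q: "0 < Q" and s: "s < 2"
  shows "summable (\<lambda>k. Q ^ k * fact k powr (s - 2))"
proof -
  have "((\<lambda>k. real (Suc k) powr (s - 2)) \<longlongrightarrow> 0) sequentially"
    using s by (intro tendsto_neg_powr filterlim_compose[OF filterlim_real_sequentially filterlim_Suc]) auto
  then have "((\<lambda>k. Q * real (Suc k) powr (s - 2)) \<longlongrightarrow> 0) sequentially" by (rule tendsto_mult_right_zero)
  then have "\<forall>\<^sub>F k in sequentially. Q * real (Suc k) powr (s - 2) < 1/2"
    by (rule order_tendstoD) simp
  then obtain N where N: "\<And>k. N \<le> k \<Longrightarrow> Q * real (Suc k) powr (s - 2) < 1/2"
    unfolding eventually_sequentially by blast
  show ?thesis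
  proof (rule summable_ratio_test[where c = "1/2" and N = N])
    fix k assume k: "N \<le> k"
    have "norm (Q ^ Suc k * fact (Suc k) powr (s - 2)) = (Q * real (Suc k) powr (s - 2)) * (Q ^ k * fact k powr (s - 2))"
      using Q by (simp add: powr_mult abs_mult)
    also have "\<dots> \<le> 1/2 * (Q ^ k * fact k powr (s - 2))"
      using N[OF k] Q by (intro mult_right_mono) auto
    finally show "norm (Q ^ Suc k * fact (Suc k) powr (s - 2)) \<le> 1/2 * norm (Q ^ k * fact k powr (s - 2))"
      using Q by (simp add: abs_mult)
  qed simp
qed

text \<open>For \<open>s < 2\<close> the double factorial decay of the coefficients beats the Gevrey growth of the derivatives.\<close>

lemma gevrey_series:
  fixes c :: "nat \<Rightarrow> 'b::banach"
  assumes S: "convex S" and Y: "deriv_family S Y" and gb: "gevrey_bound s S Y" and s: "0 \<le> s" "s < 2"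
    and d: "0 < d" and c: "\<And>k. norm (c k) \<le> 1 / (d ^ (2 * k) * (fact k * fact k))"
  obtains W where "\<And>n t. t \<in> S \<Longrightarrow> (\<lambda>k. Y (n + k) t *\<^sub>R c k) sums W n t"
    "\<And>n t. t \<in> S \<Longrightarrow> (W n has_vector_derivative W (Suc n) t) (at t within S)"
    "\<exists>M>0. \<exists>R>0. \<forall>n. \<forall>t\<in>S. norm (W n t) \<le> M * fact n powr s / R ^ n"
proof -
  obtain M R where MR: "0 < M" "0 < R" "\<And>n t. t \<in> S \<Longrightarrow> \<bar>Y n t\<bar> \<le> M * fact n powr s / R ^ n"
    using gb unfolding gevrey_bound_def by blast
  \<comment> \<open>By \<open>fact_add_le\<close>, the power s of (n + k)! splits into a factor in n
    and one in k, each with a geometric loss. The factors in k collect in \<open>r k\<close>, those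
    in n in \<open>C n\<close>: the bound is uniform in t, and the sum is Gevrey with radius R /
    2^s.\<close>
  define Q where "Q = 2 powr s / (R * d\<^sup>2)"
  have Q: "0 < Q" using MR d by (simp add: Q_def)
  define r where "r k = Q ^ k * fact k powr (s - 2)" for k
  have r: "summable r" unfolding r_def by (rule summable_power_fact_powr[OF Q s(2)])
  have r0: "0 \<le> r k" for k using Q by (simp add: r_def)
  define C where "C n = M * fact n powr s / (R / 2 powr s) ^ n" for n :: nat
  have C0: "0 \<le> C n" for n using MR by (simp add: C_def)
  have b: "norm (Y (n + k) t *\<^sub>R c k) \<le> C n * r k" if t: "t \<in> S" for n k t
  proof -
    have f: "fact (n + k) powr s \<le> (2 powr s) ^ n * (2 powr s) ^ k * (fact n powr s * fact k powr s)"
    proof -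
      have "(fact (n + k) :: real) powr s \<le> (2 ^ (n + k) * fact n * fact k) powr s"
        using s fact_add_le[of n k] by (intro powr_mono2) auto
      also have "\<dots> = (2 ^ (n + k)) powr s * (fact n powr s * fact k powr s)"
        by (simp add: powr_mult)
      also have "((2::real) ^ (n + k)) powr s = (2 powr s) ^ n * (2 powr s) ^ k"
        by (simp add: powr_realpow[symmetric] powr_powr powr_add[symmetric] mult.commute algebra_simps)
      finally show ?thesis .
    qed
    have "norm (Y (n + k) t *\<^sub>R c k) \<le> (M * fact (n + k) powr s / R ^ (n + k)) * (1 / (d ^ (2 * k) * (fact k * fact k)))"
      unfolding norm_scaleR using MR t c by (intro mult_mono) auto
    also have "\<dots> \<le> (M * ((2 powr s) ^ n * (2 powr s) ^ k * (fact n powr s * fact k powr s)) / R ^ (n + k)) * (1 / (d ^ (2 * k) * (fact k * fact k)))"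
      using MR d f by (intro mult_right_mono divide_right_mono mult_left_mono) auto
    also have "\<dots> = C n * (Q ^ k * (fact k powr s / (fact k * fact k)))"
      unfolding C_def Q_def power_mult[of d] by (simp add: power_add power_divide power_mult_distrib mult_ac)
    also have "fact k powr s / (fact k * fact k :: real) = fact k powr (s - 2)"
      by (simp add: powr_diff powr_numeral power2_eq_square)
    finally show ?thesis by (simp add: r_def)
  qed
  have sm: "summable (\<lambda>k. C n * r k)" for n by (rule summable_mult[OF r])
  have sn: "summable (\<lambda>k. norm (Y (n + k) t *\<^sub>R c k))" if "t \<in> S" for n t
    by (rule summable_comparison_test'[OF sm[of n], of 0]) (use b[OF that] in simp)
  define W where "W n t = (\<Sum>k. Y (n + k) t *\<^sub>R c k)" for n t
  have W: "(\<lambda>k. Y (n + k) t *\<^sub>R c k) sums W n t" if "t \<in> S" for n t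
    unfolding W_def by (rule summable_sums[OF summable_norm_cancel[OF sn[OF that]]])
  have Wd: "(W n has_vector_derivative W (Suc n) t) (at t within S)" if t: "t \<in> S" for n t
  proof -
    have ul: "uniform_limit S (\<lambda>N t. \<Sum>k<N. Y (Suc n + k) t *\<^sub>R c k) (W (Suc n)) sequentially"
      unfolding W_def by (rule Weierstrass_m_test[OF b sm])
    have "\<exists>g. \<forall>x\<in>S. (\<lambda>k. Y (n + k) x *\<^sub>R c k) sums g x \<and> (g has_derivative (\<lambda>h. h *\<^sub>R W (Suc n) x)) (at x within S)"
    proof (rule has_derivative_series[where f = "\<lambda>k t. Y (n + k) t *\<^sub>R c k"
          and f' = "\<lambda>k x h. h *\<^sub>R Y (Suc n + k) x *\<^sub>R c k" and x = t and l = "W n t"])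
      show "convex S" by (rule S)
      show "t \<in> S" by (rule t)
      show "(\<lambda>k. Y (n + k) t *\<^sub>R c k) sums W n t" by (rule W[OF t])
    next
      fix k x assume x: "x \<in> S"
      have "(Y (n + k) has_vector_derivative Y (Suc n + k) x) (at x within S)"
        using Y x by (simp add: deriv_family_def)
      from bounded_linear.has_vector_derivative[OF bounded_linear_scaleR_left this]
      show "((\<lambda>t. Y (n + k) t *\<^sub>R c k) has_derivative (\<lambda>h. h *\<^sub>R Y (Suc n + k) x *\<^sub>R c k)) (at x within S)"
        by (simp add: has_vector_derivative_def)
    next
      fix e :: real assume e: "0 < e"
      have "\<forall>\<^sub>F N in sequentially. \<forall>x\<in>S. dist (\<Sum>k<N. Y (Suc n + k) x *\<^sub>R c k) (W (Suc n) x) < e"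
        using ul e unfolding uniform_limit_iff by blast
      then show "\<forall>\<^sub>F N in sequentially. \<forall>x\<in>S. \<forall>h. norm ((\<Sum>k<N. h *\<^sub>R Y (Suc n + k) x *\<^sub>R c k) - h *\<^sub>R W (Suc n) x) \<le> e * norm h"
      proof eventually_elim
        case (elim N)
        show ?case
        proof (intro ballI allI)
          fix x and h :: real assume x: "x \<in> S"
          have "norm ((\<Sum>k<N. h *\<^sub>R Y (Suc n + k) x *\<^sub>R c k) - h *\<^sub>R W (Suc n) x)
            = \<bar>h\<bar> * norm ((\<Sum>k<N. Y (Suc n + k) x *\<^sub>R c k) - W (Suc n) x)"
            unfolding scaleR_sum_right[symmetric] scaleR_diff_right[symmetric] norm_scaleR ..
          also have "\<dots> \<le> \<bar>h\<bar> * e" using elim x by (intro mult_left_mono) (auto simp: dist_norm less_imp_le)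
          finally show "norm ((\<Sum>k<N. h *\<^sub>R Y (Suc n + k) x *\<^sub>R c k) - h *\<^sub>R W (Suc n) x) \<le> e * norm h"
            by (simp add: mult.commute)
        qed
      qed
    qed
    then obtain g where g: "\<And>x. x \<in> S \<Longrightarrow> (\<lambda>k. Y (n + k) x *\<^sub>R c k) sums g x"
      "\<And>x. x \<in> S \<Longrightarrow> (g has_vector_derivative W (Suc n) x) (at x within S)"
      unfolding has_vector_derivative_def by blast
    show ?thesis
      by (rule has_vector_derivative_transform[OF t _ g(2)[OF t]]) (rule sums_unique2[OF W g(1)])
  qed
  have Wb: "norm (W n t) \<le> (suminf r * M + 1) * fact n powr s / (R / 2 powr s) ^ n" if t: "t \<in> S" for n t
  proof -
    have "norm (W n t) \<le> (\<Sum>k. norm (Y (n + k) t *\<^sub>R c k))" unfolding W_def by (rule summable_norm[OF sn[OF t]])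
    also have "\<dots> \<le> (\<Sum>k. C n * r k)" by (rule suminf_le[OF b[OF t] sn[OF t] sm])
    also have "\<dots> = C n * suminf r" by (rule suminf_mult[OF r])
    also have "\<dots> = (suminf r * M) * fact n powr s / (R / 2 powr s) ^ n" by (simp add: C_def)
    also have "\<dots> \<le> (suminf r * M + 1) * fact n powr s / (R / 2 powr s) ^ n"
      using MR by (intro divide_right_mono mult_right_mono) auto
    finally show ?thesis .
  qed
  have "0 < suminf r * M + 1" using suminf_nonneg[OF r r0] MR by (simp add: add_nonneg_pos)
  moreover have "0 < R / 2 powr s" using MR by simp
  ultimately have "\<exists>M>0. \<exists>R>0. \<forall>n. \<forall>t\<in>S. norm (W n t) \<le> M * fact n powr s / R ^ n" using Wb by blast
  then show thesis using that[OF W Wd] by blast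
qed

context degenerate begin

text \<open>Since \<open>G (PL k) = bk (k + 1) PL 0 - PL (k + 1)\<close>, a series in the \<open>PL k\<close> is determined by
  its value at \<open>1\<close> and by \<open>G\<close> of the shifted series.\<close>

lemma flat_series_identity:
  assumes w0: "(\<lambda>k. z k *\<^sub>R PL k) sums w0" and w1: "(\<lambda>k. z (Suc k) *\<^sub>R PL k) sums w1"
    and b: "(\<lambda>k. z k * bk k) sums \<beta>"
  shows "w0 = \<beta> *\<^sub>R PL 0 - G w1"
proof -
  have "(\<lambda>k. G (z (Suc k) *\<^sub>R PL k)) sums G w1" by (rule bounded_linear.sums[OF bounded_linear_G w1])
  then have 1: "(\<lambda>k. (z (Suc k) * bk (Suc k)) *\<^sub>R PL 0 - z (Suc k) *\<^sub>R PL (Suc k)) sums G w1"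
    by (simp add: linear_scale[OF linear_G] G_PL scaleR_diff_right)
  have 2: "(\<lambda>k. z (Suc k) *\<^sub>R PL (Suc k)) sums (w0 - z 0 *\<^sub>R PL 0)"
    using w0 by (subst sums_Suc_iff) simp
  have "(\<lambda>k. z (Suc k) * bk (Suc k)) sums (\<beta> - z 0 * bk 0)"
    using b by (subst sums_Suc_iff) simp
  from bounded_linear.sums[OF bounded_linear_scaleR_left this, of "PL 0"]
  have 3: "(\<lambda>k. (z (Suc k) * bk (Suc k)) *\<^sub>R PL 0) sums ((\<beta> - z 0) *\<^sub>R PL 0)" by (simp add: bk_0)
  have "G w1 = (\<beta> - z 0) *\<^sub>R PL 0 - (w0 - z 0 *\<^sub>R PL 0)"
    by (rule sums_unique2[OF 1 sums_diff[OF 3 2]])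
  then show ?thesis by (simp add: algebra_simps)
qed

lemma PL_0_eq: "PL 0 = ind 1"
  by (simp add: PL_0 ind_1)

lemma PL_0_nonzero: "PL 0 \<noteq> 0"
  using norm_one by (auto simp: PL_0)

end

lemma at_within_Icc_left:
  fixes t :: real
  assumes "p \<le> q" "q < t"
  shows "at t within {p..r} = at t within {q..r}"
  by (rule at_within_nhd[where S = "{q<..}"]) (use assms in auto)

theorem theorem1p3:
  fixes \<alpha> T \<tau> s :: real and f0 :: "real \<Rightarrow> real"
  assumes "1 \<le> \<alpha>" and "\<alpha> < 2"
    and "f0 \<in> L2 0 1"
    and "0 < T"
    and "0 < \<tau>" and "\<tau> < T"
    and "1 < s" and "s < 2"
  shows "\<exists>y\<in>gevrey s \<tau> T. \<exists>u.
           (\<forall>t\<in>{0..\<tau>}. u t = 0) \<and>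
           (\<forall>t\<in>{\<tau><..T}.
              (\<lambda>k. nth_deriv {\<tau>..T} k y t /
                     ((2 - \<alpha>) ^ (2 * k) * fact k * (\<Prod>j=1..k. real j + (\<alpha> - 1) / (2 - \<alpha>))))
              sums u t) \<and>
           (\<exists>f. weak_solution \<alpha> T f0 u f) \<and>
           (\<forall>f. weak_solution \<alpha> T f0 u f \<longrightarrow> (AE x in lebesgue_on {0<..<1}. f T x = 0)) \<and>
           u \<in> gevrey s 0 T"
proof -
  interpret degenerate \<alpha> using assms by unfold_locales
  note T = assms(4) and \<tau> = assms(5,6) and s = assms(7,8)
  obtain v y where v: "\<And>n t. 0 < t \<Longrightarrow> (v n has_vector_derivative v (Suc n) t) (at t)"
    and vG: "\<And>n t. 0 < t \<Longrightarrow> v n t = - G (v (Suc n) t)"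
    and v0: "(v 0 \<longlongrightarrow> cls f0) (at_right 0)"
    and y: "\<And>n t. 0 < t \<Longrightarrow> (y n has_vector_derivative y (Suc n) t) (at t)"
    and vy: "\<And>m t. 0 < t \<Longrightarrow> (\<lambda>k. y (m + k) t *\<^sub>R PL k) sums v m t"
    and yb: "\<And>r. 0 < r \<Longrightarrow> \<exists>M>0. \<exists>R>0. \<forall>n. \<forall>t\<ge>r. \<bar>y n t\<bar> \<le> M * fact n / R ^ n"
    by (rule free_evolution[of "cls f0"]) blast
  obtain \<theta> where \<theta>: "deriv_family UNIV \<theta>" "gevrey_bound s UNIV \<theta>" "\<And>x. x \<le> 0 \<Longrightarrow> \<theta> 0 x = 0"
    "\<And>x. 1 \<le> x \<Longrightarrow> \<theta> 0 x = 1" "\<And>x. \<bar>\<theta> 0 x\<bar> \<le> 1"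
    by (rule gevrey_step_exists[OF s(1)]) blast

  \<comment> \<open>Cutoff of the free flat output\<close>
  define p1 where "p1 = (2 * \<tau> + T) / 3"
  define p2 where "p2 = (\<tau> + 2 * T) / 3"
  \<comment> \<open>These points cut [\<tau>, T] into thirds: the cutoff varies on the middle one
    only, so the flat output is the free one near \<tau> and zero near T.\<close>
  have p: "\<tau> < p1" "p1 < p2" "p2 < T" using \<tau> by (auto simp: p1_def p2_def)
  \<comment> \<open>The negative slope reverses the step: q (t - p2) runs from 1 at p1 down to 0 at
    p2.\<close>
  define q where "q = - (1 / (p2 - p1))"
  have q: "q < 0" using p by (simp add: q_def)
  let ?S = "{\<tau>..T}"
  have nb: "at t within ?S \<noteq> bot" if "t \<in> ?S" for t by (rule Icc_within_ne_bot[OF \<tau>(2) that])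
  define \<kappa> where "\<kappa> = affine_family q p2 \<theta>"
  have \<kappa>: "deriv_family ?S \<kappa>" "gevrey_bound s ?S \<kappa>"
    unfolding \<kappa>_def using q
    by (auto intro!: deriv_family_subset[OF deriv_family_affine[OF \<theta>(1)]] gevrey_bound_subset[OF gevrey_bound_affine[OF \<theta>(2)]])
  have \<kappa>1: "\<kappa> 0 t = 1" if "t < p1" for t
  proof -
    have "q * (t - p2) = (p2 - t) / (p2 - p1)" by (simp add: q_def diff_divide_distrib)
    also have "1 \<le> \<dots>" using that p by (simp add: field_simps)
    finally show ?thesis by (simp add: \<kappa>_def affine_family_0 \<theta>(4))
  qed
  have \<kappa>0: "\<kappa> 0 t = 0" if "p2 < t" for t
  proof -
    have "q * (t - p2) \<le> 0" using that q by (simp add: mult_nonpos_nonneg)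
    then show ?thesis by (simp add: \<kappa>_def affine_family_0 \<theta>(3))
  qed
  have dy: "deriv_family ?S y"
    using y \<tau> by (auto simp: deriv_family_def intro: has_vector_derivative_at_within)
  have gy: "gevrey_bound s ?S y"
  proof -
    obtain M R where MR: "0 < M" "0 < R" "\<And>n t. \<tau> \<le> t \<Longrightarrow> \<bar>y n t\<bar> \<le> M * fact n / R ^ n"
      using yb[OF \<tau>(1)] by blast
    have "\<bar>y n t\<bar> \<le> M * fact n powr s / R ^ n" if "t \<in> ?S" for n t
    proof -
      have "(fact n :: real) powr 1 \<le> fact n powr s" using s by (intro powr_mono) (auto simp: fact_ge_1)
      then have "M * fact n / R ^ n \<le> M * fact n powr s / R ^ n"
        using MR by (intro divide_right_mono mult_left_mono) auto
      then show ?thesis using MR(3)[of t n] that by simp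
    qed
    then show ?thesis unfolding gevrey_bound_def using MR(1,2) by blast
  qed
  define Y where "Y = leibniz \<kappa> y"
  have dY: "deriv_family ?S Y" unfolding Y_def by (rule deriv_family_leibniz[OF \<kappa>(1) dy])
  have gY: "gevrey_bound s ?S Y" unfolding Y_def using s by (intro gevrey_bound_leibniz \<kappa>(2) gy) simp
  have Yy: "Y n t = y n t" if "t \<in> ?S" "t < p1" for n t
  proof (rule deriv_family_eq_on_open[OF dY dy open_lessThan[of p1] nb])
    show "Y 0 t = y 0 t" if "t \<in> {..<p1}" for t using that by (simp add: Y_def leibniz_0 \<kappa>1)
  qed (use that in auto)
  have Y0: "Y n t = 0" if "t \<in> ?S" "p2 < t" for n t
  proof (rule deriv_family_eq_on_open[OF dY _ open_greaterThan[of p2] nb, where E = "\<lambda>_ _. 0"])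
    show "deriv_family ?S (\<lambda>_ _. 0)" by (simp add: deriv_family_def)
    show "Y 0 t = 0" if "t \<in> {p2<..}" for t using that by (simp add: Y_def leibniz_0 \<kappa>0)
  qed (use that in auto)
  have d: "0 < 2 - \<alpha>" using assms by simp
  \<comment> \<open>The derivatives of \<open>Y\<close> are summed against two sequences: the
    scalars \<open>bk k\<close> give the boundary value, the functions \<open>PL k\<close> the
    state.\<close>
  have c1: "norm (bk k) \<le> 1 / ((2 - \<alpha>) ^ (2 * k) * (fact k * fact k))" for k
    using bk_bounds[of k] by simp
  have c2: "norm (PL k) \<le> 1 / ((2 - \<alpha>) ^ (2 * k) * (fact k * fact k))" for k
    using norm_PL_le[of k] bk_bounds(2)[of k] by linarith
  have s0: "0 \<le> s" using s by simp
  obtain U where U: "\<And>n t. t \<in> ?S \<Longrightarrow> (\<lambda>k. Y (n + k) t *\<^sub>R bk k) sums U n t"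
    "\<And>n t. t \<in> ?S \<Longrightarrow> (U n has_vector_derivative U (Suc n) t) (at t within ?S)"
    "\<exists>M>0. \<exists>R>0. \<forall>n. \<forall>t\<in>?S. norm (U n t) \<le> M * fact n powr s / R ^ n"
    by (rule gevrey_series[OF convex_real_interval(5) dY gY s0 s(2) d c1]) blast
  obtain W where W: "\<And>n t. t \<in> ?S \<Longrightarrow> (\<lambda>k. Y (n + k) t *\<^sub>R PL k) sums W n t"
    "\<And>n t. t \<in> ?S \<Longrightarrow> (W n has_vector_derivative W (Suc n) t) (at t within ?S)"
    "\<exists>M>0. \<exists>R>0. \<forall>n. \<forall>t\<in>?S. norm (W n t) \<le> M * fact n powr s / R ^ n"
    by (rule gevrey_series[OF convex_real_interval(5) dY gY s0 s(2) d c2]) blast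
  have WU: "W n t = U n t *\<^sub>R PL 0 - G (W (Suc n) t)" if t: "t \<in> ?S" for n t
    by (rule flat_series_identity[where z = "\<lambda>k. Y (n + k) t"])
      (use W(1)[OF t, of n] W(1)[OF t, of "Suc n"] U(1)[OF t, of n] in simp_all)
  have Wv: "W n t = v n t" if t: "t \<in> ?S" "t < p1" for n t
    using W(1)[OF t(1), of n] vy[of t n] t \<tau> by (auto simp: Yy intro: sums_unique2)
  \<comment> \<open>Before p1 the state is the free one, for which v_n = - G v_(n+1); the identity
    \<open>WU\<close> then leaves only a multiple of the nonzero \<open>PL 0\<close>.\<close>
  have Uz: "U n t = 0" if t: "t \<in> ?S" "t < p1" for n t
  proof -
    have "U n t *\<^sub>R PL 0 = v n t + G (v (Suc n) t)" using WU[OF t(1), of n] by (simp add: Wv[OF t])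
    also have "\<dots> = 0" using vG[of t n] t \<tau> by simp
    finally show ?thesis using PL_0_nonzero by simp
  qed
  have within: "at t within {0..T} = at t within ?S" if "\<tau> < t" for t
    by (rule at_within_Icc_left) (use that \<tau> in auto)

  \<comment> \<open>The control and its derivatives\<close>
  define u where "u n t = (if t \<le> \<tau> then 0 else U n t)" for n t
  have u0: "u n t = 0" if "t \<le> T" "t < p1" for n t using that Uz[of t n] by (simp add: u_def)
  have du: "deriv_family {0..T} u"
    unfolding deriv_family_def
  proof (intro allI ballI)
    fix n t assume t: "t \<in> {0..T}"
    show "(u n has_vector_derivative u (Suc n) t) (at t within {0..T})"
    \<comment> \<open>The split is at p1 and not at \<tau>: zero and \<open>U n\<close> agree on
      (\<tau>, p1), so in each case a single formula holds on a whole neighbourhood of t.\<close>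
    proof (cases "t < p1")
      case True
      have "((\<lambda>_. 0) has_vector_derivative u (Suc n) t) (at t within {0..T})" using u0[of t] t True by simp
      then show ?thesis
        by (rule has_vector_derivative_transform_within[where d = "p1 - t"])
          (use t True in \<open>auto simp: u0 dist_real_def\<close>)
    next
      case False
      have "(U n has_vector_derivative u (Suc n) t) (at t within {0..T})"
        using False t p U(2)[of t n] by (simp add: within u_def)
      then show ?thesis
        by (rule has_vector_derivative_transform_within[where d = "t - \<tau>"])
          (use t False p in \<open>auto simp: u_def dist_real_def\<close>)
    qed
  qed
  have gu: "gevrey_bound s {0..T} u"
  proof -
    obtain M R where MR: "0 < M" "0 < R" "\<And>n t. t \<in> ?S \<Longrightarrow> \<bar>U n t\<bar> \<le> M * fact n powr s / R ^ n"
      using U(3) unfolding real_norm_def by blast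
    have "\<bar>u n t\<bar> \<le> M * fact n powr s / R ^ n" if "t \<in> {0..T}" for n t
      using MR that by (cases "t \<le> \<tau>") (auto simp: u_def)
    then show ?thesis unfolding gevrey_bound_def using MR(1,2) by blast
  qed

  \<comment> \<open>The controlled trajectory\<close>
  define F where "F t = (if t \<le> 0 then cls f0 else if t \<le> \<tau> then v 0 t else W 0 t)" for t
  define Fd where "Fd t = (if t \<le> \<tau> then v 1 t else W 1 t)" for t
  have Fv: "F t = v 0 t" "Fd t = v 1 t" if "0 < t" "t < p1" "t \<le> T" for t
    using that Wv[of t] by (auto simp: F_def Fd_def)
  have Fderiv: "(F has_vector_derivative Fd t) (at t within {0..T})" if t: "0 < t" "t \<le> T" for t
  proof (cases "t < p1")
    case True
    have "(v 0 has_vector_derivative Fd t) (at t within {0..T})"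
      using v[OF t(1), of 0] Fv[of t] t True by (simp add: has_vector_derivative_at_within)
    then show ?thesis
      by (rule has_vector_derivative_transform_within[where d = "min t (p1 - t)"])
        (use t True in \<open>auto simp: Fv dist_real_def\<close>)
  next
    case False
    have "(W 0 has_vector_derivative Fd t) (at t within {0..T})"
      using False t p W(2)[of t 0] by (simp add: within Fd_def)
    then show ?thesis
      by (rule has_vector_derivative_transform_within[where d = "t - \<tau>"])
        (use t False p \<tau> in \<open>auto simp: F_def dist_real_def\<close>)
  qed
  have F0: "F 0 = cls f0" by (simp add: F_def)
  have Fcont: "continuous_on {0..T} F"
    unfolding continuous_on_eq_continuous_within
  proof
    fix t assume t: "t \<in> {0..T}"
    show "continuous (at t within {0..T}) F"
    proof (cases "t = 0")
      case False
      then show ?thesis using Fderiv[of t] t by (intro has_vector_derivative_continuous) auto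
    next
      \<comment> \<open>At t = 0 only the limit of the free evolution is available.\<close>
      case True
      have "\<forall>\<^sub>F t in at_right 0. v 0 t = F t"
        unfolding eventually_at_right_field
        by (intro exI[of _ \<tau>]) (use \<tau> in \<open>auto simp: F_def\<close>)
      from Lim_transform_eventually[OF v0 this] show ?thesis
        unfolding True continuous_within at_within_Icc_at_right[OF T] F0 .
    qed
  qed
  have Feq: "F t = u 0 t *\<^sub>R ind 1 - G (Fd t)" if t: "0 < t" "t \<le> T" for t
  proof (cases "t \<le> \<tau>")
    case True
    then show ?thesis using vG[OF t(1), of 0] t by (simp add: F_def Fd_def u_def)
  next
    case False
    then show ?thesis using WU[of t 0] t by (simp add: F_def Fd_def u_def PL_0_eq)
  qed
  have ud: "(u 0 has_real_derivative u 1 t) (at t within {0..T})" if "t \<in> {0..T}" for t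
    using du that by (simp add: deriv_family_def has_real_derivative_iff_has_vector_derivative)
  have uc: "continuous_on {0..T} (u n)" for n
    using du unfolding deriv_family_def by (meson continuous_on_eq_continuous_within has_vector_derivative_continuous)
  have sol: "weak_solution \<alpha> T f0 (u 0) (\<lambda>t. rep (F t))"
  proof (rule weak_solution_of_evolution[OF T Fcont F0 assms(3) Fderiv Feq _ uc])
    show "u 0 \<in> Sobolev 1 0 T" by (rule C1_Sobolev[OF _ ud uc]) (use T in auto)
  qed
  \<comment> \<open>All derivatives of the flat output vanish at T, so every term of the series for
    the state is 0 there.\<close>
  have FT: "F T = 0"
  proof -
    have "T \<in> ?S" using \<tau> by simp
    from W(1)[OF this, of 0] have "(\<lambda>k. 0) sums W 0 T" using Y0[of T] p \<tau> by simp
    then have "W 0 T = 0" using sums_unique2 sums_zero by blast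
    then show ?thesis using T \<tau> by (simp add: F_def)
  qed
  show ?thesis
  proof (intro bexI[of _ "Y 0"] exI[of _ "u 0"] conjI ballI allI impI)
    show "Y 0 \<in> gevrey s \<tau> T" by (rule gevreyI(1)[OF \<tau>(2) dY gY]) simp
    show "u 0 \<in> gevrey s 0 T" by (rule gevreyI(1)[OF T du gu]) simp
    show "u 0 t = 0" if "t \<in> {0..\<tau>}" for t using that by (simp add: u_def)
    show "(\<lambda>k. nth_deriv {\<tau>..T} k (Y 0) t /
        ((2 - \<alpha>) ^ (2 * k) * fact k * (\<Prod>j=1..k. real j + (\<alpha> - 1) / (2 - \<alpha>)))) sums u 0 t"
      if t: "t \<in> {\<tau><..T}" for t
    proof -
      have tS: "t \<in> ?S" using t by simp
      have "nth_deriv {\<tau>..T} k (Y 0) t = Y k t" for k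
        by (rule gevreyI(2)[OF \<tau>(2) dY gY _ tS]) simp
      then show ?thesis using U(1)[OF tS, of 0] t by (simp add: bk_def u_def)
    qed
    show "\<exists>f. weak_solution \<alpha> T f0 (u 0) f" using sol by blast
    \<comment> \<open>Uniqueness transfers the final value of the constructed solution to an
      arbitrary one.\<close>
    fix f assume "weak_solution \<alpha> T f0 (u 0) f"
    from weak_solution_unique[OF T this sol] have "AE x in I01. f T x = rep 0 x" by (simp only: FT)
    then show "AE x in I01. f T x = 0" using rep_zero by eventually_elim simp
  qed
qed

end
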